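(* Suppose $0\le\beta<1/2$, and that either (1) $n\ge3$, $m\ge2$ and $\alpha\in\mathbb{N}$, or (2) $n=2$, $m\ge2$ and $\alpha=1$. Then there exists a constant $C>0$, depending on $\alpha,\beta,n$ and $m$, such that for every $k\in\mathbb{N}_0$ and every $g\in L^2(\Omega,d\Omega)$, $$\int_\Omega\left|\psi^{-\beta}(\phi)\,P_k\left(\psi^{-\beta}(\cdot)g\right)(\phi,\omega_1,\omega_2)\right|^2d\Omega\le C(k+1)^{\frac{2\alpha}{\alpha+1}}\int_\Omega|g|^2\,d\Omega.$$
   Context: $\mathbb{N}=\{1,2,\dots\}$, $\mathbb{N}_0=\{0,1,2,\dots\}$. Points of $\mathbb{R}^{n+m}$ are $(x,y)$, $x\in\mathbb{R}^n$, $y\in\mathbb{R}^m$. Polar coordinates $(\rho,\phi,\omega_1,\omega_2)$: $\rho=\left(|x|^{2(\alpha+1)}+(\alpha+1)^2|y|^2\right)^{\frac{1}{2(\alpha+1)}}$, $\phi\in[0,\pi/2]$ with $|x|=\rho\sin^{\frac1{\alpha+1}}\phi$, $|y|=\frac{1}{\alpha+1}\rho^{\alpha+1}\cos\phi$, $\omega_1=x/|x|\in\mathbb{S}^{n-1}$, $\omega_2=y/|y|\in\mathbb{S}^{m-1}$. The angle function is $\psi(\phi)=\sin^{\frac{2\alpha}{\alpha+1}}\phi$. $\Omega=\{\rho=1\}$ is equipped with $d\Omega=\sin^{\frac{n-2}{\alpha+1}+1}\phi\,\cos^{m-1}\phi\,d\phi\,d\omega_1\,d\omega_2$ ($d\omega_1,d\omega_2$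 surface measures on the spheres). Let $\{Y_{\ell,p}\}_{1\le p\le d_\ell(n)}$ be an orthonormal basis of the spherical harmonics of degree $\ell$ on $\mathbb{S}^{n-1}$ ($d_\ell(n)$ the dimension of that space), and similarly $\{Y_{j,q}\}_{1\le q\le d_j(m)}$ on $\mathbb{S}^{m-1}$. With $P_N^{(a,b)}$ the Jacobi polynomials, put $\widetilde{k}=\frac{k-\ell-j(\alpha+1)}{2(\alpha+1)}$, $\mu=\frac{n-2+2\ell}{2(\alpha+1)}$, $\gamma=j+\frac m2$, $h_{k,\ell,j}(\phi)=\cos^j\phi\,\sin^{\frac{\ell}{\alpha+1}}\phi\,P_{\widetilde k}^{(\mu,\gamma-1)}(\cos2\phi)$. $\mathcal{H}_k^\alpha$ (restricted to $\Omega$) is the span of $h_{k,\ell,j}(\phi)Y_{\ell,p}(\omega_1)Y_{j,q}(\omega_2)$ over all $0\le\ell,j\le k$ with $\widetilde k\in\mathbb{N}_0$ and all $p,q$; these functions are mutually orthogonal in $L^2(\Omega,d\Omega)$. $P_k:L^2(\Omega,d\Omega)\to\mathcal{H}_k^\alpha$ is the orthogonal projection, which is the integral operator $P_k(g)=\int_\Omega G_k(\cdot,\zeta)g(\zeta)\,d\Omega(\zeta)$ with $G_k(z,\zeta)=\sum_ie_i(z)\overline{e_i(\zeta)}$ for any orthonormal basis $\{e_i\}$ of $\mathcal{H}_k^\alpha$; this formula defines $P_k$ on $L^1(\Omega,d\Omega)$. *)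

theory Defs
  imports "HOL-Analysis.Analysis" "HOL-Library.Function_Algebras"
begin

section \<open>Complex function spaces and orthonormal bases\<close>

global_interpretation cfun: vector_space "\<lambda>(c::complex) (f::'a \<Rightarrow> complex) x. c * f x"
  defines cspan = cfun.span and cdim = cfun.dim
  by unfold_locales (auto simp: fun_eq_iff algebra_simps)

text \<open>
  Functions on a subset \<open>S\<close> of a Euclidean space are represented by functions on the whole
  space that vanish outside \<open>S\<close>, so that they form a complex vector space.
\<close>
definition on_set :: "'a set \<Rightarrow> ('a \<Rightarrow> complex) \<Rightarrow> ('a \<Rightarrow> complex)" where
  "on_set S f = (\<lambda>x. if x \<in> S then f x else 0)"

definition orthonormal_basis ::
  "'a measure \<Rightarrow> ('a \<Rightarrow> complex) set \<Rightarrow> (nat \<Rightarrow> 'a \<Rightarrow> complex) \<Rightarrow> bool" where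
  "orthonormal_basis M V e \<longleftrightarrow>
     (\<forall>p\<in>{1..cdim V}. \<forall>q\<in>{1..cdim V}.
        (LINT x|M. e p x * cnj (e q x)) = (if p = q then 1 else 0)) \<and>
     cspan (e ` {1..cdim V}) = V"

definition square_integrable :: "'a measure \<Rightarrow> ('a \<Rightarrow> complex) \<Rightarrow> bool" where
  "square_integrable M g \<longleftrightarrow>
     g \<in> borel_measurable M \<and> integrable M (\<lambda>x. (cmod (g x))\<^sup>2)"


section \<open>The sphere and spherical harmonics\<close>

text \<open>
  Surface measure on the unit sphere of a \<open>d\<close>-dimensional Euclidean space: the measure of \<open>A\<close> is
  \<open>d\<close> times the Lebesgue measure of the cone \<open>{t \<omega> | 0 < t < 1, \<omega> \<in> A}\<close>, which is what the formula
  for integration in polar coordinates prescribes. Here \<open>sgn x = x / |x|\<close>.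
\<close>
definition sphere_measure :: "'a::euclidean_space measure" where
  "sphere_measure = scale_measure (ennreal (real DIM('a)))
     (distr (restrict_space lborel (ball 0 1 - {0})) (restrict_space borel (sphere 0 1)) sgn)"

definition laplacian :: "('a::euclidean_space \<Rightarrow> complex) \<Rightarrow> 'a \<Rightarrow> complex" where
  "laplacian f x = (\<Sum>b\<in>Basis.
     vector_derivative (\<lambda>s. vector_derivative (\<lambda>t. f (x + t *\<^sub>R b)) (at s)) (at 0))"

definition solid_harmonics :: "nat \<Rightarrow> ('a::euclidean_space \<Rightarrow> complex) set" where
  "solid_harmonics l = {p. polynomial_function p \<and>
     (\<forall>t x. p (t *\<^sub>R x) = of_real (t ^ l) * p x) \<and> (\<forall>x. laplacian p x = 0)}"

definition spherical_harmonics :: "nat \<Rightarrow> ('a::euclidean_space \<Rightarrow> complex) set" where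
  "spherical_harmonics l = on_set (sphere 0 1) ` solid_harmonics l"

definition spherical_harmonic_bases :: "(nat \<Rightarrow> nat \<Rightarrow> 'a::euclidean_space \<Rightarrow> complex) \<Rightarrow> bool" where
  "spherical_harmonic_bases Y \<longleftrightarrow>
     (\<forall>l. orthonormal_basis sphere_measure (spherical_harmonics l) (Y l))"


section \<open>Polar coordinates and the measure on \<open>\<Omega>\<close>\<close>

definition rho :: "real \<Rightarrow> (real^'n) \<times> (real^'m) \<Rightarrow> real" where
  "rho \<alpha> = (\<lambda>(x, y). (norm x powr (2 * (\<alpha> + 1)) + (\<alpha> + 1)\<^sup>2 * (norm y)\<^sup>2) powr (1 / (2 * (\<alpha> + 1))))"

definition Omega :: "real \<Rightarrow> ((real^'n) \<times> (real^'m)) set" where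
  "Omega \<alpha> = {z. rho \<alpha> z = 1}"

text \<open>
  The angles \<open>\<omega>\<^sub>1 = x / |x|\<close> and \<open>\<omega>\<^sub>2 = y / |y|\<close> of a point \<open>(x, y)\<close> are \<open>sgn x\<close> and \<open>sgn y\<close>; they
  have the junk value 0 where \<open>x = 0\<close> or \<open>y = 0\<close>, which is a null subset of \<open>\<Omega>\<close>.
\<close>
definition angle :: "real \<Rightarrow> (real^'n) \<times> (real^'m) \<Rightarrow> real" where
  "angle \<alpha> z = arccos ((\<alpha> + 1) * norm (snd z) / rho \<alpha> z powr (\<alpha> + 1))"

definition polar_map :: "real \<Rightarrow> real \<times> (real^'n) \<times> (real^'m) \<Rightarrow> (real^'n) \<times> (real^'m)" where
  "polar_map \<alpha> = (\<lambda>(\<phi>, \<omega>\<^sub>1, \<omega>\<^sub>2).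
     ((sin \<phi> powr (1 / (\<alpha> + 1))) *\<^sub>R \<omega>\<^sub>1, (cos \<phi> / (\<alpha> + 1)) *\<^sub>R \<omega>\<^sub>2))"

definition polar_measure :: "real \<Rightarrow> (real \<times> (real^'n) \<times> (real^'m)) measure" where
  "polar_measure \<alpha> = density
     (restrict_space lborel {0..pi/2} \<Otimes>\<^sub>M (sphere_measure \<Otimes>\<^sub>M sphere_measure))
     (\<lambda>(\<phi>, \<omega>\<^sub>1, \<omega>\<^sub>2). ennreal (sin \<phi> powr ((real CARD('n) - 2) / (\<alpha> + 1) + 1)
                             * cos \<phi> ^ (CARD('m) - 1)))"

definition Omega_measure :: "real \<Rightarrow> ((real^'n) \<times> (real^'m)) measure" where
  "Omega_measure \<alpha> = distr (polar_measure \<alpha>) (restrict_space borel (Omega \<alpha>)) (polar_map \<alpha>)"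

text \<open>
  The next lemmas confirm that the polar coordinates parametrize \<open>\<Omega>\<close> and that the image measures
  above are taken along measurable maps (for others \<^const>\<open>distr\<close> is meaningless).
\<close>

lemma rho_polar_map:
  fixes \<omega>\<^sub>1 :: "real^'n" and \<omega>\<^sub>2 :: "real^'m"
  assumes "\<alpha> \<ge> 0" "\<phi> \<in> {0..pi/2}" "norm \<omega>\<^sub>1 = 1" "norm \<omega>\<^sub>2 = 1"
  shows "rho \<alpha> (polar_map \<alpha> (\<phi>, \<omega>\<^sub>1, \<omega>\<^sub>2)) = 1"
proof -
  have s: "sin \<phi> \<ge> 0" using assms by (auto intro: sin_ge_zero)
  have e: "(sin \<phi> powr (1 / (\<alpha> + 1))) powr (2 * (\<alpha> + 1)) = (sin \<phi>)\<^sup>2"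
  proof -
    have "1 / (\<alpha> + 1) * (2 * (\<alpha> + 1)) = 2" using assms(1) by (simp add: field_simps)
    then show ?thesis
      using s by (cases "sin \<phi> = 0") (simp_all add: powr_powr flip: powr_numeral)
  qed
  have "(\<alpha> + 1)\<^sup>2 * (\<bar>cos \<phi>\<bar> / (\<alpha> + 1))\<^sup>2 = (cos \<phi>)\<^sup>2"
    using assms(1) by (simp add: power_divide)
  then show ?thesis
    using assms e by (simp add: rho_def polar_map_def)
qed

lemma angle_polar_map:
  fixes \<omega>\<^sub>1 :: "real^'n" and \<omega>\<^sub>2 :: "real^'m"
  assumes "\<alpha> \<ge> 0" "\<phi> \<in> {0..pi/2}" "norm \<omega>\<^sub>1 = 1" "norm \<omega>\<^sub>2 = 1"
  shows "angle \<alpha> (polar_map \<alpha> (\<phi>, \<omega>\<^sub>1, \<omega>\<^sub>2)) = \<phi>"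
proof -
  have "cos \<phi> \<ge> 0" using assms by (auto intro: cos_ge_zero)
  then show ?thesis
    using assms by (simp add: angle_def rho_polar_map) (simp add: polar_map_def arccos_cos)
qed

lemma sgn_polar_map:
  assumes "\<alpha> \<ge> 0" "\<phi> \<in> {0<..<pi/2}" "norm \<omega>\<^sub>1 = 1" "norm \<omega>\<^sub>2 = 1"
  shows "sgn (fst (polar_map \<alpha> (\<phi>, \<omega>\<^sub>1, \<omega>\<^sub>2))) = \<omega>\<^sub>1"
    and "sgn (snd (polar_map \<alpha> (\<phi>, \<omega>\<^sub>1, \<omega>\<^sub>2))) = \<omega>\<^sub>2"
proof -
  have "sin \<phi> > 0" "cos \<phi> > 0"
    using assms by (auto intro: sin_gt_zero cos_gt_zero)
  then show "sgn (fst (polar_map \<alpha> (\<phi>, \<omega>\<^sub>1, \<omega>\<^sub>2))) = \<omega>\<^sub>1"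
    "sgn (snd (polar_map \<alpha> (\<phi>, \<omega>\<^sub>1, \<omega>\<^sub>2))) = \<omega>\<^sub>2"
    using assms by (auto simp: polar_map_def sgn_div_norm)
qed

lemma measurable_sgn_sphere:
  "sgn \<in> restrict_space lborel (ball 0 1 - {0}) \<rightarrow>\<^sub>M
         restrict_space borel (sphere (0::'a::euclidean_space) 1)"
proof (rule measurable_restrict_space2)
  show "sgn \<in> space (restrict_space lborel (ball 0 1 - {0::'a})) \<rightarrow> sphere 0 1"
    by (auto simp: space_restrict_space norm_sgn)
  have "(sgn :: 'a \<Rightarrow> 'a) \<in> borel_measurable borel"
    unfolding sgn_div_norm by measurable
  then show "sgn \<in> borel_measurable (restrict_space lborel (ball 0 1 - {0::'a}))"
    by (simp add: measurable_restrict_space1)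
qed

lemma space_sphere_measure: "space sphere_measure = sphere (0::'a::euclidean_space) 1"
  by (simp add: sphere_measure_def space_scale_measure space_restrict_space)

lemma sets_sphere_measure:
  "sets sphere_measure = sets (restrict_space borel (sphere (0::'a::euclidean_space) 1))"
  by (simp add: sphere_measure_def)

lemma measurable_polar_map:
  assumes "\<alpha> \<ge> 0"
  shows "(polar_map \<alpha> :: _ \<Rightarrow> (real^'n) \<times> (real^'m))
           \<in> polar_measure \<alpha> \<rightarrow>\<^sub>M restrict_space borel (Omega \<alpha>)"
proof (rule measurable_restrict_space2)
  let ?N = "restrict_space lborel {0..pi/2} \<Otimes>\<^sub>M
    ((sphere_measure :: (real^'n) measure) \<Otimes>\<^sub>M (sphere_measure :: (real^'m) measure))"
  have sp: "space (polar_measure \<alpha> :: (real \<times> (real^'n) \<times> (real^'m)) measure)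
      = {0..pi/2} \<times> sphere 0 1 \<times> sphere 0 1"
    by (simp add: polar_measure_def space_pair_measure space_sphere_measure space_restrict_space)
  show "(polar_map \<alpha> :: _ \<Rightarrow> (real^'n) \<times> (real^'m)) \<in> space (polar_measure \<alpha>) \<rightarrow> Omega \<alpha>"
    using assms by (auto simp: sp Omega_def intro!: rho_polar_map)
  have i: "(\<lambda>x. x) \<in> borel_measurable (sphere_measure :: 'b::euclidean_space measure)"
    by (subst measurable_cong_sets[OF sets_sphere_measure refl])
       (simp add: measurable_restrict_space1)
  have j: "(\<lambda>x. x) \<in> borel_measurable (restrict_space lborel {0..pi/2})"
    by (simp add: measurable_restrict_space1)
  have f: "fst \<in> borel_measurable ?N"
    by (rule measurable_compose[OF measurable_fst j])
  have g: "(\<lambda>z. fst (snd z)) \<in> borel_measurable ?N"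
    by (rule measurable_compose[OF measurable_snd measurable_compose[OF measurable_fst i]])
  have h: "(\<lambda>z. snd (snd z)) \<in> borel_measurable ?N"
    by (rule measurable_compose[OF measurable_snd measurable_compose[OF measurable_snd i]])
  note [measurable] = f g h
  have "(polar_map \<alpha> :: _ \<Rightarrow> (real^'n) \<times> (real^'m)) \<in> borel_measurable ?N"
    unfolding polar_map_def split_beta' by measurable
  then show "(polar_map \<alpha> :: _ \<Rightarrow> (real^'n) \<times> (real^'m)) \<in> borel_measurable (polar_measure \<alpha>)"
    by (simp add: polar_measure_def)
qed


section \<open>The spaces \<open>\<H>\<^sub>k\<^sup>\<alpha>\<close> and their projections\<close>

text \<open>Jacobi polynomials in the standard normalization \<open>P\<^sub>N\<^sup>(\<^sup>a\<^sup>,\<^sup>b\<^sup>)(1) = (N + a) gchoose N\<close>.\<close>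
definition jacobi :: "nat \<Rightarrow> real \<Rightarrow> real \<Rightarrow> real \<Rightarrow> real" where
  "jacobi N a b t = (\<Sum>s\<le>N. ((real N + a) gchoose (N - s)) * ((real N + b) gchoose s)
     * ((t - 1) / 2) ^ s * ((t + 1) / 2) ^ (N - s))"

definition ktilde :: "real \<Rightarrow> nat \<Rightarrow> nat \<Rightarrow> nat \<Rightarrow> real" where
  "ktilde \<alpha> k l j = (real k - real l - real j * (\<alpha> + 1)) / (2 * (\<alpha> + 1))"

text \<open>
  The factor \<open>sin\<^bsup>l/(\<alpha>+1)\<^esup> \<phi>\<close> is written as an \<open>l\<close>-th power because \<open>0 powr 0 = 0\<close>. The function
  is only used when \<open>ktilde \<alpha> k l j\<close> is a natural number.
\<close>
definition h_fun :: "nat \<Rightarrow> nat \<Rightarrow> real \<Rightarrow> nat \<Rightarrow> nat \<Rightarrow> nat \<Rightarrow> real \<Rightarrow> real" where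
  "h_fun n m \<alpha> k l j \<phi> =
     (let \<mu> = (real n - 2 + 2 * real l) / (2 * (\<alpha> + 1)); \<gamma> = real j + real m / 2
      in cos \<phi> ^ j * (sin \<phi> powr (1 / (\<alpha> + 1))) ^ l
           * jacobi (nat \<lfloor>ktilde \<alpha> k l j\<rfloor>) \<mu> (\<gamma> - 1) (cos (2 * \<phi>)))"

definition H_space :: "real \<Rightarrow> (nat \<Rightarrow> nat \<Rightarrow> real^'n \<Rightarrow> complex) \<Rightarrow> (nat \<Rightarrow> nat \<Rightarrow> real^'m \<Rightarrow> complex)
    \<Rightarrow> nat \<Rightarrow> ((real^'n) \<times> (real^'m) \<Rightarrow> complex) set" where
  "H_space \<alpha> Y Z k = cspan
     {on_set (Omega \<alpha>) (\<lambda>z. of_real (h_fun CARD('n) CARD('m) \<alpha> k l j (angle \<alpha> z))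
                               * Y l p (sgn (fst z)) * Z j q (sgn (snd z))) | l j p q.
        l \<le> k \<and> j \<le> k \<and> ktilde \<alpha> k l j \<in> \<nat> \<and>
        p \<in> {1..cdim (spherical_harmonics l :: (real^'n \<Rightarrow> complex) set)} \<and>
        q \<in> {1..cdim (spherical_harmonics j :: (real^'m \<Rightarrow> complex) set)}}"

text \<open>The kernel does not depend on the choice of the orthonormal basis.\<close>
definition G_kernel :: "real \<Rightarrow> (nat \<Rightarrow> nat \<Rightarrow> real^'n \<Rightarrow> complex) \<Rightarrow> (nat \<Rightarrow> nat \<Rightarrow> real^'m \<Rightarrow> complex)
    \<Rightarrow> nat \<Rightarrow> (real^'n) \<times> (real^'m) \<Rightarrow> (real^'n) \<times> (real^'m) \<Rightarrow> complex" where
  "G_kernel \<alpha> Y Z k z \<zeta> =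
     (let e = (SOME e. orthonormal_basis (Omega_measure \<alpha>) (H_space \<alpha> Y Z k) e)
      in \<Sum>i\<in>{1..cdim (H_space \<alpha> Y Z k)}. e i z * cnj (e i \<zeta>))"

definition P_proj :: "real \<Rightarrow> (nat \<Rightarrow> nat \<Rightarrow> real^'n \<Rightarrow> complex) \<Rightarrow> (nat \<Rightarrow> nat \<Rightarrow> real^'m \<Rightarrow> complex)
    \<Rightarrow> nat \<Rightarrow> ((real^'n) \<times> (real^'m) \<Rightarrow> complex) \<Rightarrow> (real^'n) \<times> (real^'m) \<Rightarrow> complex" where
  "P_proj \<alpha> Y Z k g z = (LINT \<zeta>|Omega_measure \<alpha>. G_kernel \<alpha> Y Z k z \<zeta> * g \<zeta>)"

definition psi :: "real \<Rightarrow> real \<Rightarrow> real" where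
  "psi \<alpha> \<phi> = sin \<phi> powr (2 * \<alpha> / (\<alpha> + 1))"

text \<open>
  The weight \<open>\<psi>\<^bsup>-\<beta>\<^esup>\<close> on \<open>\<Omega>\<close>. Where \<open>\<psi> = 0\<close>, that is, on the null set \<open>\<phi> = 0\<close>, it has the junk
  value 0.
\<close>
definition psi_weight :: "real \<Rightarrow> real \<Rightarrow> (real^'n) \<times> (real^'m) \<Rightarrow> complex" where
  "psi_weight \<alpha> \<beta> z = of_real (psi \<alpha> (angle \<alpha> z) powr (- \<beta>))"

end

(*
  P_k splits into rank-one projections onto the functions h(phi) Y(omega_1) Z(omega_2), and a weight
  that depends on phi only keeps these functions mutually orthogonal. Hence the norm of
  psi^(-beta) P_k psi^(-beta) is the largest of the ratios
  <psi^(-2 beta)> = (int psi^(-2 beta) h^2) / (int h^2) of radial integrals, and since psi <= 1 it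
  suffices to show <1/psi> <= C (k+1)^(alpha/(alpha+1)); the theorem is the square of this bound.

  Let N be the degree and (a, b) the parameters of the Jacobi polynomial P in h. As P is orthogonal to
  all polynomials of lower degree, one integration by parts gives <cot^2 phi> = (2 N + b + 1) / a for
  a > 0, and interpolating between <1> and <sin^(-2) phi> gives the claim. The value a = 0 only occurs
  for n = 2, alpha = 1, l = 0. There the same integration by parts computes P(1)^2 / <1>, and Sonin's
  monotonicity argument bounds P^2 by P(1)^2 near phi = 0, which suffices because 1/psi = 1/sin phi.
*)
theory Submission
  imports Defs "HOL-Computational_Algebra.Polynomial"
begin

section \<open>Jacobi polynomials\<close>

text \<open>Three points shape the proof. (1) \<open>spherical_harmonic_bases\<close> speaks about
  each degree separately, so orthogonality of different degrees has to be proved. As the sphere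
  carries only a measure defined by cones, Green's identity is used in the ball, and homogeneity
  carries the result to the sphere. (2) \<open>G_kernel\<close> is formed from an unspecified
  orthonormal basis. The passage from radial integrals to the operator is therefore a duality
  argument valid for every such basis: a bound A for the quadratic form of the squared weight on the
  space gives the norm bound A for weight, projection, weight. (3) The constant must be uniform in l
  and j. With M = 2 j + m - 1 the mean of cot^2 is (M + 1 + 4 N) / (2 a); here 2 N + j \<le> k, and
  a positive a is at least 1 / (2 (\<alpha> + 1)). So <sin^(-2)> is of order k + 1, and
  interpolation with exponent \<alpha> / (\<alpha> + 1) gives the required power. For a = 0 the
  integral behind <sin^(-2)> diverges logarithmically, as P(1) is not 0; hence the separate
  argument.\<close>

definition jacobi_poly :: "nat \<Rightarrow> real \<Rightarrow> real \<Rightarrow> real poly" where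
  "jacobi_poly N a b = (\<Sum>s\<le>N. smult (((real N + a) gchoose (N - s)) * ((real N + b) gchoose s))
     ([:0, 1:] ^ s * [:1, 1:] ^ (N - s)))"

lemma poly_jacobi_poly: "poly (jacobi_poly N a b) x = jacobi N a b (1 + 2 * x)"
  by (simp add: jacobi_poly_def jacobi_def poly_sum algebra_simps add_divide_distrib)

lemma degree_jacobi_poly: "degree (jacobi_poly N a b) \<le> N"
  unfolding jacobi_poly_def
proof (intro degree_sum_le)
  fix s assume s: "s \<in> {..N}"
  have "degree ([:0, 1:] ^ s * [:1, 1::real:] ^ (N - s)) \<le> degree ([:0, 1::real:] ^ s) + degree ([:1, 1::real:] ^ (N - s))"
    by (rule degree_mult_le)
  also have "\<dots> \<le> s + (N - s)"
    by (intro add_mono) (use degree_power_le[of "[:0,1::real:]" s] degree_power_le[of "[:1,1::real:]" "N-s"] in simp_all)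
  finally show "degree (smult (((real N + a) gchoose (N - s)) * ((real N + b) gchoose s))
     ([:0, 1:] ^ s * [:1, 1:] ^ (N - s))) \<le> N"
    using s degree_smult_le by (metis atMost_iff le_add_diff_inverse order_trans)
qed simp

text \<open>
  The Jacobi differential operator in the variable \<open>x = (t - 1) / 2\<close>, which is \<open>- sin\<^sup>2 \<phi>\<close> for
  \<open>t = cos (2 \<phi>)\<close>.
\<close>
definition jacobi_op :: "real \<Rightarrow> real \<Rightarrow> real poly \<Rightarrow> real poly" where
  "jacobi_op a b p = [:0, 1, 1:] * pderiv (pderiv p) + [:a + 1, a + b + 2:] * pderiv p"

section \<open>The differential equation of the Jacobi polynomials\<close>

lemma jacobi_op_add: "jacobi_op a b (p + q) = jacobi_op a b p + jacobi_op a b q"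
  by (simp only: jacobi_op_def pderiv_add distrib_left distrib_right ac_simps)

lemma jacobi_op_smult: "jacobi_op a b (smult c p) = smult c (jacobi_op a b p)"
  by (simp add: jacobi_op_def pderiv_smult smult_add_right)

lemma jacobi_op_sum: "jacobi_op a b (\<Sum>i\<in>I. f i) = (\<Sum>i\<in>I. jacobi_op a b (f i))"
  by (induction I rule: infinite_finite_induct) (simp_all add: jacobi_op_add, simp_all add: jacobi_op_def pderiv_0)

text \<open>Ratios of neighbouring binomial coefficients, one for each factor of \<open>c\<close>.
  In \<open>jacobi_ode\<close> this recurrence brings the terms with shifted index back to the
  common products \<open>?T s\<close>.\<close>

lemma jacobi_coeff_step:
  fixes a b :: real
  assumes "s < N"
  defines "c \<equiv> \<lambda>s. ((real N + a) gchoose (N - s)) * ((real N + b) gchoose s)"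
  shows "c (Suc s) * (real s + 1) * (real s + 1 + a) = c s * (real N - real s) * (real N + b - real s)"
proof -
  obtain r where r: "N - s = Suc r" "N - Suc s = r" "real N = real s + r + 1"
    using assms(1) by (metis Suc_diff_Suc add.commute add.left_commute le_add_diff_inverse less_imp_le_nat of_nat_Suc of_nat_add)
  have 1: "(real N + a gchoose Suc r) * (real r + 1) = (real N + a gchoose r) * (real N + a - r)"
    using gbinomial_mult_1[of "real N + a" r] by (simp add: algebra_simps)
  have 2: "(real N + b gchoose Suc s) * (real s + 1) = (real N + b gchoose s) * (real N + b - s)"
    using gbinomial_mult_1[of "real N + b" s] by (simp add: algebra_simps)
  have "c (Suc s) * (real s + 1) * (real s + 1 + a) = ((real N + a gchoose r) * (real N + a - r)) * ((real N + b gchoose Suc s) * (real s + 1))"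
    unfolding c_def r(2) by (simp add: r(3) algebra_simps)
  also have "\<dots> = c s * (real N - real s) * (real N + b - real s)"
    unfolding 1[symmetric] 2 c_def r(1) using assms(1) by (simp add: r(3) algebra_simps)
  finally show ?thesis .
qed

text \<open>The products x^s (1 + x)^r are adapted to the singular points 0 and -1 of the operator:
  it maps them to products with the same s + r, so for r = N - s the eigenvalue equation becomes a
  recurrence in s alone. Where the exponents s - 1 or r - 1 are truncated, their coefficient is
  0.\<close>

lemma poly_jacobi_op_product:
  fixes a b x :: real shows
  "poly (jacobi_op a b ([:0, 1:] ^ s * [:1, 1:] ^ r)) x =
     s * (s + a) * x ^ (s - 1) * (x + 1) ^ (r + 1) + r * (r + b) * x ^ (s + 1) * (x + 1) ^ (r - 1)
     + (2 * s * r + (b + 1) * s + (a + 1) * r) * x ^ s * (x + 1) ^ r"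
proof -
  define f f' f'' where "f = [:0, 1::real:] ^ s" and "f' = pderiv f" and "f'' = pderiv f'"
  define g g' g'' where "g = [:1, 1::real:] ^ r" and "g' = pderiv g" and "g'' = pderiv g'"
  have f: "poly f x = x ^ s" "poly f' x = s * x ^ (s - 1)" "poly f'' x = s * ((s - 1) * x ^ (s - 2))"
    by (simp_all add: f_def f'_def f''_def pderiv_power pderiv_pCons pderiv_smult of_nat_diff numeral_2_eq_2)
  have g: "poly g x = (x + 1) ^ r" "poly g' x = r * (x + 1) ^ (r - 1)" "poly g'' x = r * ((r - 1) * (x + 1) ^ (r - 2))"
    by (simp_all add: g_def g'_def g''_def pderiv_power pderiv_pCons pderiv_smult of_nat_diff numeral_2_eq_2 add.commute)
  have 1: "x * poly f' x = s * poly f x" "(x + 1) * poly g' x = r * poly g x"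
    unfolding f g by (cases s; cases r; simp)+
  have 2: "x * poly f'' x = (real s - 1) * poly f' x"
    unfolding f by (cases s; cases "s - 1"; simp add: algebra_simps)
  have 3: "(x + 1) * poly g'' x = (real r - 1) * poly g' x"
    unfolding g by (cases r; cases "r - 1"; simp add: algebra_simps)
  have "poly (jacobi_op a b (f * g)) x =
      (x + 1) * poly g x * (x * poly f'' x) + 2 * (x * poly f' x) * ((x + 1) * poly g' x)
      + x * poly f x * ((x + 1) * poly g'' x)
      + (b + 1) * ((x * poly f' x) * poly g x) + (a + 1) * (poly f x * ((x + 1) * poly g' x))
      + (b + 1) * x * poly f x * poly g' x + (a + 1) * (x + 1) * poly f' x * poly g x"
    by (simp add: jacobi_op_def pderiv_mult pderiv_add f'_def f''_def g'_def g''_def algebra_simps)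
  also have "\<dots> = (s + a) * poly f' x * ((x + 1) * poly g x) + (r + b) * (x * poly f x) * poly g' x
      + (2 * s * r + (b + 1) * s + (a + 1) * r) * poly f x * poly g x"
    unfolding 1 2 3 by (simp add: algebra_simps)
  finally show ?thesis
    unfolding f g by (simp add: f_def g_def algebra_simps)
qed

lemma jacobi_ode:
  fixes a b :: real
  shows "jacobi_op a b (jacobi_poly N a b) = smult (N * (N + a + b + 1)) (jacobi_poly N a b)"
proof (rule iffD1[OF poly_eq_poly_eq_iff, OF ext])
  fix x :: real
  define c where "c s = ((real N + a) gchoose (N - s)) * ((real N + b) gchoose s)" for s
  have step: "c (Suc s) * (real s + 1) * (real s + 1 + a) = c s * (real N - real s) * (real N + b - real s)" if "s < N" for s
    using jacobi_coeff_step[OF that, of a b] by (simp add: c_def)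
  let ?T = "\<lambda>s. x ^ s * (x + 1) ^ (N - s)"
  have 1: "(\<Sum>s\<le>N. c s * (s * (s + a) * x ^ (s - 1) * (x + 1) ^ (N - s + 1)))
      = (\<Sum>s\<le>N. c s * (real N - real s) * (real N + b - real s) * ?T s)"
  proof -
    have "(\<Sum>s\<le>N. c s * (s * (s + a) * x ^ (s - 1) * (x + 1) ^ (N - s + 1)))
        = (\<Sum>s<N. c (Suc s) * (real s + 1) * (real s + 1 + a) * ?T s)"
      unfolding sum.atMost_shift
      by (simp, rule sum.cong) (auto simp: algebra_simps Suc_diff_Suc simp flip: power_Suc)
    also have "\<dots> = (\<Sum>s<N. c s * (real N - real s) * (real N + b - real s) * ?T s)"
      by (rule sum.cong) (simp_all add: step)
    \<comment> \<open>The added term s = N carries the factor N - s = 0.\<close>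
    also have "\<dots> = (\<Sum>s<Suc N. c s * (real N - real s) * (real N + b - real s) * ?T s)" by simp
    finally show ?thesis by (simp only: lessThan_Suc_atMost)
  qed
  have 2: "(\<Sum>s\<le>N. c s * (real (N - s) * (real (N - s) + b) * x ^ (s + 1) * (x + 1) ^ (N - s - 1)))
      = (\<Sum>s\<le>N. c s * s * (s + a) * ?T s)"
  proof -
    have "(\<Sum>s\<le>N. c s * (real (N - s) * (real (N - s) + b) * x ^ (s + 1) * (x + 1) ^ (N - s - 1)))
        = (\<Sum>s<N. c s * (real N - real s) * (real N + b - real s) * ?T (Suc s))"
      unfolding lessThan_Suc_atMost[symmetric] sum.lessThan_Suc
      by (simp, rule sum.cong) (auto simp: algebra_simps of_nat_diff)
    also have "\<dots> = (\<Sum>s<N. c (Suc s) * (real s + 1) * (real s + 1 + a) * ?T (Suc s))"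
      by (rule sum.cong) (simp_all add: step)
    also have "\<dots> = (\<Sum>s\<le>N. c s * s * (s + a) * ?T s)"
      unfolding sum.atMost_shift by (simp add: algebra_simps)
    finally show ?thesis .
  qed
  have "poly (jacobi_op a b (jacobi_poly N a b)) x
     = (\<Sum>s\<le>N. c s * (s * (s + a) * x ^ (s - 1) * (x + 1) ^ (N - s + 1)))
     + (\<Sum>s\<le>N. c s * (real (N - s) * (real (N - s) + b) * x ^ (s + 1) * (x + 1) ^ (N - s - 1)))
     + (\<Sum>s\<le>N. c s * (2 * s * real (N - s) + (b + 1) * s + (a + 1) * real (N - s)) * ?T s)"
    unfolding jacobi_poly_def jacobi_op_sum jacobi_op_smult poly_sum poly_smult poly_jacobi_op_product
      sum.distrib[symmetric] c_def[symmetric]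
    by (rule sum.cong[OF refl]) (simp only: distrib_left distrib_right mult.assoc of_nat_mult of_nat_numeral)
  \<comment> \<open>For each s the coefficients (N - s) (N + b - s), s (s + a) and 2 s (N - s) + (b
    + 1) s + (a + 1) (N - s) add up to the eigenvalue; the dependence on s cancels.\<close>
  also have "\<dots> = (\<Sum>s\<le>N. c s * (N * (N + a + b + 1)) * ?T s)"
    unfolding 1 2 sum.distrib[symmetric]
    by (rule sum.cong) (auto simp: of_nat_diff algebra_simps)
  also have "\<dots> = poly (smult (N * (N + a + b + 1)) (jacobi_poly N a b)) x"
    unfolding jacobi_poly_def poly_smult poly_sum sum_distrib_left
    by (rule sum.cong) (auto simp: c_def algebra_simps)
  finally show "poly (jacobi_op a b (jacobi_poly N a b)) x = poly (smult (N * (N + a + b + 1)) (jacobi_poly N a b)) x" .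
qed

text \<open>On monomials the operator is triangular, and its diagonal entries are the eigenvalues.
  The induction in \<open>jacobi_orthogonal_monom\<close> runs along this form.\<close>

lemma jacobi_op_monom:
  fixes a b :: real shows
  "jacobi_op a b (monom 1 (Suc d)) =
     smult (Suc d * (Suc d + a + b + 1)) (monom 1 (Suc d)) + smult (Suc d * (Suc d + a)) (monom 1 d)"
  by (rule iffD1[OF poly_eq_poly_eq_iff, OF ext])
     (cases d; simp add: jacobi_op_def pderiv_monom poly_monom algebra_simps)

section \<open>Integrals against the Jacobi weight in the angle variable\<close>

lemma sin_cos_pos: "\<phi> \<in> {0<..<pi/2} \<Longrightarrow> sin \<phi> > 0 \<and> cos \<phi> > 0"
  by (auto intro: sin_gt_zero cos_gt_zero)

lemma sin_cos_nonneg: "\<phi> \<in> {0..pi/2} \<Longrightarrow> sin \<phi> \<ge> 0 \<and> cos \<phi> \<ge> 0"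
  by (auto intro: sin_ge_zero cos_ge_zero)

lemma FTC_set_lborel:
  fixes F f :: "real \<Rightarrow> real"
  assumes "u \<le> v" "continuous_on {u..v} F"
    and "\<And>x. x \<in> {u<..<v} \<Longrightarrow> (F has_real_derivative f x) (at x)"
    and "set_integrable lborel {u..v} f"
  shows "(LINT x:{u..v}|lborel. f x) = F v - F u"
proof -
  have "(f has_integral F v - F u) {u..v}"
    using assms by (intro fundamental_theorem_of_calculus_interior) (auto simp: has_real_derivative_iff_has_vector_derivative)
  then show ?thesis
    using set_borel_integral_eq_integral(2)[OF assms(4)] by (simp add: integral_unique)
qed

text \<open>A nonnegative derivative is Henstock-Kurzweil integrable by the fundamental theorem,
  hence absolutely integrable. This serves integrands that are unbounded at an end point, where only
  the antiderivative is known to be continuous.\<close>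

lemma FTC_set_lborel_nonneg:
  fixes F f :: "real \<Rightarrow> real"
  assumes "u \<le> v" "continuous_on {u..v} F"
    and "\<And>x. x \<in> {u<..<v} \<Longrightarrow> (F has_real_derivative f x) (at x)"
    and [measurable]: "f \<in> borel_measurable borel" and "\<And>x. x \<in> {u..v} \<Longrightarrow> f x \<ge> 0"
  shows "set_integrable lborel {u..v} f"
proof -
  have "(f has_integral F v - F u) {u..v}"
    using assms by (intro fundamental_theorem_of_calculus_interior) (auto simp: has_real_derivative_iff_has_vector_derivative)
  then have "f absolutely_integrable_on {u..v}"
    using assms by (intro nonnegative_absolutely_integrable_1) auto
  then show ?thesis
    unfolding set_integrable_def by (subst (asm) integrable_completion) auto
qed

text \<open>The weight (-x)^a (1 + x)^b dx of the Jacobi polynomials under x = - sin^2 \<phi>, up to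
  the factor 2, when M = 2 b + 1. The cosine has a natural exponent because 2 b is an integer in the
  application.\<close>

definition jacobi_weight :: "real \<Rightarrow> nat \<Rightarrow> real \<Rightarrow> real" where
  "jacobi_weight a M \<phi> = sin \<phi> powr (2 * a + 1) * cos \<phi> ^ M"

definition jacobi_integral :: "real \<Rightarrow> nat \<Rightarrow> real poly \<Rightarrow> real" where
  "jacobi_integral a M p = (LINT \<phi>:{0..pi/2}|lborel. jacobi_weight a M \<phi> * poly p (- (sin \<phi>)\<^sup>2))"

lemma continuous_on_sin_powr: "r > 0 \<Longrightarrow> continuous_on {0..pi/2} (\<lambda>\<phi>::real. sin \<phi> powr r)"
  by (intro continuous_on_powr' continuous_intros) (auto dest: sin_cos_nonneg)

lemma continuous_on_jacobi_weight: "a \<ge> 0 \<Longrightarrow> continuous_on {0..pi/2} (jacobi_weight a M)"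
  unfolding jacobi_weight_def by (intro continuous_intros continuous_on_sin_powr) auto

lemma jacobi_weight_nonneg: "\<phi> \<in> {0..pi/2} \<Longrightarrow> jacobi_weight a M \<phi> \<ge> 0"
  using sin_cos_nonneg[of \<phi>] by (simp add: jacobi_weight_def)

lemma set_integrable_jacobi:
  assumes "a \<ge> 0"
  shows "set_integrable lborel {0..pi/2} (\<lambda>\<phi>. jacobi_weight a M \<phi> * poly p (- (sin \<phi>)\<^sup>2))"
  using assms unfolding set_integrable_def
  by (intro borel_integrable_compact continuous_intros continuous_on_jacobi_weight compact_Icc)

lemma jacobi_integral_add: "a \<ge> 0 \<Longrightarrow> jacobi_integral a M (p + q) = jacobi_integral a M p + jacobi_integral a M q"
  unfolding jacobi_integral_def by (simp add: distrib_left set_integral_add set_integrable_jacobi)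

lemma jacobi_integral_smult: "jacobi_integral a M (smult c p) = c * jacobi_integral a M p"
  unfolding jacobi_integral_def by (simp add: mult.left_commute)

lemma jacobi_integral_diff: "a \<ge> 0 \<Longrightarrow> jacobi_integral a M (p - q) = jacobi_integral a M p - jacobi_integral a M q"
  using jacobi_integral_add[of a M p "smult (-1) q"] jacobi_integral_smult[of a M "-1" q] by simp

lemma jacobi_integral_sum: "a \<ge> 0 \<Longrightarrow> jacobi_integral a M (\<Sum>i\<in>I. f i) = (\<Sum>i\<in>I. jacobi_integral a M (f i))"
proof (induction I rule: infinite_finite_induct)
  case (insert i I)
  then show ?case by (simp add: jacobi_integral_add)
qed (simp_all add: jacobi_integral_def)

lemma DERIV_sin_powr_cos_poly:
  assumes "\<phi> \<in> {0<..<pi/2}"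
  shows "((\<lambda>\<phi>. sin \<phi> powr r * cos \<phi> ^ Suc n * poly p (- (sin \<phi>)\<^sup>2)) has_real_derivative
    sin \<phi> powr (r - 1) * cos \<phi> ^ n * ((r * (cos \<phi>)\<^sup>2 - Suc n * (sin \<phi>)\<^sup>2) * poly p (- (sin \<phi>)\<^sup>2)
      - 2 * (sin \<phi>)\<^sup>2 * (cos \<phi>)\<^sup>2 * poly (pderiv p) (- (sin \<phi>)\<^sup>2))) (at \<phi>)"
proof -
  have s: "sin \<phi> > 0" and c: "cos \<phi> > 0" using sin_cos_pos[OF assms] by auto
  have p: "((\<lambda>\<phi>. poly p (- (sin \<phi>)\<^sup>2)) has_real_derivative poly (pderiv p) (- (sin \<phi>)\<^sup>2) * (- 2 * sin \<phi> * cos \<phi>)) (at \<phi>)"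
    by (rule DERIV_chain2[OF poly_DERIV]) (auto intro!: derivative_eq_intros)
  have e: "sin \<phi> powr r = sin \<phi> powr (r - 1) * sin \<phi>"
    using s by (simp add: powr_diff)
  have q: "((\<lambda>\<phi>. cos \<phi> ^ Suc n) has_real_derivative Suc n * cos \<phi> ^ n * (- sin \<phi>)) (at \<phi>)"
    by (rule DERIV_cong[OF DERIV_power[OF DERIV_cos]]) simp
  have g: "((\<lambda>\<phi>. sin \<phi> powr r) has_real_derivative r * sin \<phi> powr (r - 1) * cos \<phi>) (at \<phi>)"
    using s by (auto intro!: derivative_eq_intros)
  show ?thesis
    by (rule DERIV_cong[OF DERIV_mult[OF DERIV_mult[OF g q] p]])
       (simp add: e algebra_simps power2_eq_square)
qed

lemma continuous_on_sin_powr_cos_poly: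
  "r > 0 \<Longrightarrow> continuous_on {0..pi/2} (\<lambda>\<phi>::real. sin \<phi> powr r * cos \<phi> ^ n * poly p (- (sin \<phi>)\<^sup>2))"
  by (intro continuous_intros continuous_on_sin_powr)

text \<open>Sturm-Liouville form: the weight times \<open>jacobi_op a b p\<close> is the
  x-derivative of the weight times x (1 + x) p'. The boundary term \<open>?F\<close> vanishes at 0
  because of the sine and at pi/2 because of the cosine.\<close>

lemma jacobi_integral_ibp:
  assumes "a \<ge> 0" and M: "real M = 2 * b + 1"
  shows "jacobi_integral a M (jacobi_op a b p * q) = - jacobi_integral a M ([:0, 1, 1:] * pderiv p * pderiv q)"
proof -
  let ?F = "\<lambda>\<phi>::real. sin \<phi> powr (2 * a + 2) * cos \<phi> ^ Suc M * poly (pderiv p * q) (- (sin \<phi>)\<^sup>2)"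
  let ?g = "smult 2 (jacobi_op a b p * q + [:0, 1, 1:] * pderiv p * pderiv q)"
  let ?f = "\<lambda>\<phi>. jacobi_weight a M \<phi> * poly ?g (- (sin \<phi>)\<^sup>2)"
  have "jacobi_integral a M ?g = ?F (pi/2) - ?F 0"
    unfolding jacobi_integral_def
  proof (rule FTC_set_lborel)
    show "set_integrable lborel {0..pi/2} ?f"
      by (rule set_integrable_jacobi) fact
    show "continuous_on {0..pi/2} ?F"
      using assms by (intro continuous_on_sin_powr_cos_poly) auto
    fix \<phi> assume \<phi>: "\<phi> \<in> {0<..<pi/2}"
    have c: "(cos \<phi>)\<^sup>2 = 1 - (sin \<phi>)\<^sup>2" by (simp add: cos_squared_eq)
    have M': "real (Suc M) = 2 * b + 2" using M by simp
    show "(?F has_real_derivative ?f \<phi>) (at \<phi>)"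
      by (rule DERIV_cong[OF DERIV_sin_powr_cos_poly[OF \<phi>]])
         (simp only: M' c jacobi_weight_def, simp add: jacobi_op_def pderiv_mult algebra_simps power2_eq_square)
  qed simp
  then have "jacobi_integral a M ?g = 0" by simp
  then show ?thesis
    using assms(1) by (simp add: jacobi_integral_smult jacobi_integral_add)
qed

section \<open>Orthogonality of the Jacobi polynomials\<close>

lemma jacobi_op_symmetric:
  assumes "a \<ge> 0" "real M = 2 * b + 1"
  shows "jacobi_integral a M (jacobi_op a b p * q) = jacobi_integral a M (p * jacobi_op a b q)"
  using jacobi_integral_ibp[OF assms, of p q] jacobi_integral_ibp[OF assms, of q p]
  by (simp only: mult.commute mult.left_commute)

text \<open>By symmetry the integral of P x^d can be multiplied by the eigenvalue of P or by that of
  degree d, the latter up to a multiple of the integral for d - 1, which is 0 by induction. The two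
  eigenvalues differ.\<close>

lemma jacobi_orthogonal_monom:
  assumes "a \<ge> 0" "real M = 2 * b + 1" "d < N"
  shows "jacobi_integral a M (jacobi_poly N a b * monom 1 d) = 0"
  using assms(3)
proof (induction d)
  have pos: "real N * (N + a + b + 1) \<noteq> d * (d + a + b + 1)" if "d < N" for d :: nat
  proof -
    have "real d * (d + a + b + 1) \<le> d * (N + a + b + 1)" using that by (intro mult_left_mono) auto
    \<comment> \<open>The factor N + a + b + 1 is positive because 2 b + 1 = M \<ge> 0.\<close>
    also have "\<dots> < N * (N + a + b + 1)" using that assms by (intro mult_strict_right_mono) auto
    finally show ?thesis by simp
  qed
  let ?I = "\<lambda>d. jacobi_integral a M (jacobi_poly N a b * monom 1 d)"
  have sym: "N * (N + a + b + 1) * ?I d = jacobi_integral a M (jacobi_poly N a b * jacobi_op a b (monom 1 d))" for d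
    using jacobi_op_symmetric[OF assms(1,2), of "jacobi_poly N a b" "monom 1 d"]
    by (simp add: jacobi_ode jacobi_integral_smult)
  {
    case 0
    have "jacobi_op a b (monom 1 0) = 0" by (simp add: jacobi_op_def monom_0)
    then show ?case using sym[of 0] pos[OF 0] by (simp add: jacobi_integral_def)
  next
    case (Suc d)
    have "jacobi_integral a M (jacobi_poly N a b * jacobi_op a b (monom 1 (Suc d)))
        = Suc d * (Suc d + a + b + 1) * ?I (Suc d) + Suc d * (Suc d + a) * ?I d"
      unfolding jacobi_op_monom
      by (simp only: distrib_left mult_smult_right jacobi_integral_add[OF assms(1)] jacobi_integral_smult)
    then have "N * (N + a + b + 1) * ?I (Suc d) = Suc d * (Suc d + a + b + 1) * ?I (Suc d)"
      unfolding sym[of "Suc d"] using Suc by simp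
    then show ?case using pos[OF Suc.prems] by simp
  }
qed

lemma jacobi_orthogonal:
  assumes "a \<ge> 0" "real M = 2 * b + 1" "degree q < N"
  shows "jacobi_integral a M (jacobi_poly N a b * q) = 0"
proof -
  have "q = (\<Sum>i\<le>degree q. smult (coeff q i) (monom 1 i))"
    by (simp add: smult_monom poly_as_sum_of_monoms)
  then have "jacobi_integral a M (jacobi_poly N a b * q) =
      jacobi_integral a M (\<Sum>i\<le>degree q. smult (coeff q i) (jacobi_poly N a b * monom 1 i))"
    by (metis (no_types, lifting) mult_smult_right sum.cong sum_distrib_left)
  also have "\<dots> = 0"
    using assms by (simp add: jacobi_integral_sum jacobi_integral_smult jacobi_orthogonal_monom)
  finally show ?thesis .
qed

text \<open>(1 + x) P' and N P have the same coefficient at x^N, so their difference has degree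
  below N and is orthogonal to P.\<close>

lemma jacobi_euler:
  assumes "a \<ge> 0" "real M = 2 * b + 1"
  shows "jacobi_integral a M ([:1, 1:] * pderiv (jacobi_poly N a b) * jacobi_poly N a b)
    = N * jacobi_integral a M ((jacobi_poly N a b)\<^sup>2)"
proof (cases "N = 0")
  case True
  then have "pderiv (jacobi_poly N a b) = 0"
    using degree_jacobi_poly[of N a b] by (simp add: pderiv_eq_0_iff)
  then show ?thesis using True by (simp add: jacobi_integral_def)
next
  case False
  let ?p = "jacobi_poly N a b"
  have z: "coeff ?p i = 0" if "i > N" for i
    using degree_jacobi_poly[of N a b] that by (intro coeff_eq_0) auto
  have "degree ([:1, 1:] * pderiv ?p - smult N ?p) < N"
  proof (rule degree_lessI, use False in simp, intro allI impI)
    fix k assume k: "k \<ge> N"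
    then obtain i where "k = Suc i" using False by (cases k) auto
    with k z show "coeff ([:1, 1:] * pderiv ?p - smult N ?p) k = 0"
      by (cases "k = N") (auto simp: coeff_pderiv)
  qed
  then have "jacobi_integral a M (?p * ([:1, 1:] * pderiv ?p - smult N ?p)) = 0"
    by (rule jacobi_orthogonal[OF assms])
  then have "jacobi_integral a M (?p * ([:1, 1:] * pderiv ?p)) = jacobi_integral a M (smult N (?p * ?p))"
    by (simp add: right_diff_distrib jacobi_integral_diff[OF assms(1)])
  then show ?thesis
    by (simp only: jacobi_integral_smult power2_eq_square mult.commute)
qed

section \<open>The virial identity and integrals with singular weights\<close>

definition virial_poly :: "nat \<Rightarrow> real poly \<Rightarrow> real poly" where
  "virial_poly M p = smult (M + 1) (p\<^sup>2) + smult 4 ([:1, 1:] * pderiv p * p)"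

lemma jacobi_integral_virial:
  assumes "a \<ge> 0" "real M = 2 * b + 1"
  shows "jacobi_integral a M (virial_poly M (jacobi_poly N a b)) = (M + 1 + 4 * N) * jacobi_integral a M ((jacobi_poly N a b)\<^sup>2)"
  unfolding virial_poly_def jacobi_integral_add[OF assms(1)] jacobi_integral_smult jacobi_euler[OF assms]
  by (simp add: algebra_simps)

text \<open>One identity for both cases of the parameter. Its first term is 2 a cot^2 \<phi> times
  the weight times p^2, and \<open>virial_poly\<close> collects the rest, whose integral
  \<open>jacobi_euler\<close> evaluates. For a > 0 the differentiated function vanishes at both ends
  and the identity yields the mean of cot^2; for a = 0 that term drops out and the boundary value at
  \<phi> = 0 remains.\<close>

lemma DERIV_virial:
  assumes "\<phi> \<in> {0<..<pi/2}"
  shows "((\<lambda>\<phi>. sin \<phi> powr (2 * a) * cos \<phi> ^ Suc M * poly (p\<^sup>2) (- (sin \<phi>)\<^sup>2)) has_real_derivative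
    2 * a * (sin \<phi> powr (2 * a - 1) * cos \<phi> ^ (M + 2) * poly (p\<^sup>2) (- (sin \<phi>)\<^sup>2))
      - jacobi_weight a M \<phi> * poly (virial_poly M p) (- (sin \<phi>)\<^sup>2)) (at \<phi>)"
proof -
  have s: "sin \<phi> powr (2 * a + 1) = sin \<phi> powr (2 * a - 1) * (sin \<phi>)\<^sup>2"
    using sin_cos_pos[OF assms] powr_add[of "sin \<phi>" "2 * a - 1" 2] by (simp add: algebra_simps)
  have c: "1 - (sin \<phi>)\<^sup>2 = (cos \<phi>)\<^sup>2" by (simp add: cos_squared_eq)
  have p: "poly (pderiv (p\<^sup>2)) x = 2 * poly (pderiv p) x * poly p x" for x
    by (simp add: power2_eq_square pderiv_mult)
  have v: "poly (virial_poly M p) (- (sin \<phi>)\<^sup>2) = (M + 1) * poly (p\<^sup>2) (- (sin \<phi>)\<^sup>2)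
      + 4 * (1 - (sin \<phi>)\<^sup>2) * poly (pderiv p) (- (sin \<phi>)\<^sup>2) * poly p (- (sin \<phi>)\<^sup>2)"
    by (simp add: virial_poly_def algebra_simps)
  show ?thesis
    by (rule DERIV_cong[OF DERIV_sin_powr_cos_poly[OF assms]])
       (simp only: jacobi_weight_def s v c p power_add, simp add: algebra_simps power2_eq_square)
qed

lemma poly_at_0_jacobi:
  assumes "real M = 2 * b + 1"
  shows "(poly (jacobi_poly N 0 b) 0)\<^sup>2 = (M + 1 + 4 * N) * jacobi_integral 0 M ((jacobi_poly N 0 b)\<^sup>2)"
proof -
  let ?p = "jacobi_poly N 0 b"
  let ?F = "\<lambda>\<phi>::real. cos \<phi> ^ Suc M * poly (?p\<^sup>2) (- (sin \<phi>)\<^sup>2)"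
  let ?v = "smult (-1) (virial_poly M ?p)"
  have "jacobi_integral 0 M ?v = ?F (pi/2) - ?F 0"
    unfolding jacobi_integral_def
  proof (rule FTC_set_lborel[OF _ _ _ set_integrable_jacobi])
    fix \<phi> :: real assume \<phi>: "\<phi> \<in> {0<..<pi/2}"
    have "((\<lambda>\<phi>. sin \<phi> powr (2 * 0) * cos \<phi> ^ Suc M * poly (?p\<^sup>2) (- (sin \<phi>)\<^sup>2)) has_real_derivative
       jacobi_weight 0 M \<phi> * poly ?v (- (sin \<phi>)\<^sup>2)) (at \<phi>)"
      by (rule DERIV_cong[OF DERIV_virial[OF \<phi>]]) simp
    \<comment> \<open>As \<open>0 powr 0 = 0\<close>, the function with the factor
      \<open>sin \<phi> powr 0\<close> would jump at \<phi> = 0. \<open>?F\<close> omits the factor,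
      which is 1 in the open interval, and is continuous.\<close>
    then show "(?F has_real_derivative jacobi_weight 0 M \<phi> * poly ?v (- (sin \<phi>)\<^sup>2)) (at \<phi>)"
    proof (rule has_field_derivative_transform_within_open)
      show "sin x powr (2 * 0) * cos x ^ Suc M * poly (?p\<^sup>2) (- (sin x)\<^sup>2) = ?F x"
        if "x \<in> {0<..<pi/2}" for x using sin_cos_pos[OF that] by simp
    qed (use \<phi> in auto)
  qed (auto intro!: continuous_intros)
  then show ?thesis
    unfolding jacobi_integral_smult jacobi_integral_virial[OF order_refl assms] by simp
qed

text \<open>1 / sin^2 = 1 + cot^2, and the mean of cot^2 comes from \<open>DERIV_virial\<close>;
  \<open>a > 0\<close> makes the boundary value at \<phi> = 0 vanish.\<close>

lemma jacobi_hardy: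
  fixes N :: nat
  assumes "a > 0" "real M = 2 * b + 1"
  defines "f \<equiv> \<lambda>\<phi>. sin \<phi> powr (2 * a - 1) * cos \<phi> ^ M * (poly (jacobi_poly N a b) (- (sin \<phi>)\<^sup>2))\<^sup>2"
  shows "set_integrable lborel {0..pi/2} f"
    and "(LINT \<phi>:{0..pi/2}|lborel. f \<phi>)
      = (1 + (M + 1 + 4 * N) / (2 * a)) * jacobi_integral a M ((jacobi_poly N a b)\<^sup>2)"
proof -
  let ?p = "jacobi_poly N a b"
  define g where "g \<phi> = jacobi_weight a M \<phi> * poly (virial_poly M ?p) (- (sin \<phi>)\<^sup>2)" for \<phi>
  define F where "F \<phi> = sin \<phi> powr (2 * a) * cos \<phi> ^ Suc M * poly (?p\<^sup>2) (- (sin \<phi>)\<^sup>2)" for \<phi> :: real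
  define h where "h \<phi> = 2 * a * (sin \<phi> powr (2 * a - 1) * cos \<phi> ^ (M + 2) * poly (?p\<^sup>2) (- (sin \<phi>)\<^sup>2))" for \<phi> :: real
  define G where "G \<phi> = F \<phi> + integral {0..\<phi>} g" for \<phi>
  have cg: "continuous_on {0..pi/2} g"
    unfolding g_def using assms by (intro continuous_intros continuous_on_jacobi_weight) auto
  have cG: "continuous_on {0..pi/2} G"
    unfolding G_def F_def using assms
    by (intro continuous_intros continuous_on_sin_powr_cos_poly indefinite_integral_continuous_1
        integrable_continuous_real cg) auto
  have dG: "(G has_real_derivative h \<phi>) (at \<phi>)" if \<phi>: "\<phi> \<in> {0<..<pi/2}" for \<phi>
  proof -
    have "((\<lambda>\<phi>. integral {0..\<phi>} g) has_real_derivative g \<phi>) (at \<phi> within {0..pi/2})"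
      using \<phi> by (intro integral_has_real_derivative[OF cg]) auto
    then have "((\<lambda>\<phi>. integral {0..\<phi>} g) has_real_derivative g \<phi>) (at \<phi>)"
      using \<phi> at_within_interior[of \<phi> "{0..pi/2}"] by (simp add: interior_atLeastAtMost_real)
    from DERIV_add[OF DERIV_virial[OF \<phi>, of a M ?p] this] show ?thesis
      by (simp add: G_def[abs_def] F_def h_def g_def)
  qed
  have hi: "set_integrable lborel {0..pi/2} h"
  proof (rule FTC_set_lborel_nonneg[OF _ cG dG])
    show "h \<in> borel_measurable borel" unfolding h_def by (simp add: poly_altdef, measurable)
    fix x assume "x \<in> {0..pi/2::real}"
    then show "h x \<ge> 0" using sin_cos_nonneg[of x] assms by (simp add: h_def)
  qed auto
  have "(LINT x:{0..pi/2}|lborel. h x) = G (pi/2) - G 0"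
    by (rule FTC_set_lborel[OF _ cG dG hi]) auto
  also have "\<dots> = integral {0..pi/2} g"
    using assms by (simp add: G_def F_def)
  also have "\<dots> = jacobi_integral a M (virial_poly M ?p)"
    unfolding jacobi_integral_def g_def
    using set_borel_integral_eq_integral(2)[OF set_integrable_jacobi[of a M "virial_poly M ?p"]] assms(1) by simp
  also have "\<dots> = (M + 1 + 4 * N) * jacobi_integral a M (?p\<^sup>2)"
    using jacobi_integral_virial[of a M b N] assms by simp
  finally have hI: "(LINT x:{0..pi/2}|lborel. h x) = (M + 1 + 4 * N) * jacobi_integral a M (?p\<^sup>2)" .
  have f: "f \<phi> = (1 / (2 * a)) * h \<phi> + jacobi_weight a M \<phi> * poly (?p\<^sup>2) (- (sin \<phi>)\<^sup>2)"
    if "\<phi> \<in> {0..pi/2}" for \<phi>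
  proof (cases "sin \<phi> = 0")
    case False
    then have "sin \<phi> > 0" using sin_cos_nonneg[OF that] by simp
    then have s: "sin \<phi> powr (2 * a + 1) = sin \<phi> powr (2 * a - 1) * (sin \<phi>)\<^sup>2"
      using powr_add[of "sin \<phi>" "2 * a - 1" 2] by (simp add: algebra_simps)
    have c: "cos \<phi> ^ (M + 2) = cos \<phi> ^ M * (1 - (sin \<phi>)\<^sup>2)"
      by (simp only: power_add cos_squared_eq)
    show ?thesis unfolding f_def h_def jacobi_weight_def s c using assms(1)
      by (simp add: algebra_simps)
  qed (simp add: f_def h_def jacobi_weight_def)
  have wi: "set_integrable lborel {0..pi/2} (\<lambda>\<phi>. jacobi_weight a M \<phi> * poly (?p\<^sup>2) (- (sin \<phi>)\<^sup>2))"
    by (rule set_integrable_jacobi) (use assms in simp)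
  have "set_integrable lborel {0..pi/2} (\<lambda>\<phi>. (1 / (2 * a)) * h \<phi> + jacobi_weight a M \<phi> * poly (?p\<^sup>2) (- (sin \<phi>)\<^sup>2))"
    by (intro set_integral_add(1) set_integrable_mult_right hi wi)
  then show "set_integrable lborel {0..pi/2} f"
    by (subst set_integrable_cong[OF refl refl f])
  have "(LINT \<phi>:{0..pi/2}|lborel. f \<phi>) = (LINT \<phi>:{0..pi/2}|lborel. (1 / (2 * a)) * h \<phi> + jacobi_weight a M \<phi> * poly (?p\<^sup>2) (- (sin \<phi>)\<^sup>2))"
    by (rule set_lebesgue_integral_cong) (use f in auto)
  also have "\<dots> = (1 / (2 * a)) * (LINT \<phi>:{0..pi/2}|lborel. h \<phi>) + jacobi_integral a M (?p\<^sup>2)"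
    by (subst set_integral_add(2)[OF set_integrable_mult_right[OF hi] wi]) (simp add: jacobi_integral_def)
  also have "\<dots> = (1 + (M + 1 + 4 * N) / (2 * a)) * jacobi_integral a M (?p\<^sup>2)"
    unfolding hI using assms(1) by (simp add: field_simps)
  finally show "(LINT \<phi>:{0..pi/2}|lborel. f \<phi>) = (1 + (M + 1 + 4 * N) / (2 * a)) * jacobi_integral a M (?p\<^sup>2)" .
qed

text \<open>Interpolation by a splitting at sin^(-2) = K: pointwise sin^(-2 s) \<le> K^s + K^(s - 1)
  sin^(-2), the first term sufficing where sin^(-2) \<le> K and the second elsewhere. The parameter
  K becomes k + 1, the order of the mean of sin^(-2).\<close>

lemma jacobi_singular_bound:
  fixes N :: nat
  assumes "a > 0" "real M = 2 * b + 1" "0 \<le> s" "s \<le> 1" "K \<ge> 1"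
  defines "f \<equiv> \<lambda>\<phi>. sin \<phi> powr (- (2 * s)) * (jacobi_weight a M \<phi> * (poly (jacobi_poly N a b) (- (sin \<phi>)\<^sup>2))\<^sup>2)"
  shows "set_integrable lborel {0..pi/2} f"
    and "(LINT \<phi>:{0..pi/2}|lborel. f \<phi>)
      \<le> (K powr s + K powr (s - 1) * (1 + (M + 1 + 4 * N) / (2 * a))) * jacobi_integral a M ((jacobi_poly N a b)\<^sup>2)"
proof -
  let ?p = "jacobi_poly N a b"
  let ?u = "\<lambda>\<phi>. jacobi_weight a M \<phi> * poly (?p\<^sup>2) (- (sin \<phi>)\<^sup>2)"
  let ?v = "\<lambda>\<phi>. sin \<phi> powr (2 * a - 1) * cos \<phi> ^ M * (poly ?p (- (sin \<phi>)\<^sup>2))\<^sup>2"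
  have u: "set_integrable lborel {0..pi/2} ?u"
    by (rule set_integrable_jacobi) (use assms in simp)
  note v = jacobi_hardy[OF assms(1,2), of N]
  have nn: "0 \<le> ?u \<phi>" "0 \<le> f \<phi>" if "\<phi> \<in> {0..pi/2}" for \<phi>
    using jacobi_weight_nonneg[OF that] sin_cos_nonneg[OF that] by (auto simp: f_def)
  have le: "f \<phi> \<le> K powr s * ?u \<phi> + K powr (s - 1) * ?v \<phi>" if \<phi>: "\<phi> \<in> {0..pi/2}" for \<phi>
  proof (cases "sin \<phi> = 0")
    case True
    then show ?thesis by (simp add: f_def jacobi_weight_def)
  next
    case False
    then have s: "sin \<phi> > 0" using sin_cos_nonneg[OF \<phi>] by simp
    have uv: "?v \<phi> = sin \<phi> powr (-2) * ?u \<phi>"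
      using s powr_add[of "sin \<phi>" "-2" "2 * a + 1"] by (simp add: jacobi_weight_def algebra_simps)
    have v0: "?v \<phi> \<ge> 0" using sin_cos_nonneg[OF \<phi>] by simp
    show ?thesis
    proof (cases "sin \<phi> powr (-2) \<le> K")
      case True
      have "sin \<phi> powr (- (2 * s)) = (sin \<phi> powr (-2)) powr s" by (simp add: powr_powr)
      also have "\<dots> \<le> K powr s" using True assms by (intro powr_mono2) auto
      finally have "f \<phi> \<le> K powr s * ?u \<phi>"
        unfolding f_def using nn(1)[OF \<phi>] by (simp add: mult_right_mono)
      also have "\<dots> \<le> K powr s * ?u \<phi> + K powr (s - 1) * ?v \<phi>" using v0 by simp
      finally show ?thesis .
    next
      case False
      have "sin \<phi> powr (- (2 * s)) = (sin \<phi> powr (-2)) powr (s - 1) * sin \<phi> powr (-2)"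
        using s by (simp add: powr_powr algebra_simps flip: powr_add)
      also have "\<dots> \<le> K powr (s - 1) * sin \<phi> powr (-2)"
        using False assms by (intro mult_right_mono powr_mono2') auto
      finally have "f \<phi> \<le> K powr (s - 1) * sin \<phi> powr (-2) * ?u \<phi>"
        unfolding f_def using nn(1)[OF \<phi>] by (simp add: mult_right_mono)
      also have "\<dots> = K powr (s - 1) * ?v \<phi>" unfolding uv by simp
      also have "\<dots> \<le> K powr s * ?u \<phi> + K powr (s - 1) * ?v \<phi>" using nn(1)[OF \<phi>] by simp
      finally show ?thesis .
    qed
  qed
  have I: "set_integrable lborel {0..pi/2} (\<lambda>\<phi>. K powr s * ?u \<phi> + K powr (s - 1) * ?v \<phi>)"
    by (intro set_integral_add(1) set_integrable_mult_right u v(1))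
  show fI: "set_integrable lborel {0..pi/2} f"
  proof (rule set_integrable_bound[OF I])
    have [measurable]: "f \<in> borel_measurable borel"
      unfolding f_def jacobi_weight_def by (simp add: poly_altdef, measurable)
    show "set_borel_measurable lborel {0..pi/2} f" by (simp add: set_borel_measurable_def)
    show "AE x in lborel. x \<in> {0..pi/2} \<longrightarrow> norm (f x) \<le> norm (K powr s * ?u x + K powr (s - 1) * ?v x)"
      using le nn(2) by (intro AE_I2) fastforce
  qed
  have "(LINT \<phi>:{0..pi/2}|lborel. f \<phi>) \<le> (LINT \<phi>:{0..pi/2}|lborel. K powr s * ?u \<phi> + K powr (s - 1) * ?v \<phi>)"
    by (rule set_integral_mono[OF fI I le])
  also have "\<dots> = K powr s * (LINT \<phi>:{0..pi/2}|lborel. ?u \<phi>) + K powr (s - 1) * (LINT \<phi>:{0..pi/2}|lborel. ?v \<phi>)"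
    by (subst set_integral_add(2)) (simp_all add: u v(1) del: poly_power)
  also have "\<dots> = (K powr s + K powr (s - 1) * (1 + (M + 1 + 4 * N) / (2 * a))) * jacobi_integral a M (?p\<^sup>2)"
    unfolding v(2) jacobi_integral_def by (simp add: algebra_simps)
  finally show "(LINT \<phi>:{0..pi/2}|lborel. f \<phi>) \<le> (K powr s + K powr (s - 1) * (1 + (M + 1 + 4 * N) / (2 * a))) * jacobi_integral a M (?p\<^sup>2)" .
qed

text \<open>The differential equation turns the derivative of Sonin's function into (1 + (2 b + 2)
  x) P'^2, and the second bound on x keeps this factor nonnegative from x up to 0. For N = 0 the
  eigenvalue is 0 and cannot be cancelled, but then P is constant.\<close>

lemma jacobi_sonin:
  assumes b: "b \<ge> 0" and x: "x \<le> 0" "- 1 \<le> (2 * b + 2) * x"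
  shows "(poly (jacobi_poly N 0 b) x)\<^sup>2 \<le> (poly (jacobi_poly N 0 b) 0)\<^sup>2"
proof (cases "N = 0")
  case True
  then show ?thesis by (simp add: jacobi_poly_def)
next
  case False
  define p where "p = jacobi_poly N 0 b"
  define L where "L = real N * (N + b + 1)"
  have L: "L > 0" using False b by (simp add: L_def)
  \<comment> \<open>Sonin's function: it dominates \<open>L p\<^sup>2\<close> on \<open>[-1, 0]\<close>, with equality at \<open>0\<close>.\<close>
  define E where "E = smult L (p\<^sup>2) - [:0, 1, 1:] * (pderiv p)\<^sup>2"
  have ode: "L * poly p y = y * (1 + y) * poly (pderiv (pderiv p)) y + (1 + (b + 2) * y) * poly (pderiv p) y" for y
    using arg_cong[OF jacobi_ode[of 0 b N], of "\<lambda>q. poly q y"]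
    by (simp add: jacobi_op_def p_def L_def algebra_simps)
  have dE: "poly (pderiv E) y = ((2 * b + 2) * y + 1) * (poly (pderiv p) y)\<^sup>2" for y
  proof -
    have "poly (pderiv E) y = 2 * poly (pderiv p) y * (L * poly p y - y * (1 + y) * poly (pderiv (pderiv p)) y)
       - (1 + 2 * y) * (poly (pderiv p) y)\<^sup>2"
      by (simp add: E_def power2_eq_square pderiv_mult pderiv_add pderiv_diff pderiv_smult pderiv_pCons algebra_simps)
    then show ?thesis unfolding ode by (simp add: power2_eq_square algebra_simps)
  qed
  have "x \<ge> -1"
  proof (rule ccontr)
    assume "\<not> x \<ge> -1"
    then have "(2 * b + 2) * x < (2 * b + 2) * (-1)" using b by (intro mult_strict_left_mono) auto
    then show False using x b by simp
  qed
  have "poly E x \<le> poly E 0"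
  proof (rule DERIV_nonneg_imp_nondecreasing[OF x(1)])
    fix y assume y: "x \<le> y" "y \<le> 0"
    have "(2 * b + 2) * x \<le> (2 * b + 2) * y" using y b by (intro mult_left_mono) auto
    then have "0 \<le> poly (pderiv E) y" unfolding dE using x by simp
    then show "\<exists>d. (poly E has_real_derivative d) (at y) \<and> 0 \<le> d" using poly_DERIV by blast
  qed
  moreover have "L * (poly p x)\<^sup>2 \<le> poly E x"
  proof -
    have "(- x) * (1 + x) * (poly (pderiv p) x)\<^sup>2 \<ge> 0" using x \<open>x \<ge> -1\<close> by (intro mult_nonneg_nonneg) auto
    then show ?thesis by (simp add: E_def algebra_simps)
  qed
  moreover have "poly E 0 = L * (poly p 0)\<^sup>2" by (simp add: E_def)
  ultimately have "L * (poly p x)\<^sup>2 \<le> L * (poly p 0)\<^sup>2" by simp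
  then show ?thesis using L by (simp add: p_def)
qed

text \<open>The splitting at sin \<theta> = 1 / sqrt T balances two contributions of sqrt T times
  the squared norm. Below \<theta> the sine in the weight cancels 1 / sin, P^2 is at most P(1)^2,
  and P(1)^2 equals T times the squared norm by \<open>poly_at_0_jacobi\<close>; above \<theta>, 1 /
  sin is at most sqrt T.\<close>

lemma jacobi_singular_bound_0:
  fixes N :: nat
  assumes "M \<ge> 1" "real M = 2 * b + 1"
  defines "f \<equiv> \<lambda>\<phi>. sin \<phi> powr (-1) * (jacobi_weight 0 M \<phi> * (poly (jacobi_poly N 0 b) (- (sin \<phi>)\<^sup>2))\<^sup>2)"
  shows "set_integrable lborel {0..pi/2} f"
    and "(LINT \<phi>:{0..pi/2}|lborel. f \<phi>) \<le> 2 * sqrt (M + 1 + 4 * N) * jacobi_integral 0 M ((jacobi_poly N 0 b)\<^sup>2)"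
proof -
  let ?p = "jacobi_poly N 0 b"
  define T where "T = real (M + 1 + 4 * N)"
  define \<theta> where "\<theta> = arcsin (1 / sqrt T)"
  have T: "T \<ge> 1" "T \<ge> real M + 1" by (auto simp: T_def)
  have \<theta>: "\<theta> \<in> {0..pi/2}" "sin \<theta> = 1 / sqrt T"
  proof -
    have r: "0 \<le> 1 / sqrt T" "1 / sqrt T \<le> 1" using T(1) by auto
    then have "-1 \<le> 1 / sqrt T" by linarith
    with r show "\<theta> \<in> {0..pi/2}" "sin \<theta> = 1 / sqrt T"
      using arcsin_bounded[of "1 / sqrt T"] arcsin_le_arcsin[of 0 "1 / sqrt T"]
      by (auto simp: \<theta>_def simp del: zero_le_divide_1_iff divide_le_eq_1 sin_arcsin intro!: sin_arcsin)
  qed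
  let ?u = "\<lambda>\<phi>. jacobi_weight 0 M \<phi> * poly (?p\<^sup>2) (- (sin \<phi>)\<^sup>2)"
  \<comment> \<open>One cosine is kept in the majorant, so that its integral is exactly sin
    \<theta>.\<close>
  let ?c = "\<lambda>\<phi>. indicat_real {0..\<theta>} \<phi> * cos \<phi>"
  let ?v = "\<lambda>\<phi>. (poly ?p 0)\<^sup>2 * ?c \<phi> + sqrt T * ?u \<phi>"
  have c: "set_integrable lborel {0..\<theta>} cos"
    unfolding set_integrable_def by (intro borel_integrable_compact continuous_intros compact_Icc)
  have c': "(\<lambda>\<phi>. indicat_real {0..pi/2} \<phi> *\<^sub>R ?c \<phi>) = (\<lambda>\<phi>. indicat_real {0..\<theta>} \<phi> *\<^sub>R cos \<phi>)"
    using \<theta>(1) by (auto simp: indicator_def)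
  have ci: "set_integrable lborel {0..pi/2} ?c" "(LINT \<phi>:{0..pi/2}|lborel. ?c \<phi>) = 1 / sqrt T"
  proof -
    show "set_integrable lborel {0..pi/2} ?c"
      using c unfolding set_integrable_def c' .
    have "(LINT \<phi>:{0..\<theta>}|lborel. cos \<phi>) = sin \<theta> - sin 0"
      using \<theta>(1) by (intro FTC_set_lborel c) (auto intro!: continuous_intros derivative_eq_intros)
    then show "(LINT \<phi>:{0..pi/2}|lborel. ?c \<phi>) = 1 / sqrt T"
      unfolding set_lebesgue_integral_def c' \<theta>(2) by simp
  qed
  have u: "set_integrable lborel {0..pi/2} ?u" by (rule set_integrable_jacobi) simp
  have I: "set_integrable lborel {0..pi/2} ?v"
    by (intro set_integral_add(1) set_integrable_mult_right u ci)
  have nn: "0 \<le> ?u \<phi>" "0 \<le> f \<phi>" if "\<phi> \<in> {0..pi/2}" for \<phi>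
    using jacobi_weight_nonneg[OF that] sin_cos_nonneg[OF that] by (auto simp: f_def)
  have le: "f \<phi> \<le> ?v \<phi>" if \<phi>: "\<phi> \<in> {0..pi/2}" for \<phi>
  proof (cases "sin \<phi> = 0")
    case True
    then show ?thesis using sin_cos_nonneg[OF \<phi>] by (simp add: f_def jacobi_weight_def indicator_def)
  next
    case False
    then have s: "sin \<phi> > 0" using sin_cos_nonneg[OF \<phi>] by simp
    show ?thesis
    proof (cases "\<phi> \<le> \<theta>")
      case True
      have "sin \<phi> \<le> 1 / sqrt T"
        unfolding \<theta>(2)[symmetric] using True \<phi> \<theta>(1) by (intro sin_monotone_2pi_le) auto
      then have "(sin \<phi>)\<^sup>2 \<le> (1 / sqrt T)\<^sup>2" using s by (intro power_mono) auto
      then have "(sin \<phi>)\<^sup>2 \<le> 1 / T" using T by (simp add: power_divide)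
      \<comment> \<open>As 2 b + 2 = M + 1 \<le> T, the point x = - sin^2 \<phi> lies in the range
        of \<open>jacobi_sonin\<close>.\<close>
      then have "(real M + 1) * (sin \<phi>)\<^sup>2 \<le> T * (1 / T)" using T by (intro mult_mono) auto
      then have p: "(poly ?p (- (sin \<phi>)\<^sup>2))\<^sup>2 \<le> (poly ?p 0)\<^sup>2"
        using T assms by (intro jacobi_sonin) (auto simp: add.commute)
      have "sin \<phi> powr (-1) * jacobi_weight 0 M \<phi> = cos \<phi> ^ M"
        using s by (simp add: jacobi_weight_def powr_minus)
      then have "f \<phi> = cos \<phi> ^ M * (poly ?p (- (sin \<phi>)\<^sup>2))\<^sup>2" by (simp only: f_def mult.assoc[symmetric])
      also have "\<dots> \<le> cos \<phi> ^ 1 * (poly ?p 0)\<^sup>2"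
        using p assms(1) sin_cos_nonneg[OF \<phi>] by (intro mult_mono power_decreasing) auto
      also have "\<dots> \<le> ?v \<phi>" using True \<phi> nn(1)[OF \<phi>] T by simp
      finally show ?thesis .
    next
      case False
      have "sin \<phi> \<ge> 1 / sqrt T"
        unfolding \<theta>(2)[symmetric] using False \<phi> \<theta>(1) by (intro sin_monotone_2pi_le) auto
      then have "sin \<phi> powr (-1) \<le> sqrt T"
        using s T by (simp add: powr_minus field_simps)
      then have "f \<phi> \<le> sqrt T * ?u \<phi>"
        unfolding f_def poly_power using nn(1)[OF \<phi>, unfolded poly_power] by (rule mult_right_mono)
      also have "\<dots> = ?v \<phi>" using False by simp
      finally show ?thesis .
    qed
  qed
  show fI: "set_integrable lborel {0..pi/2} f"
  proof (rule set_integrable_bound[OF I])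
    have [measurable]: "f \<in> borel_measurable borel"
      unfolding f_def jacobi_weight_def by (simp add: poly_altdef, measurable)
    show "set_borel_measurable lborel {0..pi/2} f" by (simp add: set_borel_measurable_def)
    show "AE x in lborel. x \<in> {0..pi/2} \<longrightarrow> norm (f x) \<le> norm (?v x)"
      using le nn(2) by (intro AE_I2) fastforce
  qed
  have "(LINT \<phi>:{0..pi/2}|lborel. f \<phi>) \<le> (LINT \<phi>:{0..pi/2}|lborel. ?v \<phi>)"
    by (rule set_integral_mono[OF fI I le])
  also have "\<dots> = (poly ?p 0)\<^sup>2 * (LINT \<phi>:{0..pi/2}|lborel. ?c \<phi>) + sqrt T * (LINT \<phi>:{0..pi/2}|lborel. ?u \<phi>)"
    by (subst set_integral_add(2)) (simp_all add: u ci(1) del: poly_power)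
  also have "\<dots> = T / sqrt T * jacobi_integral 0 M (?p\<^sup>2) + sqrt T * jacobi_integral 0 M (?p\<^sup>2)"
    unfolding ci(2) poly_at_0_jacobi[OF assms(2)] jacobi_integral_def T_def by simp
  also have "\<dots> = 2 * sqrt T * jacobi_integral 0 M (?p\<^sup>2)"
    using T by (simp add: real_div_sqrt)
  finally show "(LINT \<phi>:{0..pi/2}|lborel. f \<phi>) \<le> 2 * sqrt (M + 1 + 4 * N) * jacobi_integral 0 M (?p\<^sup>2)"
    by (simp add: T_def)
qed

text \<open>A vanishing integral forces P = 0 for all \<phi> in the open interval. At \<phi> = 0 the
  weight is 0, so continuity is needed to reach x = 0, where P has the positive value
  \<open>(N + a) gchoose N\<close>.\<close>

lemma jacobi_integral_pos:
  assumes "a \<ge> 0" "b \<ge> 0"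
  shows "jacobi_integral a M ((jacobi_poly N a b)\<^sup>2) > 0"
proof -
  let ?p = "jacobi_poly N a b"
  let ?f = "\<lambda>\<phi>. jacobi_weight a M \<phi> * poly (?p\<^sup>2) (- (sin \<phi>)\<^sup>2)"
  have c: "continuous_on {0..pi/2} ?f"
    using assms by (intro continuous_intros continuous_on_jacobi_weight)
  have nn: "0 \<le> ?f \<phi>" if "\<phi> \<in> {0..pi/2}" for \<phi>
    using jacobi_weight_nonneg[OF that] by simp
  have J: "jacobi_integral a M (?p\<^sup>2) = integral {0..pi/2} ?f"
    unfolding jacobi_integral_def
    using set_borel_integral_eq_integral(2)[OF set_integrable_jacobi[of a M "?p\<^sup>2"]] assms(1) by simp
  have "jacobi_integral a M (?p\<^sup>2) \<noteq> 0"
  proof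
    assume "jacobi_integral a M (?p\<^sup>2) = 0"
    then have z: "?f \<phi> = 0" if "\<phi> \<in> {0..pi/2}" for \<phi>
      using integral_eq_0_iff[OF c] nn that unfolding J by auto
    have "continuous_on {0..pi/2} (\<lambda>\<phi>. poly ?p (- (sin \<phi>)\<^sup>2))" by (intro continuous_intros)
    moreover have "poly ?p (- (sin \<phi>)\<^sup>2) = 0" if "\<phi> \<in> {0<..<pi/2}" for \<phi>
      using z[of \<phi>] that sin_cos_pos[OF that] by (auto simp: jacobi_weight_def)
    ultimately have "poly ?p (- (sin 0)\<^sup>2) = 0"
      using continuous_constant_on_closure[of "{0<..<pi/2}" "\<lambda>\<phi>. poly ?p (- (sin \<phi>)\<^sup>2)" 0 0] by simp
    moreover have "poly ?p 0 = (N + a) gchoose N"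
    proof -
      have "poly ?p 0 = (\<Sum>s\<le>N. if s = 0 then (N + a) gchoose N else 0)"
        unfolding jacobi_poly_def poly_sum by (rule sum.cong) auto
      then show ?thesis by simp
    qed
    moreover have "(N + a) gchoose N > 0"
      unfolding gbinomial_prod_rev using assms by (auto intro!: divide_pos_pos prod_pos)
    ultimately show False by simp
  qed
  moreover have "jacobi_integral a M (?p\<^sup>2) \<ge> 0"
    unfolding J by (rule integral_nonneg[OF integrable_continuous_real[OF c] nn])
  ultimately show ?thesis by simp
qed

section \<open>Orthogonality of spherical harmonics\<close>

definition partial_derivative :: "'a::euclidean_space \<Rightarrow> ('a \<Rightarrow> complex) \<Rightarrow> 'a \<Rightarrow> complex" where
  "partial_derivative b f x = vector_derivative (\<lambda>t. f (x + t *\<^sub>R b)) (at 0)"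

lemma real_polynomial_function_partial:
  fixes p :: "'a::real_normed_vector \<Rightarrow> real"
  assumes "real_polynomial_function p"
  shows "\<exists>p'. real_polynomial_function p' \<and>
    (\<forall>x. ((\<lambda>t. p (x + t *\<^sub>R b)) has_real_derivative p' x) (at 0))"
  using assms
proof induction
  case (linear f)
  then have "((\<lambda>t. f x + t * f b) has_real_derivative f b) (at 0)" for x
    by (auto intro!: derivative_eq_intros)
  with linear show ?case
    by (intro exI[of _ "\<lambda>_. f b"]) (auto simp: linear_simps)
next
  case (const c)
  then show ?case by (intro exI[of _ "\<lambda>_. 0"]) auto
next
  case (add f g)
  then obtain f' g' where "real_polynomial_function f'" "real_polynomial_function g'"
    "\<And>x. ((\<lambda>t. f (x + t *\<^sub>R b)) has_real_derivative f' x) (at 0)"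
    "\<And>x. ((\<lambda>t. g (x + t *\<^sub>R b)) has_real_derivative g' x) (at 0)" by blast
  then show ?case by (intro exI[of _ "\<lambda>x. f' x + g' x"]) (auto intro!: derivative_intros)
next
  case (mult f g)
  then obtain f' g' where "real_polynomial_function f'" "real_polynomial_function g'"
    "\<And>x. ((\<lambda>t. f (x + t *\<^sub>R b)) has_real_derivative f' x) (at 0)"
    "\<And>x. ((\<lambda>t. g (x + t *\<^sub>R b)) has_real_derivative g' x) (at 0)" by blast
  with mult show ?case
    by (intro exI[of _ "\<lambda>x. f' x * g x + g' x * f x"]) (auto intro!: derivative_eq_intros)
qed

lemma polynomial_function_complex_iff:
  fixes p :: "'a::euclidean_space \<Rightarrow> complex"
  shows "polynomial_function p \<longleftrightarrow>
    real_polynomial_function (\<lambda>x. Re (p x)) \<and> real_polynomial_function (\<lambda>x. Im (p x))"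
  by (subst polynomial_function_iff_Basis_inner) (auto simp: Basis_complex_def inner_complex_def)

lemma polynomial_function_partial:
  fixes p :: "'a::euclidean_space \<Rightarrow> complex"
  assumes "polynomial_function p"
  shows "polynomial_function (partial_derivative b p)"
    and "((\<lambda>t. p (x + t *\<^sub>R b)) has_vector_derivative partial_derivative b p (x + s *\<^sub>R b)) (at s)"
proof -
  obtain u v where uv: "real_polynomial_function u" "real_polynomial_function v"
    "\<And>x. ((\<lambda>t. Re (p (x + t *\<^sub>R b))) has_real_derivative u x) (at 0)"
    "\<And>x. ((\<lambda>t. Im (p (x + t *\<^sub>R b))) has_real_derivative v x) (at 0)"
    using assms real_polynomial_function_partial[of "\<lambda>x. Re (p x)" b] real_polynomial_function_partial[of "\<lambda>x. Im (p x)" b]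
    unfolding polynomial_function_complex_iff by blast
  then have d: "((\<lambda>t. p (x + t *\<^sub>R b)) has_vector_derivative Complex (u x) (v x)) (at 0)" for x
    by (simp add: has_vector_derivative_complex_iff)
  then have e: "partial_derivative b p x = Complex (u x) (v x)" for x
    unfolding partial_derivative_def by (rule vector_derivative_at)
  show "polynomial_function (partial_derivative b p)"
    using uv by (simp add: polynomial_function_complex_iff e)
  have "((\<lambda>t. p ((x + s *\<^sub>R b) + t *\<^sub>R b)) \<circ> (\<lambda>t. t - s) has_vector_derivative 1 *\<^sub>R partial_derivative b p (x + s *\<^sub>R b)) (at s)"
    by (rule vector_diff_chain_at) (use d[of "x + s *\<^sub>R b"] in \<open>auto intro!: derivative_eq_intros simp: e\<close>)
  then show "((\<lambda>t. p (x + t *\<^sub>R b)) has_vector_derivative partial_derivative b p (x + s *\<^sub>R b)) (at s)"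
    by (simp add: o_def algebra_simps)
qed

lemma laplacian_polynomial:
  assumes "polynomial_function p"
  shows "laplacian p x = (\<Sum>b\<in>Basis. partial_derivative b (partial_derivative b p) x)"
proof -
  have "vector_derivative (\<lambda>t. p (x + t *\<^sub>R b)) (at s) = partial_derivative b p (x + s *\<^sub>R b)" for b s
    by (rule vector_derivative_at[OF polynomial_function_partial(2)[OF assms]])
  then show ?thesis by (simp add: laplacian_def partial_derivative_def[of _ "partial_derivative _ p"])
qed

text \<open>Both sides are the derivative of p ((1 + t) x) = (1 + t)^l p x at t = 0, the left one by
  the chain rule.\<close>

lemma euler_homogeneous:
  fixes p :: "'a::euclidean_space \<Rightarrow> complex"
  assumes p: "polynomial_function p" and h: "\<And>t x. p (t *\<^sub>R x) = of_real (t ^ l) * p x"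
  shows "(\<Sum>b\<in>Basis. of_real (x \<bullet> b) * partial_derivative b p x) = of_nat l * p x"
proof -
  obtain D where D: "(p has_derivative D) (at x)"
    using differentiable_at_polynomial_function[OF p, of x UNIV] by (auto simp: differentiable_def)
  have lin: "bounded_linear D" using D by (rule has_derivative_bounded_linear)
  have ch: "((\<lambda>t. p (x + t *\<^sub>R v)) has_vector_derivative D v) (at 0)" for v
  proof -
    have 1: "((\<lambda>t. x + t *\<^sub>R v) has_derivative (\<lambda>t. t *\<^sub>R v)) (at 0)"
      by (auto intro!: derivative_eq_intros)
    have "((\<lambda>t. p (x + t *\<^sub>R v)) has_derivative (\<lambda>t. D (t *\<^sub>R v))) (at 0)"
      by (rule has_derivative_compose[OF 1]) (use D in simp)
    then show ?thesis
      by (simp add: has_vector_derivative_def linear_cmul[OF bounded_linear.linear[OF lin]])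
  qed
  have pd: "partial_derivative b p x = D b" for b
    unfolding partial_derivative_def by (rule vector_derivative_at[OF ch])
  have "((\<lambda>t. (1 + t) ^ l) has_vector_derivative of_nat l) (at (0::real))"
    unfolding has_real_derivative_iff_has_vector_derivative[symmetric]
    by (auto intro!: derivative_eq_intros)
  then have "((\<lambda>t. of_real ((1 + t) ^ l) * p x) has_vector_derivative of_nat l * p x) (at 0)"
    using bounded_linear.has_vector_derivative[OF bounded_linear_compose[OF bounded_linear_mult_left bounded_linear_of_real]]
    by fastforce
  moreover have "(\<lambda>t. of_real ((1 + t) ^ l) * p x) = (\<lambda>t. p (x + t *\<^sub>R x))"
    by (simp add: h[symmetric] scaleR_add_left del: of_real_power)
  ultimately have "of_nat l * p x = D x"
    using ch[of x] vector_derivative_unique_at by metis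
  also have "D x = D (\<Sum>b\<in>Basis. (x \<bullet> b) *\<^sub>R b)" by (simp add: euclidean_representation)
  also have "\<dots> = (\<Sum>b\<in>Basis. (x \<bullet> b) *\<^sub>R D b)"
    using bounded_linear.linear[OF lin] by (simp add: linear_sum linear_cmul)
  finally show ?thesis by (simp add: pd scaleR_conv_of_real)
qed

section \<open>Integrals over the unit ball\<close>

lemma integrable_continuous_support_cball:
  fixes F :: "'a::euclidean_space \<Rightarrow> complex"
  assumes F: "continuous_on UNIV F" and supp: "\<And>x. norm x > 1 \<Longrightarrow> F x = 0"
  shows "integrable lborel F"
proof -
  have "integrable lborel (\<lambda>x. indicator (cball 0 1) x *\<^sub>R F x)"
    using continuous_on_subset[OF F] by (intro borel_integrable_compact) auto
  also have "(\<lambda>x. indicator (cball 0 1) x *\<^sub>R F x) = F"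
    using supp by (auto simp: indicator_def fun_eq_iff)
  finally show ?thesis .
qed

text \<open>The difference quotients have integral 0 by translation invariance.\<close>
lemma integral_directional_derivative_eq_0:
  fixes F F' :: "'a::euclidean_space \<Rightarrow> complex"
  assumes d: "\<And>x s. ((\<lambda>t. F (x + t *\<^sub>R b)) has_vector_derivative F' (x + s *\<^sub>R b)) (at s)"
    and F: "continuous_on UNIV F" and F': "continuous_on UNIV F'"
    and supp: "\<And>x. norm x > 1 \<Longrightarrow> F x = 0" "\<And>x. norm x > 1 \<Longrightarrow> F' x = 0"
  shows "(LINT x|lborel. F' x) = 0"
proof -
  define D where "D n x = (real n + 1) *\<^sub>R (F ((1 / (real n + 1)) *\<^sub>R b + x) - F x)" for n x
  have [measurable]: "F \<in> borel_measurable borel" "F' \<in> borel_measurable borel"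
    using F F' by (auto intro: borel_measurable_continuous_onI)
  have Fi: "integrable lborel F" by (rule integrable_continuous_support_cball[OF F supp(1)])
  have tr: "integrable lborel (\<lambda>x. F (c + x))" "(LINT x|lborel. F (c + x)) = (LINT x|lborel. F x)" for c
  proof -
    have l: "distr lborel borel ((+) c) = (lborel :: 'a measure)" by (rule lborel_distr_plus)
    show "integrable lborel (\<lambda>x. F (c + x))"
      using Fi by (subst (asm) l[of, symmetric]) (simp add: integrable_distr_eq)
    show "(LINT x|lborel. F (c + x)) = (LINT x|lborel. F x)"
      by (subst l[symmetric]) (simp add: integral_distr del: l)
  qed
  have "compact (F' ` cball 0 1)"
    by (intro compact_continuous_image continuous_on_subset[OF F'] compact_cball) auto
  then obtain B where B: "\<And>x. norm x \<le> 1 \<Longrightarrow> norm (F' x) \<le> B"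
    using compact_imp_bounded bounded_iff by (metis image_eqI mem_cball_0)
  then have B': "norm (F' x) \<le> B" for x
    using supp(2)[of x] B[of x] order_trans[OF norm_ge_zero B[of 0]] by (cases "norm x \<le> 1") auto
  \<comment> \<open>The mean value inequality gives the bound B. Beyond radius 1 + |b| both x and
    the shifted point lie outside the unit ball, where F vanishes.\<close>
  have bound: "norm (D n x) \<le> B * indicator (cball 0 (1 + norm b)) x" for n x
  proof (cases "norm x \<le> 1 + norm b")
    case True
    let ?h = "1 / (real n + 1)"
    have "norm (F (x + ?h *\<^sub>R b) - F (x + 0 *\<^sub>R b)) \<le> B * norm (?h - 0)"
    proof (rule differentiable_bound[of UNIV "\<lambda>t. F (x + t *\<^sub>R b)" "\<lambda>s t. t *\<^sub>R F' (x + s *\<^sub>R b)"])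
      show "((\<lambda>t. F (x + t *\<^sub>R b)) has_derivative (\<lambda>t. t *\<^sub>R F' (x + s *\<^sub>R b))) (at s)" for s
        using d[of x s] by (simp add: has_vector_derivative_def)
      show "onorm (\<lambda>t. t *\<^sub>R F' (x + s *\<^sub>R b)) \<le> B" for s
          by (rule onorm_le) (simp add: mult.commute[of B] mult_left_mono B')
    qed auto
    then have "norm (D n x) \<le> (real n + 1) * (B * ?h)"
      unfolding D_def by (simp add: add.commute del: times_divide_eq_right)
    also have "\<dots> = B" by simp
    finally show ?thesis using True by simp
  next
    case False
    have "norm ((1 / (real n + 1)) *\<^sub>R b) \<le> norm b"
      by (simp add: divide_le_eq mult_le_cancel_left1)
    then have "norm ((1 / (real n + 1)) *\<^sub>R b + x) > 1"
      using False norm_triangle_ineq2[of x "- ((1 / (real n + 1)) *\<^sub>R b)"] by (simp add: add.commute)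
    moreover have "norm x > 1" using False norm_ge_zero[of b] by linarith
    ultimately show ?thesis using False supp(1) by (simp add: D_def)
  qed
  have "(\<lambda>n. LINT x|lborel. D n x) \<longlonglongrightarrow> (LINT x|lborel. F' x)"
  proof (rule integral_dominated_convergence)
    show "integrable lborel (\<lambda>x. B * indicator (cball 0 (1 + norm b)) x :: real)"
      by (intro integrable_mult_right integrable_real_indicator) (use emeasure_bounded_finite[of "cball 0 (1 + norm b)"] in auto)
    show "AE x in lborel. (\<lambda>n. D n x) \<longlonglongrightarrow> F' x"
    proof (intro AE_I2)
      fix x
      let ?h = "\<lambda>n. 1 / (real n + 1)"
      have "((\<lambda>t. F (x + t *\<^sub>R b)) has_derivative (\<lambda>t. t *\<^sub>R F' x)) (at 0)"
        using d[of x 0] by (simp add: has_vector_derivative_def)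
      then have "((\<lambda>t. (1 / norm t) *\<^sub>R (F (x + t *\<^sub>R b) - (F x + t *\<^sub>R F' x))) \<longlongrightarrow> 0) (at 0)"
        by (simp add: has_derivative_at2)
      moreover have "filterlim ?h (at 0) sequentially"
        unfolding filterlim_at using LIMSEQ_inverse_real_of_nat
        by (auto simp: inverse_eq_divide add.commute)
      ultimately have "(\<lambda>n. (1 / norm (?h n)) *\<^sub>R (F (x + ?h n *\<^sub>R b) - (F x + ?h n *\<^sub>R F' x))) \<longlonglongrightarrow> 0"
        by (rule filterlim_compose)
      also have "(\<lambda>n. (1 / norm (?h n)) *\<^sub>R (F (x + ?h n *\<^sub>R b) - (F x + ?h n *\<^sub>R F' x))) = (\<lambda>n. D n x - F' x)"
      proof
        fix n
        have n: "1 / norm (?h n) = real n + 1" by simp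
        have "(real n + 1) *\<^sub>R (?h n *\<^sub>R F' x) = F' x" by simp
        then show "(1 / norm (?h n)) *\<^sub>R (F (x + ?h n *\<^sub>R b) - (F x + ?h n *\<^sub>R F' x)) = D n x - F' x"
          unfolding n D_def diff_add_eq_diff_diff_swap[of _ _ "?h n *\<^sub>R F' x"]
          by (simp only: scaleR_diff_right scaleR_add_right add.commute[of x]) (simp add: algebra_simps)
      qed
      finally show "(\<lambda>n. D n x) \<longlonglongrightarrow> F' x" by (rule LIM_zero_cancel)
    qed
    show "AE x in lborel. norm (D n x) \<le> B * indicator (cball 0 (1 + norm b)) x" for n
      using bound by simp
  qed (auto simp: D_def)
  moreover have "(LINT x|lborel. D n x) = 0" for n
    unfolding D_def by (simp add: tr Fi)
  ultimately show ?thesis using LIMSEQ_unique[OF _ tendsto_const] by simp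
qed

lemma integral_ball_radial_scale:
  fixes G :: "'a::euclidean_space \<Rightarrow> complex"
  assumes hom: "\<And>t x. t > 0 \<Longrightarrow> G (t *\<^sub>R x) = G x" and [measurable]: "G \<in> borel_measurable borel" and r: "r > 0"
  shows "(LINT x:ball 0 r|lborel. G x) = of_real (r ^ DIM('a)) * (LINT x:ball 0 1|lborel. G x)"
proof -
  have i: "indicator (ball 0 r) (0 + r *\<^sub>R x) = (indicator (ball 0 1) x :: real)" for x :: 'a
    using r by (simp add: indicator_def)
  have [measurable]: "ball (0::'a) r \<in> sets borel" by simp
  have "(LINT x:ball 0 r|lborel. G x) = (LINT x|density (distr lborel borel (\<lambda>x. 0 + r *\<^sub>R x)) (\<lambda>_. \<bar>r\<bar>^DIM('a)). indicator (ball 0 r) x *\<^sub>R G x)"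
    unfolding set_lebesgue_integral_def using r by (subst lborel_affine[of r 0]) auto
  also have "\<dots> = (LINT x|lborel. r ^ DIM('a) *\<^sub>R (indicator (ball 0 r) (0 + r *\<^sub>R x) *\<^sub>R G (0 + r *\<^sub>R x)))"
    using r by (subst integral_density) (auto simp: integral_distr)
  also have "\<dots> = r ^ DIM('a) *\<^sub>R (LINT x:ball 0 1|lborel. G x)"
    unfolding i set_lebesgue_integral_def using r by (simp add: hom del: scaleR_scaleR)
  finally show ?thesis by (simp add: scaleR_conv_of_real)
qed

text \<open>This replaces integration in polar coordinates for a function that is constant along
  rays. With n the dimension, Fubini in (x, r) and the scaling of balls leave the integral of d r^(d
  - 1) (1 - r^n) over [0, 1], which is n / (n + d).\<close>

lemma integral_ball_norm_power:
  fixes G :: "'a::euclidean_space \<Rightarrow> complex"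
  assumes hom: "\<And>t x. t > 0 \<Longrightarrow> G (t *\<^sub>R x) = G x" and [measurable]: "G \<in> borel_measurable borel"
    and bd: "\<And>x. norm (G x) \<le> B" and d: "d > 0"
  shows "(LINT x:ball 0 1|lborel. of_real (norm x ^ d) * G x)
    = of_real (DIM('a) / (DIM('a) + d)) * (LINT x:ball 0 1|lborel. G x)"
proof -
  let ?n = "DIM('a)"
  define \<Phi> where "\<Phi> = (LINT x:ball 0 1|lborel. G x)"
  \<comment> \<open>\<open>|x|\<^sup>d\<close> is written as the integral of \<open>d r\<^bsup>d-1\<^esup>\<close> over \<open>0 \<le> r \<le> |x|\<close>.\<close>
  define f where "f x r = (indicator (ball 0 1) x * indicator {0..1} r * (if r \<le> norm x then 1 else 0) * (d * r ^ (d - 1))) *\<^sub>R G x" for x :: 'a and r :: real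
  have Gi: "set_integrable lborel S G" if "S \<in> sets borel" "emeasure lborel S < \<infinity>" for S
    unfolding set_integrable_def
    by (rule integrableI_bounded_set_indicator[where B=B]) (use that bd in auto)
  have inner: "(LINT r|lborel. f x r) = indicator (ball 0 1) x *\<^sub>R (of_real (norm x ^ d) * G x)" for x
  proof (cases "x \<in> ball 0 1")
    case True
    have f: "f x = (\<lambda>r::real. (indicator {0..norm x} r *\<^sub>R (d * r ^ (d - 1))) *\<^sub>R G x)"
      using True by (auto simp: f_def indicator_def fun_eq_iff)
    have I: "set_integrable lborel {0..norm x} (\<lambda>r. d * r ^ (d - 1))"
      unfolding set_integrable_def by (intro borel_integrable_compact continuous_intros compact_Icc)
    have "(LINT r:{0..norm x}|lborel. d * r ^ (d - 1)) = norm x ^ d - 0 ^ d"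
      by (rule FTC_set_lborel[OF _ _ _ I]) (auto intro!: derivative_eq_intros continuous_intros)
    moreover have "(LINT r|lborel. f x r) = (LINT r:{0..norm x}|lborel. d * r ^ (d - 1)) *\<^sub>R G x"
      unfolding f set_lebesgue_integral_def
      using I by (intro integral_scaleR_left) (simp add: set_integrable_def)
    ultimately show ?thesis using True d by (simp add: scaleR_conv_of_real)
  qed (simp add: f_def)
  have outer: "(LINT x|lborel. f x r) = (indicator {0..1} r * (d * r ^ (d - 1) * (1 - r ^ ?n))) *\<^sub>R \<Phi>" for r :: real
  proof (cases "r \<in> {0..1}")
    case True
    have sc: "(LINT x:ball 0 r|lborel. G x) = of_real (r ^ ?n) * \<Phi>"
    proof (cases "r = 0")
      case True
      then show ?thesis by (simp add: set_lebesgue_integral_def)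
    next
      case False
      then show ?thesis unfolding \<Phi>_def using \<open>r \<in> {0..1}\<close>
        by (intro integral_ball_radial_scale[OF hom]) auto
    qed
    \<comment> \<open>For r in [0, 1] the condition r \<le> |x| < 1 describes the unit ball minus
      the ball of radius r.\<close>
    have e: "f x r = (d * r ^ (d - 1)) *\<^sub>R (indicator (ball 0 1) x *\<^sub>R G x - indicator (ball 0 r) x *\<^sub>R G x)" for x
      using True by (auto simp: f_def indicator_def)
    have "(LINT x|lborel. f x r) = (d * r ^ (d - 1)) *\<^sub>R (\<Phi> - (LINT x:ball 0 r|lborel. G x))"
      unfolding e \<Phi>_def set_lebesgue_integral_def
      using Gi[OF _ emeasure_bounded_finite[OF bounded_ball], of 0 1] Gi[OF _ emeasure_bounded_finite[OF bounded_ball], of 0 r]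
      by (subst integral_scaleR_right, subst Bochner_Integration.integral_diff)
        (auto simp: set_integrable_def)
    also have "\<dots> = (d * r ^ (d - 1)) *\<^sub>R (\<Phi> - of_real (r ^ ?n) * \<Phi>)"
      unfolding sc ..
    finally show ?thesis using True by (simp add: scaleR_conv_of_real algebra_simps)
  qed (simp add: f_def)
  have fi: "integrable (lborel \<Otimes>\<^sub>M lborel) (\<lambda>(x, r). f x r)"
  proof -
    let ?A = "ball (0::'a) 1 \<times> {0..1::real}"
    let ?g = "\<lambda>(x::'a, r::real). ((if r \<le> norm x then 1 else 0) * (d * r ^ (d - 1))) *\<^sub>R G x"
    have "integrable (lborel \<Otimes>\<^sub>M lborel) (\<lambda>z. indicator ?A z *\<^sub>R ?g z)"
    proof (rule integrableI_bounded_set_indicator[where B="d * B"])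
      show "emeasure (lborel \<Otimes>\<^sub>M lborel) ?A < \<infinity>"
        by (subst lborel.emeasure_pair_measure_Times)
           (use emeasure_bounded_finite[OF bounded_ball, of "0::'a" 1] in \<open>auto simp: ennreal_mult_less_top\<close>)
      have "norm (?g (x, r)) \<le> d * B" if "(x, r) \<in> ?A" for x :: 'a and r :: real
      proof -
        have B: "0 \<le> B" by (rule order_trans[OF norm_ge_zero bd[of 0]])
        have "r ^ (d - 1) \<le> 1" using that by (auto intro: power_le_one)
        then have "r ^ (d - 1) * norm (G x) \<le> 1 * B" using that bd by (intro mult_mono) auto
        then have "d * (r ^ (d - 1) * norm (G x)) \<le> d * (1 * B)" by (rule mult_left_mono) simp
        then show ?thesis using that B by (auto simp: abs_mult mult.assoc)
      qed
      then show "AE z in lborel \<Otimes>\<^sub>M lborel. z \<in> ?A \<longrightarrow> norm (?g z) \<le> d * B" by auto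
    qed (auto intro!: measurable_Pair1' simp: split_beta')
    also have "(\<lambda>z. indicator ?A z *\<^sub>R ?g z) = (\<lambda>(x, r). f x r)"
      by (auto simp: f_def indicator_def fun_eq_iff)
    finally show ?thesis .
  qed
  have "(LINT x:ball 0 1|lborel. of_real (norm x ^ d) * G x) = (LINT x|lborel. LINT r|lborel. f x r)"
    unfolding inner set_lebesgue_integral_def ..
  also have "\<dots> = (LINT r|lborel. LINT x|lborel. f x r)"
    by (rule lborel_pair.Fubini_integral[OF fi, symmetric])
  also have "\<dots> = (LINT r:{0..1::real}|lborel. (real d * r ^ (d - 1) * (1 - r ^ ?n))) *\<^sub>R \<Phi>"
  proof -
    have "integrable lborel (\<lambda>r. indicator {0..1} r *\<^sub>R (d * r ^ (d - 1) * (1 - r ^ ?n)))"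
      by (intro borel_integrable_compact continuous_intros compact_Icc)
    then show ?thesis
      unfolding outer set_lebesgue_integral_def
      by (subst integral_scaleR_left[symmetric]) auto
  qed
  also have "(LINT r:{0..1::real}|lborel. (real d * r ^ (d - 1) * (1 - r ^ ?n))) = ?n / (?n + d)"
  proof -
    let ?F = "\<lambda>r::real. r ^ d - d / (d + ?n) * r ^ (d + ?n)"
    have "(LINT r:{0..1::real}|lborel. (real d * r ^ (d - 1) * (1 - r ^ ?n))) = ?F 1 - ?F 0"
    proof (rule FTC_set_lborel)
      show "set_integrable lborel {0..1} (\<lambda>r. d * r ^ (d - 1) * (1 - r ^ ?n))"
        unfolding set_integrable_def by (intro borel_integrable_compact continuous_intros compact_Icc)
      show "continuous_on {0..1} ?F" by (intro continuous_intros)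
      fix x :: real
      have "d + ?n - 1 = d - 1 + ?n" using d by simp
      moreover have "real d / (d + ?n) * (d + ?n) = d" using d by simp
      ultimately have e: "d * x ^ (d - 1) - d / (d + ?n) * ((d + ?n) * x ^ (d + ?n - 1)) = d * x ^ (d - 1) * (1 - x ^ ?n)"
        by (simp only: mult.assoc[symmetric] power_add) (simp add: algebra_simps)
      show "(?F has_real_derivative d * x ^ (d - 1) * (1 - x ^ ?n)) (at x)"
        by (subst e[symmetric]) (rule derivative_eq_intros refl | simp)+
    qed simp
    also have "\<dots> = ?n / (?n + d)"
    proof -
      have "(0::real) ^ d = 0" "(0::real) ^ (d + ?n) = 0" using d by auto
      then show ?thesis by (simp only: power_one) (simp add: field_simps)
    qed
    finally show ?thesis .
  qed
  finally show ?thesis by (simp add: \<Phi>_def scaleR_conv_of_real)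
qed

text \<open>The square removes the kink of the cutoff at 0, so that the weight W below is
  continuously differentiable across the unit sphere.\<close>

lemma DERIV_max_0_power2: "((\<lambda>r::real. (max 0 r)\<^sup>2) has_real_derivative 2 * max 0 r) (at r)"
proof -
  consider "r > 0" | "r < 0" | "r = 0" by linarith
  then show ?thesis
  proof cases
    case 1
    have "((\<lambda>r::real. r\<^sup>2) has_real_derivative 2 * max 0 r) (at r)"
      using 1 by (auto intro!: derivative_eq_intros)
    then show ?thesis
      by (rule has_field_derivative_transform_within_open[where S="{0<..}"]) (use 1 in auto)
  next
    case 2
    have "((\<lambda>r::real. 0) has_real_derivative 2 * max 0 r) (at r)"
      using 2 by auto
    then show ?thesis
      by (rule has_field_derivative_transform_within_open[where S="{..<0}"]) (use 2 in auto)
  next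
    case 3
    have "((\<lambda>h::real. max 0 h) \<longlongrightarrow> max 0 0) (at 0)" by (intro tendsto_intros)
    then have "((\<lambda>h::real. max 0 h) \<longlongrightarrow> 0) (at 0)" by simp
    then have "((\<lambda>h::real. (max 0 h)\<^sup>2 / h) \<longlongrightarrow> 0) (at 0)"
      by (rule Lim_transform_eventually)
         (auto simp: eventually_at_filter max_def power2_eq_square)
    then show ?thesis using 3 by (simp add: DERIV_def)
  qed
qed

text \<open>
  Green's identity for \<open>div (W \<nabla>)\<close> with \<open>W = (max 0 (1 - |x|\<^sup>2))\<^sup>2\<close>. As \<open>\<nabla>W\<close> is radial, Euler's identity
  turns \<open>\<nabla>W \<bullet> \<nabla>u\<close> into a multiple of \<open>l u\<close>, and no boundary terms arise.
\<close>
lemma solid_harmonics_ball_orthogonal: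
  fixes u v :: "'a::euclidean_space \<Rightarrow> complex"
  assumes u: "u \<in> solid_harmonics l" and v: "v \<in> solid_harmonics l'" and "l \<noteq> l'"
  shows "(LINT x:ball 0 1|lborel. of_real (1 - (norm x)\<^sup>2) * (u x * v x)) = 0"
proof -
  have pu: "polynomial_function u" and pv: "polynomial_function v"
    using u v by (auto simp: solid_harmonics_def)
  let ?D = "partial_derivative"
  note pu' = polynomial_function_partial(1)[OF pu] and pv' = polynomial_function_partial(1)[OF pv]
  note pu'' = polynomial_function_partial(1)[OF pu'] and pv'' = polynomial_function_partial(1)[OF pv']
  define m where "m x = max 0 (1 - x \<bullet> x)" for x :: 'a
  \<comment> \<open>Component b of W (v \<nabla>u - u \<nabla>v); \<open>F'\<close> is its
    derivative along b, in which the products of first derivatives of u and v cancel. Each term of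
    \<open>F'\<close> keeps a factor \<open>m\<close>, so it is continuous and vanishes outside the
    ball.\<close>
  define F where "F b x = of_real ((m x)\<^sup>2) * (?D b u x * v x - u x * ?D b v x)" for b x
  define F' where "F' b x = of_real (2 * m x * (- 2 * (x \<bullet> b))) * (?D b u x * v x - u x * ?D b v x)
      + of_real ((m x)\<^sup>2) * (?D b (?D b u) x * v x - u x * ?D b (?D b v) x)" for b x
  have cm: "continuous_on UNIV m" unfolding m_def by (intro continuous_intros)
  note cont = cm continuous_on_polymonial_function[OF pu] continuous_on_polymonial_function[OF pv]
    continuous_on_polymonial_function[OF pu'] continuous_on_polymonial_function[OF pv']
    continuous_on_polymonial_function[OF pu''] continuous_on_polymonial_function[OF pv'']
  have m0: "m x = 0" if "norm x \<ge> 1" for x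
    using that power_mono[of 1 "norm x" 2] by (simp add: m_def flip: power2_norm_eq_inner)
  have cF: "continuous_on UNIV (F b)" "continuous_on UNIV (F' b)" for b
    unfolding F_def F'_def by (intro continuous_intros cont)+
  have supp: "F b x = 0" "F' b x = 0" if "norm x > 1" for b x
    using m0[of x] that by (auto simp: F_def F'_def)
  have dF: "((\<lambda>t. F b (x + t *\<^sub>R b)) has_vector_derivative F' b (x + s *\<^sub>R b)) (at s)" for b x s
  proof -
    have "((\<lambda>t. 1 - (x + t *\<^sub>R b) \<bullet> (x + t *\<^sub>R b)) has_real_derivative - 2 * ((x + s *\<^sub>R b) \<bullet> b)) (at s)"
      by (auto intro!: derivative_eq_intros simp: inner_simps algebra_simps inner_commute)
    from DERIV_chain2[OF DERIV_max_0_power2 this]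
    have "((\<lambda>t. (m (x + t *\<^sub>R b))\<^sup>2) has_vector_derivative 2 * m (x + s *\<^sub>R b) * (- 2 * ((x + s *\<^sub>R b) \<bullet> b))) (at s)"
      unfolding m_def has_real_derivative_iff_has_vector_derivative[symmetric] .
    from bounded_linear.has_vector_derivative[OF bounded_linear_of_real this]
    have w: "((\<lambda>t. complex_of_real ((m (x + t *\<^sub>R b))\<^sup>2)) has_vector_derivative
        of_real (2 * m (x + s *\<^sub>R b) * (- 2 * ((x + s *\<^sub>R b) \<bullet> b)))) (at s)" .
    note d = polynomial_function_partial(2)[OF pu] polynomial_function_partial(2)[OF pv]
      polynomial_function_partial(2)[OF pu'] polynomial_function_partial(2)[OF pv']
    show ?thesis
      unfolding F_def
      by (rule has_vector_derivative_eq_rhs[OF has_vector_derivative_mult[OF w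
            has_vector_derivative_diff[OF has_vector_derivative_mult[OF d(3) d(2)] has_vector_derivative_mult[OF d(1) d(4)]]]])
         (simp add: F'_def algebra_simps)
  qed
  have "(LINT x|lborel. F' b x) = 0" for b
    by (rule integral_directional_derivative_eq_0[OF dF cF supp])
  moreover have "(LINT x|lborel. (\<Sum>b\<in>Basis. F' b x)) = (\<Sum>b\<in>Basis. (LINT x|lborel. F' b x))"
    by (intro Bochner_Integration.integral_sum integrable_continuous_support_cball cF supp)
  ultimately have 1: "(LINT x|lborel. (\<Sum>b\<in>Basis. F' b x)) = 0" by simp
  have 2: "(\<Sum>b\<in>Basis. F' b x) = (- 4 * (of_nat l - of_nat l')) * (indicator (ball 0 1) x *\<^sub>R (of_real (1 - (norm x)\<^sup>2) * (u x * v x)))" for x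
  proof -
    have lu: "(\<Sum>b\<in>Basis. ?D b (?D b u) x) = 0" and lv: "(\<Sum>b\<in>Basis. ?D b (?D b v) x) = 0"
      using u v laplacian_polynomial[OF pu, of x] laplacian_polynomial[OF pv, of x] by (auto simp: solid_harmonics_def)
    have eu: "(\<Sum>b\<in>Basis. of_real (x \<bullet> b) * ?D b u x) = of_nat l * u x"
      by (rule euler_homogeneous[OF pu]) (use u in \<open>simp add: solid_harmonics_def\<close>)
    have ev: "(\<Sum>b\<in>Basis. of_real (x \<bullet> b) * ?D b v x) = of_nat l' * v x"
      by (rule euler_homogeneous[OF pv]) (use v in \<open>simp add: solid_harmonics_def\<close>)
    have "(\<Sum>b\<in>Basis. F' b x) = - 4 * of_real (m x) *
        ((\<Sum>b\<in>Basis. of_real (x \<bullet> b) * ?D b u x) * v x - u x * (\<Sum>b\<in>Basis. of_real (x \<bullet> b) * ?D b v x))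
      + of_real ((m x)\<^sup>2) * ((\<Sum>b\<in>Basis. ?D b (?D b u) x) * v x - u x * (\<Sum>b\<in>Basis. ?D b (?D b v) x))"
      unfolding F'_def sum_distrib_left sum_distrib_right sum_subtractf[symmetric] sum.distrib[symmetric]
      by (rule sum.cong) (auto simp: algebra_simps)
    \<comment> \<open>Harmonicity removes the second derivatives; Euler's identity leaves the factor
      l - l', which is not 0.\<close>
    also have "\<dots> = - 4 * (of_nat l - of_nat l') * (of_real (m x) * (u x * v x))"
      unfolding lu lv eu ev by (simp add: algebra_simps)
    also have "of_real (m x) * (u x * v x) = indicator (ball 0 1) x *\<^sub>R (of_real (1 - (norm x)\<^sup>2) * (u x * v x))"
    proof (cases "norm x < 1")
      case True
      then have "m x = 1 - (norm x)\<^sup>2"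
        by (simp add: m_def power2_norm_eq_inner[symmetric] power_le_one)
      then show ?thesis using True by simp
    qed (use m0 in simp)
    finally show ?thesis .
  qed
  show ?thesis
    using 1[unfolded 2 integral_mult_right_zero] \<open>l \<noteq> l'\<close> unfolding set_lebesgue_integral_def by simp
qed

text \<open>The inner product on the sphere conjugates one factor, whereas
  \<open>solid_harmonics_ball_orthogonal\<close> is bilinear. The Laplacian commutes with
  conjugation.\<close>

lemma solid_harmonics_cnj:
  assumes "v \<in> solid_harmonics l"
  shows "(\<lambda>x. cnj (v x)) \<in> solid_harmonics l"
proof -
  have p: "polynomial_function v" using assms by (simp add: solid_harmonics_def)
  then have p': "polynomial_function (\<lambda>x. cnj (v x))"
    unfolding polynomial_function_complex_iff complex_cnj by (simp add: real_polynomial_function_minus)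
  have d: "partial_derivative b (\<lambda>x. cnj (w x)) = (\<lambda>x. cnj (partial_derivative b w x))"
    if w: "polynomial_function w" for b and w :: "'a \<Rightarrow> complex"
  proof
    fix x
    have "((\<lambda>t. w (x + t *\<^sub>R b)) has_vector_derivative partial_derivative b w x) (at 0)"
      using polynomial_function_partial(2)[OF w, of x b 0] by simp
    then show "partial_derivative b (\<lambda>x. cnj (w x)) x = cnj (partial_derivative b w x)"
      unfolding partial_derivative_def[of b "\<lambda>x. cnj (w x)"]
      by - (rule vector_derivative_at, erule has_vector_derivative_cnj)
  qed
  have "laplacian (\<lambda>x. cnj (v x)) x = cnj (laplacian v x)" for x
    unfolding laplacian_polynomial[OF p] laplacian_polynomial[OF p'] d[OF p]
      d[OF polynomial_function_partial(1)[OF p]] by simp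
  then show ?thesis using assms p' by (simp add: solid_harmonics_def)
qed

section \<open>From the ball to the sphere\<close>

lemma scale_measure_eq_density: "scale_measure r M = density M (\<lambda>_. r)"
  by (rule measure_eqI) (simp_all add: emeasure_density nn_integral_cmult_indicator)

text \<open>The definition by cones makes this the integral over the ball of a function constant
  along rays; the origin, excluded there, is a null set.\<close>

lemma integral_sphere_measure:
  fixes f :: "'a::euclidean_space \<Rightarrow> complex"
  assumes [measurable]: "f \<in> borel_measurable borel"
  shows "(LINT x|sphere_measure. f x) = of_nat DIM('a) * (LINT x:ball 0 1|lborel. f (sgn x))"
proof -
  let ?B = "ball (0::'a) 1 - {0}"
  have [measurable]: "(sgn :: 'a \<Rightarrow> 'a) \<in> borel_measurable borel"
    unfolding sgn_div_norm by measurable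
  have fs: "(\<lambda>x. f (sgn x)) \<in> borel_measurable borel"
    by measurable
  have fm: "f \<in> borel_measurable (restrict_space borel (sphere 0 1))"
    by (rule measurable_restrict_space1) fact
  have "(LINT x|sphere_measure. f x) = (LINT x|distr (restrict_space lborel ?B) (restrict_space borel (sphere 0 1)) sgn. real DIM('a) *\<^sub>R f x)"
    unfolding sphere_measure_def scale_measure_eq_density
    by (rule integral_density) (simp_all add: fm)
  also have "\<dots> = (LINT x|restrict_space lborel ?B. real DIM('a) *\<^sub>R f (sgn x))"
    by (rule integral_distr[OF measurable_sgn_sphere]) (rule borel_measurable_scaleR[OF borel_measurable_const fm])
  also have "\<dots> = (LINT x|lborel. indicator ?B x *\<^sub>R (real DIM('a) *\<^sub>R f (sgn x)))"
    by (subst integral_restrict_space) auto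
  also have "\<dots> = (LINT x|lborel. real DIM('a) *\<^sub>R (indicator (ball 0 1) x *\<^sub>R f (sgn x)))"
  proof (rule integral_cong_AE)
    show "AE x in lborel. indicator ?B x *\<^sub>R (real DIM('a) *\<^sub>R f (sgn x)) = real DIM('a) *\<^sub>R (indicator (ball 0 1) x *\<^sub>R f (sgn x))"
      using AE_lborel_singleton[of "0::'a"] by eventually_elim (simp add: indicator_def)
  qed (intro borel_measurable_scaleR borel_measurable_indicator borel_measurable_const; simp add: fs)+
  finally show ?thesis by (simp add: set_lebesgue_integral_def scaleR_conv_of_real)
qed

lemma finite_measure_sphere: "finite_measure (sphere_measure :: 'a::euclidean_space measure)"
proof
  let ?B = "ball (0::'a) 1 - {0}"
  let ?N = "restrict_space lborel ?B"
  have "emeasure ?N (space ?N) = emeasure lborel ?B"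
    by (simp add: space_restrict_space emeasure_restrict_space)
  also have "\<dots> < \<infinity>"
    by (rule emeasure_bounded_finite) (rule bounded_subset[OF bounded_ball[of 0 1]], auto)
  finally have "emeasure ?N (sgn -` sphere 0 1 \<inter> space ?N) < \<infinity>"
    by (rule le_less_trans[OF emeasure_space])
  moreover have "emeasure (sphere_measure :: 'a measure) (sphere 0 1) = ennreal (real DIM('a)) * emeasure ?N (sgn -` sphere 0 1 \<inter> space ?N)"
    unfolding sphere_measure_def emeasure_scale_measure
    by (subst emeasure_distr[OF measurable_sgn_sphere]) (simp_all add: sets_restrict_space image_iff, rule bexI[of _ UNIV], simp_all)
  ultimately have "emeasure (sphere_measure :: 'a measure) (sphere 0 1) < \<infinity>"
    by (simp only: infinity_ennreal_def ennreal_mult_less_top) simp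
  then show "emeasure (sphere_measure :: 'a measure) (space sphere_measure) \<noteq> \<infinity>"
    by (simp add: space_sphere_measure)
qed

text \<open>With d = l + l' the product of the solid harmonics is |x|^d G(x), G constant along rays.
  In dimension n its integral over the ball against 1 - |x|^2 is 0, but also n / (n + d) - n / (n +
  d + 2) > 0 times the integral of G, which up to the factor n is the integral over the
  sphere.\<close>

lemma spherical_harmonics_orthogonal:
  fixes f g :: "'a::euclidean_space \<Rightarrow> complex"
  assumes "f \<in> spherical_harmonics l" "g \<in> spherical_harmonics l'" and ne: "l \<noteq> l'"
  shows "(LINT x|sphere_measure. f x * cnj (g x)) = 0"
proof -
  obtain u w where u: "u \<in> solid_harmonics l" "f = on_set (sphere 0 1) u"
    and w: "w \<in> solid_harmonics l'" "g = on_set (sphere 0 1) w"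
    using assms by (auto simp: spherical_harmonics_def)
  define v where "v x = cnj (w x)" for x
  have v: "v \<in> solid_harmonics l'" unfolding v_def by (rule solid_harmonics_cnj[OF w(1)])
  define G where "G x = u (sgn x) * v (sgn x)" for x
  define d where "d = l + l'"
  have d: "d > 0" using ne by (auto simp: d_def)
  have cu: "continuous_on UNIV u" and cv: "continuous_on UNIV v"
    using u v by (auto simp: solid_harmonics_def intro: continuous_on_polymonial_function)
  have [measurable]: "u \<in> borel_measurable borel" "v \<in> borel_measurable borel"
    using cu cv by (auto intro: borel_measurable_continuous_onI)
  have [measurable]: "(sgn :: 'a \<Rightarrow> 'a) \<in> borel_measurable borel"
    unfolding sgn_div_norm by measurable
  have Gm[measurable]: "G \<in> borel_measurable borel" unfolding G_def by measurable
  have "compact ((\<lambda>x. u x * v x) ` cball 0 1)"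
    by (intro compact_continuous_image continuous_intros continuous_on_subset[OF cu] continuous_on_subset[OF cv] compact_cball) auto
  then obtain B where "\<And>x. norm x \<le> 1 \<Longrightarrow> norm (u x * v x) \<le> B"
    using compact_imp_bounded bounded_iff by (metis (no_types, lifting) image_eqI mem_cball_0)
  then have GB: "norm (G x) \<le> B" for x by (simp add: G_def norm_sgn)
  have hom: "G (t *\<^sub>R x) = G x" if "t > 0" for t x using that by (simp add: G_def sgn_scaleR)
  have uv: "u x * v x = of_real (norm x ^ d) * G x" for x
  proof -
    have "u (norm x *\<^sub>R sgn x) = of_real (norm x ^ l) * u (sgn x)" "v (norm x *\<^sub>R sgn x) = of_real (norm x ^ l') * v (sgn x)"
      using u v by (auto simp: solid_harmonics_def)
    moreover have "norm x *\<^sub>R sgn x = x" by (cases "x = 0") (auto simp: sgn_div_norm)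
    ultimately show ?thesis by (simp add: G_def d_def power_add)
  qed
  let ?I = "LINT x:ball 0 1|lborel. G x"
  let ?n = "real DIM('a)"
  have i: "set_integrable lborel (ball 0 1) (\<lambda>x. of_real (norm x ^ e) * G x)" for e
    unfolding set_integrable_def
  proof (rule integrableI_bounded_set_indicator[where B=B])
    have "norm (of_real (norm x ^ e) * G x) \<le> B" if "x \<in> ball 0 1" for x
    proof -
      have "norm x ^ e * norm (G x) \<le> 1 * B"
        using that GB by (intro mult_mono power_le_one) auto
      then show ?thesis by (simp add: norm_mult norm_power)
    qed
    then show "AE x in lborel. x \<in> ball 0 1 \<longrightarrow> norm (of_real (norm x ^ e) * G x) \<le> B" by simp
  qed (use emeasure_bounded_finite[OF bounded_ball, of "0::'a" 1] in auto)
  have radial: "(LINT x:ball 0 1|lborel. of_real (norm x ^ d) * G x) = of_real (?n / (?n + d)) * ?I"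
    "(LINT x:ball 0 1|lborel. of_real (norm x ^ (d + 2)) * G x) = of_real (?n / (?n + (d + 2))) * ?I"
    using integral_ball_norm_power[OF hom Gm GB, of d] integral_ball_norm_power[OF hom Gm GB, of "d + 2"] d by simp_all
  have "0 = (LINT x:ball 0 1|lborel. of_real (1 - (norm x)\<^sup>2) * (u x * v x))"
    using solid_harmonics_ball_orthogonal[OF u(1) v ne] by simp
  also have "\<dots> = (LINT x:ball 0 1|lborel. of_real (norm x ^ d) * G x - of_real (norm x ^ (d + 2)) * G x)"
    unfolding uv by (simp add: algebra_simps power_add power2_eq_square)
  also have "\<dots> = of_real (?n / (?n + d)) * ?I - of_real (?n / (?n + (d + 2))) * ?I"
    by (simp only: set_integral_diff(2)[OF i i] radial)
  also have "\<dots> = of_real (?n / (?n + d) - ?n / (?n + (d + 2))) * ?I" by (simp add: algebra_simps)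
  finally have "of_real (?n / (?n + d) - ?n / (?n + (d + 2))) * ?I = 0" by simp
  moreover have "?n / (?n + d) - ?n / (?n + (d + 2)) > 0" by (auto intro!: divide_strict_left_mono mult_pos_pos add_pos_nonneg)
  ultimately have I: "?I = 0" by simp
  have "(LINT x|sphere_measure. f x * cnj (g x)) = (LINT x|sphere_measure. u x * v x)"
    by (rule Bochner_Integration.integral_cong) (auto simp: space_sphere_measure u w on_set_def v_def)
  also have "\<dots> = of_nat DIM('a) * ?I"
    unfolding G_def by (rule integral_sphere_measure) auto
  finally show ?thesis using I by simp
qed

section \<open>Weighted projections\<close>

lemma borel_measurable_cnj [measurable (raw)]:
  "f \<in> borel_measurable M \<Longrightarrow> (\<lambda>x. cnj (f x)) \<in> borel_measurable M"
  by (rule measurable_compose[OF _ borel_measurable_continuous_onI]) (auto intro: continuous_on_cnj continuous_on_id)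

lemma integrable_mult_square_integrable:
  fixes f g :: "'a \<Rightarrow> complex"
  assumes [measurable]: "f \<in> borel_measurable M" "g \<in> borel_measurable M"
    and i: "integrable M (\<lambda>x. (cmod (f x))\<^sup>2)" "integrable M (\<lambda>x. (cmod (g x))\<^sup>2)"
  shows "integrable M (\<lambda>x. f x * g x)"
proof (rule Bochner_Integration.integrable_bound[OF Bochner_Integration.integrable_add[OF i]])
  have "cmod (f x) * cmod (g x) \<le> (cmod (f x))\<^sup>2 + (cmod (g x))\<^sup>2" for x
  proof -
    have "0 \<le> cmod (f x) * cmod (g x)" by simp
    moreover have "2 * cmod (f x) * cmod (g x) \<le> (cmod (f x))\<^sup>2 + (cmod (g x))\<^sup>2" by (rule sum_squares_bound)
    ultimately show ?thesis by linarith
  qed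
  then show "AE x in M. norm (f x * g x) \<le> norm ((cmod (f x))\<^sup>2 + (cmod (g x))\<^sup>2)"
    by (simp add: norm_mult)
qed simp

lemma sum_fun_apply: "(\<Sum>i\<in>I. f i) x = (\<Sum>i\<in>I. f i x)"
  for f :: "'i \<Rightarrow> 'a \<Rightarrow> 'b::comm_monoid_add"
  by (induction I rule: infinite_finite_induct) simp_all

text \<open>\<open>orthonormal_basis\<close> indexes its vectors by the dimension of the span, so
  normalizing is not enough: integration against each vector shows independence, which identifies
  that dimension with \<open>card I\<close>.\<close>

lemma orthonormal_basis_of_orthogonal_family:
  fixes T :: "'i \<Rightarrow> 'a \<Rightarrow> complex"
  assumes fin: "finite I"
    and int: "\<And>i j. i \<in> I \<Longrightarrow> j \<in> I \<Longrightarrow> integrable M (\<lambda>x. T i x * cnj (T j x))"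
    and orth: "\<And>i j. i \<in> I \<Longrightarrow> j \<in> I \<Longrightarrow> i \<noteq> j \<Longrightarrow> (LINT x|M. T i x * cnj (T j x)) = 0"
    and pos: "\<And>i. i \<in> I \<Longrightarrow> (LINT x|M. T i x * cnj (T i x)) = of_real (\<nu> i)" "\<And>i. i \<in> I \<Longrightarrow> \<nu> i > 0"
  shows "\<exists>e. orthonormal_basis M (cspan (T ` I)) e"
proof -
  let ?d = "card I"
  obtain b where b: "bij_betw b {1..?d} I" using ex_bij_betw_nat_finite_1[OF fin] by blast
  have bI: "b p \<in> I" if "p \<in> {1..?d}" for p by (rule bij_betw_apply[OF b that])
  have binj: "b p = b q \<longleftrightarrow> p = q" if "p \<in> {1..?d}" "q \<in> {1..?d}" for p q
    by (rule inj_on_eq_iff[OF bij_betw_imp_inj_on[OF b] that])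
  define e where "e p = (\<lambda>x. of_real (1 / sqrt (\<nu> (b p))) * T (b p) x)" for p
  have ee: "(\<lambda>x. e p x * cnj (e q x)) = (\<lambda>x. of_real (1 / sqrt (\<nu> (b p)) * (1 / sqrt (\<nu> (b q)))) * (T (b p) x * cnj (T (b q) x)))" for p q
    by (rule ext) (simp add: e_def)
  have ei: "integrable M (\<lambda>x. e p x * cnj (e q x))" if "p \<in> {1..?d}" "q \<in> {1..?d}" for p q
    unfolding ee by (intro integrable_mult_right int bI that)
  have eo: "(LINT x|M. e p x * cnj (e q x)) = (if p = q then 1 else 0)" if pq: "p \<in> {1..?d}" "q \<in> {1..?d}" for p q
  proof (cases "p = q")
    case True
    have n: "\<nu> (b q) > 0" by (intro pos(2) bI pq)
    have "(LINT x|M. e p x * cnj (e q x)) = of_real (1 / sqrt (\<nu> (b q)) * (1 / sqrt (\<nu> (b q))) * \<nu> (b q))"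
      unfolding True ee integral_mult_right_zero pos(1)[OF bI[OF pq(2)]] by simp
    also have "1 / sqrt (\<nu> (b q)) * (1 / sqrt (\<nu> (b q))) * \<nu> (b q) = 1"
      using n by (simp add: real_div_sqrt field_simps)
    finally show ?thesis using True by simp
  next
    case False
    then show ?thesis
      unfolding ee integral_mult_right_zero using orth[OF bI[OF pq(1)] bI[OF pq(2)]] binj[OF pq] by simp
  qed
  have inj: "inj_on e {1..?d}"
  proof (rule inj_onI, rule ccontr)
    fix p q assume pq: "p \<in> {1..?d}" "q \<in> {1..?d}" "e p = e q" "p \<noteq> q"
    then show False using eo[OF pq(1,2)] eo[OF pq(2,2)] unfolding pq(3) by simp
  qed
  have ind: "\<not> cfun.dependent (e ` {1..?d})"
  proof (rule cfun.independent_if_scalars_zero)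
    fix f x assume z: "(\<Sum>v\<in>e ` {1..?d}. (\<lambda>x. f v * v x)) = 0" and x: "x \<in> e ` {1..?d}"
    from x obtain q where q: "q \<in> {1..?d}" "x = e q" by blast
    have "(\<Sum>p\<in>{1..?d}. f (e p) * e p y) = 0" for y
      using fun_cong[OF z, of y] unfolding sum_fun_apply sum.reindex[OF inj] by simp
    then have "(LINT y|M. (\<Sum>p\<in>{1..?d}. f (e p) * e p y) * cnj (e q y)) = 0" by simp
    also have "(LINT y|M. (\<Sum>p\<in>{1..?d}. f (e p) * e p y) * cnj (e q y))
        = (\<Sum>p\<in>{1..?d}. f (e p) * (LINT y|M. e p y * cnj (e q y)))"
      unfolding sum_distrib_right mult.assoc using ei q
      by (subst Bochner_Integration.integral_sum) auto
    also have "\<dots> = (\<Sum>p\<in>{1..?d}. if p = q then f (e q) else 0)"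
      by (intro sum.cong refl) (simp add: eo[OF _ q(1)] del: atLeastAtMost_iff One_nat_def)
    also have "\<dots> = f (e q)" using q(1) by simp
    finally show "f x = 0" using q by simp
  qed simp
  have span: "cspan (e ` {1..?d}) = cspan (T ` I)"
  proof (rule antisym)
    show "cspan (e ` {1..?d}) \<subseteq> cspan (T ` I)"
    proof (rule cfun.span_minimal)
      show "e ` {1..?d} \<subseteq> cspan (T ` I)"
        unfolding e_def by (intro image_subsetI cfun.span_scale cfun.span_base imageI bI)
    qed (rule cfun.subspace_span)
    show "cspan (T ` I) \<subseteq> cspan (e ` {1..?d})"
    proof (rule cfun.span_minimal)
      show "T ` I \<subseteq> cspan (e ` {1..?d})"
      proof (intro image_subsetI)
        fix i assume "i \<in> I"
        then obtain p where p: "p \<in> {1..?d}" "i = b p" using bij_betw_imp_surj_on[OF b] by blast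
        have "\<nu> (b p) > 0" using pos(2) bI[OF p(1)] by auto
        then have "T i = (\<lambda>x. of_real (sqrt (\<nu> (b p))) * e p x)"
          by (auto simp: e_def p fun_eq_iff)
        also have "\<dots> \<in> cspan (e ` {1..?d})"
          using p by (intro cfun.span_scale cfun.span_base) auto
        finally show "T i \<in> cspan (e ` {1..?d})" .
      qed
    qed (rule cfun.subspace_span)
  qed
  have "cdim (cspan (T ` I)) = ?d"
    unfolding span[symmetric] using cfun.dim_span_eq_card_independent[OF ind] card_image[OF inj] by simp
  then show ?thesis
    unfolding orthonormal_basis_def using eo span by (intro exI[of _ e]) auto
qed

text \<open>Duality: if f is the projection of w g, then the squared norm of f equals its pairing
  with w g, hence is at most the norm of w f times that of g. The bound on V turns this into |f|^2
  \<le> A |g|^2 for the L^2 norms, and a second use into |w f|^2 \<le> A^2 |g|^2.\<close>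

lemma weighted_projection_bound:
  fixes w g :: "'a \<Rightarrow> complex"
  assumes ob: "orthonormal_basis M V e"
    and sq: "\<And>f. f \<in> V \<Longrightarrow> f \<in> borel_measurable M" "\<And>f. f \<in> V \<Longrightarrow> integrable M (\<lambda>x. (cmod (f x))\<^sup>2)"
    and w[measurable]: "w \<in> borel_measurable M"
    and bound: "\<And>f. f \<in> V \<Longrightarrow> integrable M (\<lambda>x. (cmod (w x * f x))\<^sup>2)"
      "\<And>f. f \<in> V \<Longrightarrow> (LINT x|M. (cmod (w x * f x))\<^sup>2) \<le> A * (LINT x|M. (cmod (f x))\<^sup>2)"
    and A: "A > 0" and g: "square_integrable M g"
  shows "(\<integral>\<^sup>+ z. ennreal ((cmod (w z * (LINT \<zeta>|M. (\<Sum>i\<in>{1..cdim V}. e i z * cnj (e i \<zeta>)) * (w \<zeta> * g \<zeta>))))\<^sup>2) \<partial>M)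
    \<le> ennreal (A\<^sup>2) * (\<integral>\<^sup>+ z. ennreal ((cmod (g z))\<^sup>2) \<partial>M)"
proof -
  let ?I = "{1..cdim V}"
  have span: "cspan (e ` ?I) = V" and eo: "\<And>p q. p \<in> ?I \<Longrightarrow> q \<in> ?I \<Longrightarrow> (LINT x|M. e p x * cnj (e q x)) = (if p = q then 1 else 0)"
    using ob unfolding orthonormal_basis_def by blast+
  have eV: "e p \<in> V" if "p \<in> ?I" for p
    using cfun.span_base[OF imageI[OF that], of e] unfolding span .
  have comb: "(\<lambda>x. \<Sum>p\<in>?I. c p * e p x) \<in> V" for c
  proof -
    have "(\<Sum>p\<in>?I. (\<lambda>x. c p * e p x)) \<in> cspan (e ` ?I)"
      by (intro cfun.span_sum cfun.span_scale cfun.span_base) auto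
    moreover have "(\<Sum>p\<in>?I. (\<lambda>x. c p * e p x)) = (\<lambda>x. \<Sum>p\<in>?I. c p * e p x)"
      by (simp add: fun_eq_iff sum_fun_apply)
    ultimately show ?thesis unfolding span by simp
  qed
  have gm[measurable]: "g \<in> borel_measurable M" and gi: "integrable M (\<lambda>x. (cmod (g x))\<^sup>2)"
    using g by (auto simp: square_integrable_def)
  have em: "e p \<in> borel_measurable M" if "p \<in> ?I" for p by (rule sq(1)[OF eV[OF that]])
  have ei: "integrable M (\<lambda>x. e p x * cnj (e q x))" if "p \<in> ?I" "q \<in> ?I" for p q
    by (rule integrable_mult_square_integrable)
       (simp_all add: borel_measurable_cnj sq eV that del: atLeastAtMost_iff One_nat_def)
  \<comment> \<open>w g need not be square integrable; the weight is moved to f, where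
    \<open>bound(1)\<close> controls it.\<close>
  have fwg: "integrable M (\<lambda>x. cnj (f x) * (w x * g x))" if f: "f \<in> V" for f
  proof -
    note [measurable] = sq(1)[OF f]
    have "(\<lambda>x. (cmod (cnj (f x) * w x))\<^sup>2) = (\<lambda>x. (cmod (w x * f x))\<^sup>2)"
      by (simp add: norm_mult mult.commute)
    then have "integrable M (\<lambda>x. (cnj (f x) * w x) * g x)"
      using bound(1)[OF f] by (intro integrable_mult_square_integrable gi gm) simp_all
    then show ?thesis by (simp only: mult.assoc)
  qed
  define c where "c p = (LINT x|M. cnj (e p x) * (w x * g x))" for p
  define f where "f x = (\<Sum>p\<in>?I. c p * e p x)" for x
  have fV: "f \<in> V" unfolding f_def[abs_def] by (rule comb)
  note [measurable] = sq(1)[OF fV]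
  have P: "(LINT \<zeta>|M. (\<Sum>i\<in>?I. e i z * cnj (e i \<zeta>)) * (w \<zeta> * g \<zeta>)) = f z" for z
  proof -
    have "(LINT \<zeta>|M. (\<Sum>i\<in>?I. e i z * cnj (e i \<zeta>)) * (w \<zeta> * g \<zeta>))
        = (LINT \<zeta>|M. (\<Sum>i\<in>?I. e i z * (cnj (e i \<zeta>) * (w \<zeta> * g \<zeta>))))"
      by (simp only: sum_distrib_right mult.assoc)
    also have "\<dots> = (\<Sum>i\<in>?I. (LINT \<zeta>|M. e i z * (cnj (e i \<zeta>) * (w \<zeta> * g \<zeta>))))"
      by (intro Bochner_Integration.integral_sum integrable_mult_right fwg eV)
    also have "\<dots> = f z" by (simp only: f_def c_def integral_mult_right_zero mult.commute)
    finally show ?thesis .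
  qed
  let ?S = "LINT x|M. (cmod (f x))\<^sup>2" and ?G = "LINT x|M. (cmod (g x))\<^sup>2"
  have S1: "of_real ?S = (\<Sum>p\<in>?I. c p * cnj (c p))"
  proof -
    have ff: "f x * cnj (f x) = (\<Sum>p\<in>?I. \<Sum>q\<in>?I. (c p * cnj (c q)) * (e p x * cnj (e q x)))" for x
      unfolding f_def cnj_sum complex_cnj_mult sum_product by (intro sum.cong refl) (simp only: mult_ac)
    have "of_real ?S = (LINT x|M. f x * cnj (f x))"
      by (simp only: complex_norm_square[symmetric] integral_complex_of_real)
    also have "\<dots> = (\<Sum>p\<in>?I. (LINT x|M. (\<Sum>q\<in>?I. (c p * cnj (c q)) * (e p x * cnj (e q x)))))"
      unfolding ff
      by (intro Bochner_Integration.integral_sum Bochner_Integration.integrable_sum integrable_mult_right ei)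
    also have "\<dots> = (\<Sum>p\<in>?I. \<Sum>q\<in>?I. (LINT x|M. (c p * cnj (c q)) * (e p x * cnj (e q x))))"
      by (intro sum.cong refl Bochner_Integration.integral_sum integrable_mult_right ei)
    also have "\<dots> = (\<Sum>p\<in>?I. \<Sum>q\<in>?I. if p = q then c p * cnj (c q) else 0)"
      by (intro sum.cong refl) (simp add: eo del: atLeastAtMost_iff One_nat_def)
    also have "\<dots> = (\<Sum>p\<in>?I. c p * cnj (c p))" by (rule sum.cong) (simp_all add: sum.delta)
    finally show ?thesis .
  qed
  have S2: "of_real ?S = (LINT x|M. cnj (f x) * (w x * g x))"
  proof -
    have fw: "cnj (f x) * (w x * g x) = (\<Sum>p\<in>?I. cnj (c p) * (cnj (e p x) * (w x * g x)))" for x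
      unfolding f_def cnj_sum complex_cnj_mult sum_distrib_right by (simp only: mult.assoc)
    have "(LINT x|M. cnj (f x) * (w x * g x)) = (\<Sum>p\<in>?I. (LINT x|M. cnj (c p) * (cnj (e p x) * (w x * g x))))"
      unfolding fw by (intro Bochner_Integration.integral_sum integrable_mult_right fwg eV)
    also have "\<dots> = (\<Sum>p\<in>?I. cnj (c p) * c p)"
      by (simp only: integral_mult_right_zero c_def)
    finally show ?thesis unfolding S1 by (simp only: mult.commute)
  qed
  have S0: "?S \<ge> 0" by simp
  have wfi: "integrable M (\<lambda>x. (cmod (w x * f x))\<^sup>2)" by (rule bound(1)[OF fV])
  have "?S = cmod (LINT x|M. cnj (f x) * (w x * g x))"
    using S0 by (simp flip: S2)
  also have "\<dots> \<le> (LINT x|M. cmod (cnj (f x) * (w x * g x)))" by (rule integral_norm_bound)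
  \<comment> \<open>Young's inequality, with the parameter A chosen such that after
    \<open>bound(2)\<close> half of \<open>?S\<close> is absorbed on the left.\<close>
  also have "\<dots> \<le> (LINT x|M. (1 / (2 * A)) * (cmod (w x * f x))\<^sup>2 + (A / 2) * (cmod (g x))\<^sup>2)"
  proof (rule integral_mono)
    show "integrable M (\<lambda>x. cmod (cnj (f x) * (w x * g x)))" using fwg[OF fV] by (rule integrable_norm)
    show "integrable M (\<lambda>x. (1 / (2 * A)) * (cmod (w x * f x))\<^sup>2 + (A / 2) * (cmod (g x))\<^sup>2)"
      using wfi gi by (intro Bochner_Integration.integrable_add integrable_mult_right)
    fix x
    have "0 \<le> (1 / (2 * A)) * (cmod (w x * f x) - A * cmod (g x))\<^sup>2" using A by simp
    also have "\<dots> = (1 / (2 * A)) * (cmod (w x * f x))\<^sup>2 + (A / 2) * (cmod (g x))\<^sup>2 - cmod (w x * f x) * cmod (g x)"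
      using A by (simp add: field_simps power2_eq_square)
    finally show "cmod (cnj (f x) * (w x * g x)) \<le> (1 / (2 * A)) * (cmod (w x * f x))\<^sup>2 + (A / 2) * (cmod (g x))\<^sup>2"
      by (simp add: norm_mult mult_ac)
  qed
  also have "\<dots> = (1 / (2 * A)) * (LINT x|M. (cmod (w x * f x))\<^sup>2) + (A / 2) * ?G"
    using wfi gi by simp
  also have "\<dots> \<le> (1 / (2 * A)) * (A * ?S) + (A / 2) * ?G"
    using bound(2)[OF fV] A by (intro add_right_mono mult_left_mono) auto
  also have "\<dots> = ?S / 2 + A * ?G / 2" using A by simp
  finally have SG: "?S \<le> A * ?G" by simp
  have "(LINT x|M. (cmod (w x * f x))\<^sup>2) \<le> A * ?S" by (rule bound(2)[OF fV])
  also have "\<dots> \<le> A * (A * ?G)" using SG A by (intro mult_left_mono) auto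
  finally have fin: "(LINT x|M. (cmod (w x * f x))\<^sup>2) \<le> A\<^sup>2 * ?G" by (simp add: power2_eq_square)
  have "(\<integral>\<^sup>+ z. ennreal ((cmod (w z * f z))\<^sup>2) \<partial>M) = ennreal (LINT x|M. (cmod (w x * f x))\<^sup>2)"
    by (rule nn_integral_eq_integral[OF wfi]) simp
  also have "\<dots> \<le> ennreal (A\<^sup>2 * ?G)" using fin by (rule ennreal_leI)
  also have "\<dots> = ennreal (A\<^sup>2) * (\<integral>\<^sup>+ z. ennreal ((cmod (g z))\<^sup>2) \<partial>M)"
    by (subst nn_integral_eq_integral[OF gi]) (auto simp: ennreal_mult)
  finally show ?thesis unfolding P .
qed

section \<open>Integration on \<open>\<Omega>\<close>\<close>

lemma pair_integral_mult:
  fixes f :: "'a \<Rightarrow> complex" and g :: "'b \<Rightarrow> complex"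
  assumes "sigma_finite_measure M" "sigma_finite_measure N"
    and f: "integrable M f" and g: "integrable N g"
  shows "integrable (M \<Otimes>\<^sub>M N) (\<lambda>z. f (fst z) * g (snd z))"
    and "(LINT z|(M \<Otimes>\<^sub>M N). f (fst z) * g (snd z)) = (LINT x|M. f x) * (LINT y|N. g y)"
proof -
  interpret pair_sigma_finite M N using assms by (simp add: pair_sigma_finite_def)
  have [measurable]: "f \<in> borel_measurable M" "g \<in> borel_measurable N" using f g by auto
  show i: "integrable (M \<Otimes>\<^sub>M N) (\<lambda>z. f (fst z) * g (snd z))"
  proof (rule Fubini_integrable)
    show "integrable M (\<lambda>x. \<integral>y. norm (f (fst (x, y)) * g (snd (x, y))) \<partial>N)"
      using f by (simp add: norm_mult)
    show "AE x in M. integrable N (\<lambda>y. f (fst (x, y)) * g (snd (x, y)))"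
      using g by simp
  qed measurable
  show "(LINT z|(M \<Otimes>\<^sub>M N). f (fst z) * g (snd z)) = (LINT x|M. f x) * (LINT y|N. g y)"
    using integral_fst'[OF i] by simp
qed

lemma sigma_finite_sphere_measure: "sigma_finite_measure (sphere_measure :: 'a::euclidean_space measure)"
  using finite_measure_sphere by (rule finite_measure.axioms(1))

lemma Omega_norm_snd_le:
  assumes "\<alpha> \<ge> 0" "z \<in> Omega \<alpha>"
  shows "(\<alpha> + 1) * norm (snd z) \<le> 1"
proof -
  obtain x y where z: "z = (x, y)" by (cases z)
  let ?S = "norm x powr (2 * (\<alpha> + 1)) + (\<alpha> + 1)\<^sup>2 * (norm y)\<^sup>2"
  have "?S powr (1 / (2 * (\<alpha> + 1))) = 1"
    using assms by (simp add: Omega_def rho_def z)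
  then have "?S \<le> 1"
    using assms(1) gr_one_powr[of ?S "1 / (2 * (\<alpha> + 1))"] by force
  then have "((\<alpha> + 1) * norm y)\<^sup>2 \<le> 1"
    using powr_ge_zero[of "norm x" "2 * (\<alpha> + 1)"] unfolding power_mult_distrib by linarith
  then show ?thesis using z power2_le_imp_le[of "(\<alpha> + 1) * norm y" 1] by simp
qed

text \<open>\<open>arccos\<close> is well behaved only on [-1, 1]. On \<Omega> its argument lies in
  [0, 1] because \<open>rho\<close> is 1, so clamping the argument changes nothing there and gives a
  function continuous on the whole space.\<close>

lemma measurable_angle:
  assumes "\<alpha> \<ge> 0"
  shows "(angle \<alpha> :: (real^'n) \<times> (real^'m) \<Rightarrow> real) \<in> borel_measurable (restrict_space borel (Omega \<alpha>))"
proof -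
  have "continuous_on UNIV (\<lambda>z::(real^'n) \<times> (real^'m). arccos (max (-1) (min 1 ((\<alpha> + 1) * norm (snd z)))))"
    by (intro continuous_intros) auto
  then have "(\<lambda>z::(real^'n) \<times> (real^'m). arccos (max (-1) (min 1 ((\<alpha> + 1) * norm (snd z))))) \<in> borel_measurable borel"
    by (rule borel_measurable_continuous_onI)
  then have "(\<lambda>z::(real^'n) \<times> (real^'m). arccos (max (-1) (min 1 ((\<alpha> + 1) * norm (snd z))))) \<in> borel_measurable (restrict_space borel (Omega \<alpha>))"
    by (rule measurable_restrict_space1)
  also have "?this \<longleftrightarrow> ?thesis"
  proof (rule measurable_cong)
    fix z :: "(real^'n) \<times> (real^'m)" assume "z \<in> space (restrict_space borel (Omega \<alpha>))"
    then have z: "z \<in> Omega \<alpha>" by (simp add: space_restrict_space)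
    have "0 \<le> (\<alpha> + 1) * norm (snd z)" using assms by simp
    then have "max (-1) (min 1 ((\<alpha> + 1) * norm (snd z))) = (\<alpha> + 1) * norm (snd z)"
      using Omega_norm_snd_le[OF assms z] by linarith
    moreover have "rho \<alpha> z = 1" using z by (simp add: Omega_def)
    ultimately show "arccos (max (-1) (min 1 ((\<alpha> + 1) * norm (snd z)))) = angle \<alpha> z"
      by (simp add: angle_def)
  qed
  finally show ?thesis .
qed

section \<open>Separation of variables in integrals over \<Omega>\<close>

definition radial_density :: "nat \<Rightarrow> nat \<Rightarrow> real \<Rightarrow> real \<Rightarrow> real" where
  "radial_density n m \<alpha> \<phi> = sin \<phi> powr ((real n - 2) / (\<alpha> + 1) + 1) * cos \<phi> ^ (m - 1)"

lemma borel_measurable_radial_density [measurable]: "radial_density n m \<alpha> \<in> borel_measurable borel"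
  unfolding radial_density_def[abs_def] by measurable

lemma radial_density_nonneg: "\<phi> \<in> {0..pi/2} \<Longrightarrow> radial_density n m \<alpha> \<phi> \<ge> 0"
  using sin_cos_nonneg[of \<phi>] by (simp add: radial_density_def)

text \<open>\<open>Omega_measure\<close> is the image of a product measure with a density in \<phi>
  alone, so Fubini separates the variables after pulling the integrand back along
  \<open>polar_map\<close>.\<close>

lemma Omega_integral_product:
  fixes F :: "real \<Rightarrow> real" and U :: "real^'n \<Rightarrow> complex" and V :: "real^'m \<Rightarrow> complex"
  assumes \<alpha>: "\<alpha> \<ge> 0" and m: "CARD('m) \<ge> 2"
    and [measurable]: "F \<in> borel_measurable borel" "U \<in> borel_measurable borel" "V \<in> borel_measurable borel"
    and F: "set_integrable lborel {0..pi/2} (\<lambda>\<phi>. F \<phi> * radial_density CARD('n) CARD('m) \<alpha> \<phi>)"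
    and U: "integrable sphere_measure U" and V: "integrable sphere_measure V"
  shows "integrable (Omega_measure \<alpha>) (\<lambda>z. of_real (F (angle \<alpha> z)) * U (sgn (fst z)) * V (sgn (snd z)))"
    and "(LINT z|Omega_measure \<alpha>. of_real (F (angle \<alpha> z)) * U (sgn (fst z)) * V (sgn (snd z)))
      = of_real (LINT \<phi>:{0..pi/2}|lborel. F \<phi> * radial_density CARD('n) CARD('m) \<alpha> \<phi>)
        * (LINT x|sphere_measure. U x) * (LINT y|sphere_measure. V y)"
proof -
  let ?D = "radial_density CARD('n) CARD('m) \<alpha>"
  let ?R = "restrict_space lborel {0..pi/2} :: real measure"
  let ?S = "(sphere_measure :: (real^'n) measure) \<Otimes>\<^sub>M (sphere_measure :: (real^'m) measure)"
  define H where "H z = of_real (F (angle \<alpha> z)) * U (sgn (fst z)) * V (sgn (snd z))" for z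
  define W where "W p = of_real (F (fst p) * ?D (fst p)) * (U (fst (snd p)) * V (snd (snd p)))" for p :: "real \<times> (real^'n) \<times> (real^'m)"
  have sgnm: "(sgn :: 'b::euclidean_space \<Rightarrow> 'b) \<in> borel_measurable borel"
    unfolding sgn_div_norm by measurable
  note [measurable] = sgnm
  have fsm: "fst \<in> borel_measurable (restrict_space (borel :: ((real^'n) \<times> (real^'m)) measure) (Omega \<alpha>))"
    "snd \<in> borel_measurable (restrict_space (borel :: ((real^'n) \<times> (real^'m)) measure) (Omega \<alpha>))"
    by (intro measurable_restrict_space1 borel_measurable_continuous_onI continuous_intros)+
  note [measurable] = fsm measurable_angle[OF \<alpha>, where 'n='n and 'm='m]
  have Hm: "H \<in> borel_measurable (restrict_space borel (Omega \<alpha>))"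
    unfolding H_def by measurable
  have HP: "(\<lambda>p. H (polar_map \<alpha> p)) \<in> borel_measurable (polar_measure \<alpha>)"
    by (rule measurable_compose[OF measurable_polar_map[OF \<alpha>] Hm])
  then have HN: "(\<lambda>p. H (polar_map \<alpha> p)) \<in> borel_measurable (?R \<Otimes>\<^sub>M ?S)"
    by (simp add: polar_measure_def)
  have pm: "polar_measure \<alpha> = density (?R \<Otimes>\<^sub>M ?S) (\<lambda>p. ennreal (?D (fst p)))"
    unfolding polar_measure_def radial_density_def by (simp add: split_beta')
  have Rid: "(\<lambda>x. x) \<in> borel_measurable ?R" by (simp add: measurable_restrict_space1)
  have Dm: "(\<lambda>p. ?D (fst p)) \<in> borel_measurable (?R \<Otimes>\<^sub>M ?S)"
    by (rule measurable_compose[OF measurable_fst measurable_compose[OF Rid borel_measurable_radial_density]])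
  have sp: "space (?R \<Otimes>\<^sub>M ?S) = {0..pi/2} \<times> sphere 0 1 \<times> sphere 0 1"
    by (simp add: space_pair_measure space_sphere_measure space_restrict_space)
  have Dnn: "AE p in ?R \<Otimes>\<^sub>M ?S. 0 \<le> ?D (fst p)"
    by (rule AE_I2) (auto simp: sp intro!: radial_density_nonneg)
  have HW: "?D (fst p) *\<^sub>R H (polar_map \<alpha> p) = W p" if p: "p \<in> space (?R \<Otimes>\<^sub>M ?S)" for p
  proof -
    obtain \<phi> \<omega>1 \<omega>2 where q: "p = (\<phi>, \<omega>1, \<omega>2)" "\<phi> \<in> {0..pi/2}" "norm \<omega>1 = 1" "norm \<omega>2 = 1"
      using p by (cases p) (auto simp: sp)
    \<comment> \<open>At the two end points one of the unit vectors is lost and \<open>sgn\<close>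
      returns 0, but the density is 0 there as well: at 0 because \<open>0 powr r = 0\<close>, at
      pi/2 because of \<open>m\<close>.\<close>
    consider "\<phi> = 0" | "\<phi> = pi/2" | "\<phi> \<in> {0<..<pi/2}" using q(2) by force
    then show ?thesis
    proof cases
      case 3
      then show ?thesis
        using sgn_polar_map[OF \<alpha> 3 q(3,4)] angle_polar_map[OF \<alpha> q(2-4)]
        by (simp add: q(1) H_def W_def scaleR_conv_of_real mult_ac)
    next
      case 1
      then show ?thesis by (simp add: q(1) W_def radial_density_def)
    next
      case 2
      then have "cos \<phi> = 0" by (simp only: cos_pi_half)
      then have "?D \<phi> = 0" using m by (simp add: radial_density_def)
      then show ?thesis by (simp add: q(1) W_def)
    qed
  qed
  have i1: "integrable (Omega_measure \<alpha>) H \<longleftrightarrow> integrable (?R \<Otimes>\<^sub>M ?S) W"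
  proof -
    have "integrable (Omega_measure \<alpha>) H \<longleftrightarrow> integrable (polar_measure \<alpha>) (\<lambda>p. H (polar_map \<alpha> p))"
      unfolding Omega_measure_def by (rule integrable_distr_eq[OF measurable_polar_map[OF \<alpha>] Hm])
    also have "\<dots> \<longleftrightarrow> integrable (?R \<Otimes>\<^sub>M ?S) (\<lambda>p. ?D (fst p) *\<^sub>R H (polar_map \<alpha> p))"
      unfolding pm by (rule integrable_density[OF HN Dm Dnn])
    also have "\<dots> \<longleftrightarrow> integrable (?R \<Otimes>\<^sub>M ?S) W"
      by (rule Bochner_Integration.integrable_cong[OF refl HW])
    finally show ?thesis .
  qed
  have i2: "(LINT z|Omega_measure \<alpha>. H z) = (LINT p|(?R \<Otimes>\<^sub>M ?S). W p)"
  proof -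
    have "(LINT z|Omega_measure \<alpha>. H z) = (LINT p|polar_measure \<alpha>. H (polar_map \<alpha> p))"
      unfolding Omega_measure_def by (rule integral_distr[OF measurable_polar_map[OF \<alpha>] Hm])
    also have "\<dots> = (LINT p|(?R \<Otimes>\<^sub>M ?S). ?D (fst p) *\<^sub>R H (polar_map \<alpha> p))"
      unfolding pm by (rule integral_density[OF HN Dm Dnn])
    also have "\<dots> = (LINT p|(?R \<Otimes>\<^sub>M ?S). W p)"
      by (rule Bochner_Integration.integral_cong[OF refl HW])
    finally show ?thesis .
  qed
  have FR: "integrable ?R (\<lambda>\<phi>. complex_of_real (F \<phi> * ?D \<phi>))"
    using F by (subst integrable_restrict_space) (auto simp: set_integrable_def scaleR_conv_of_real simp flip: of_real_mult)
  have FI: "(LINT \<phi>|?R. complex_of_real (F \<phi> * ?D \<phi>)) = of_real (LINT \<phi>:{0..pi/2}|lborel. F \<phi> * ?D \<phi>)"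
  proof -
    have "(LINT \<phi>|?R. complex_of_real (F \<phi> * ?D \<phi>)) = of_real (LINT \<phi>|?R. F \<phi> * ?D \<phi>)"
      by (rule integral_complex_of_real)
    also have "(LINT \<phi>|?R. F \<phi> * ?D \<phi>) = (LINT \<phi>:{0..pi/2}|lborel. F \<phi> * ?D \<phi>)"
      unfolding set_lebesgue_integral_def by (rule integral_restrict_space) simp
    finally show ?thesis .
  qed
  have sR: "sigma_finite_measure ?R"
    by (intro finite_measure.axioms(1) finite_measureI) (simp add: space_restrict_space emeasure_restrict_space)
  have sS: "sigma_finite_measure ?S"
    by (intro sigma_finite_pair_measure sigma_finite_sphere_measure)
  note UV = pair_integral_mult[OF sigma_finite_sphere_measure sigma_finite_sphere_measure U V]
  note W = pair_integral_mult[OF sR sS FR UV(1)]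
  show "integrable (Omega_measure \<alpha>) (\<lambda>z. of_real (F (angle \<alpha> z)) * U (sgn (fst z)) * V (sgn (snd z)))"
    using i1 W(1) unfolding H_def[abs_def] W_def[abs_def] by simp
  show "(LINT z|Omega_measure \<alpha>. of_real (F (angle \<alpha> z)) * U (sgn (fst z)) * V (sgn (snd z)))
      = of_real (LINT \<phi>:{0..pi/2}|lborel. F \<phi> * ?D \<phi>) * (LINT x|sphere_measure. U x) * (LINT y|sphere_measure. V y)"
    using i2 W(2) unfolding H_def[abs_def] W_def[abs_def] FI UV(2) by (simp add: mult.assoc)
qed

section \<open>Radial integrals of the functions \<open>h_fun\<close>\<close>

lemma h_fun_square_density:
  fixes \<alpha> :: real and n m k l j :: nat
  assumes "\<alpha> \<ge> 0" "m \<ge> 2" "\<phi> \<in> {0..pi/2}"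
  defines "N \<equiv> nat \<lfloor>ktilde \<alpha> k l j\<rfloor>" and "a \<equiv> (real n - 2 + 2 * real l) / (2 * (\<alpha> + 1))" and "b \<equiv> real j + real m / 2 - 1"
  shows "(h_fun n m \<alpha> k l j \<phi>)\<^sup>2 * radial_density n m \<alpha> \<phi>
    = jacobi_weight a (2 * j + m - 1) \<phi> * poly ((jacobi_poly N a b)\<^sup>2) (- (sin \<phi>)\<^sup>2)"
proof -
  have s: "sin \<phi> \<ge> 0" using sin_cos_nonneg[OF assms(3)] by simp
  have J: "jacobi N a b (cos (2 * \<phi>)) = poly (jacobi_poly N a b) (- (sin \<phi>)\<^sup>2)"
    by (simp add: poly_jacobi_poly cos_double_sin)
  have h: "h_fun n m \<alpha> k l j \<phi> = cos \<phi> ^ j * (sin \<phi> powr (1 / (\<alpha> + 1))) ^ l * poly (jacobi_poly N a b) (- (sin \<phi>)\<^sup>2)"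
    unfolding J[symmetric] by (simp add: h_fun_def Let_def N_def a_def b_def)
  \<comment> \<open>The prefactors of \<open>h_fun\<close>, squared, merge with the density of
    d\<Omega> into exactly the weight belonging to the Jacobi factor: 2 l / (\<alpha> + 1) + (n - 2)
    / (\<alpha> + 1) = 2 a for the sine, and 2 j + m - 1 = 2 b + 1 for the cosine.\<close>
  have e: "((sin \<phi> powr (1 / (\<alpha> + 1))) ^ l)\<^sup>2 * sin \<phi> powr ((real n - 2) / (\<alpha> + 1) + 1) = sin \<phi> powr (2 * a + 1)"
  proof (cases "sin \<phi> = 0")
    case False
    then have s': "sin \<phi> > 0" using s by simp
    have "((sin \<phi> powr (1 / (\<alpha> + 1))) ^ l)\<^sup>2 = sin \<phi> powr (2 * real l / (\<alpha> + 1))"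
      using s' by (simp add: powr_powr mult.commute flip: powr_realpow power_mult)
    moreover have "2 * real l / (\<alpha> + 1) + ((real n - 2) / (\<alpha> + 1) + 1) = 2 * a + 1"
    proof -
      have "2 * a = (real n - 2 + 2 * real l) / (\<alpha> + 1)"
        by (simp only: a_def mult_divide_mult_cancel_left_if times_divide_eq_right) simp
      then show ?thesis by (simp add: add_divide_distrib diff_divide_distrib)
    qed
    ultimately show ?thesis by (simp only: powr_add[symmetric])
  qed simp
  have c: "cos \<phi> ^ (2 * j + m - 1) = (cos \<phi> ^ j)\<^sup>2 * cos \<phi> ^ (m - 1)"
  proof -
    have "2 * j + m - 1 = 2 * j + (m - 1)" using assms(2) by simp
    then show ?thesis by (simp add: power_add power_mult power2_eq_square power_mult_distrib)
  qed
  have "(h_fun n m \<alpha> k l j \<phi>)\<^sup>2 * radial_density n m \<alpha> \<phi> =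
     (((sin \<phi> powr (1 / (\<alpha> + 1))) ^ l)\<^sup>2 * sin \<phi> powr ((real n - 2) / (\<alpha> + 1) + 1)) * ((cos \<phi> ^ j)\<^sup>2 * cos \<phi> ^ (m - 1))
      * (poly (jacobi_poly N a b) (- (sin \<phi>)\<^sup>2))\<^sup>2"
    unfolding h radial_density_def power_mult_distrib by (simp only: mult_ac)
  then show ?thesis unfolding e c[symmetric] by (simp add: jacobi_weight_def)
qed

lemma h_fun_radial_integral:
  fixes \<alpha> :: real
  assumes \<alpha>: "\<alpha> \<ge> 0" and m: "m \<ge> 2" and n: "n \<ge> 2"
  shows "set_integrable lborel {0..pi/2} (\<lambda>\<phi>. (h_fun n m \<alpha> k l j \<phi>)\<^sup>2 * radial_density n m \<alpha> \<phi>)" (is ?th1)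
    and "(LINT \<phi>:{0..pi/2}|lborel. (h_fun n m \<alpha> k l j \<phi>)\<^sup>2 * radial_density n m \<alpha> \<phi>) > 0" (is ?th2)
proof -
  let ?a = "(real n - 2 + 2 * real l) / (2 * (\<alpha> + 1))"
  have a: "?a \<ge> 0" using n \<alpha> by simp
  note h = h_fun_square_density[OF \<alpha> m, of _ n k l j]
  have "?th1 \<longleftrightarrow> set_integrable lborel {0..pi/2} (\<lambda>\<phi>. jacobi_weight ?a (2 * j + m - 1) \<phi> *
      poly ((jacobi_poly (nat \<lfloor>ktilde \<alpha> k l j\<rfloor>) ?a (real j + real m / 2 - 1))\<^sup>2) (- (sin \<phi>)\<^sup>2))"
    by (rule set_integrable_cong[OF refl refl h])
  then show ?th1 using set_integrable_jacobi[OF a] by (simp only:)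
  have "(LINT \<phi>:{0..pi/2}|lborel. (h_fun n m \<alpha> k l j \<phi>)\<^sup>2 * radial_density n m \<alpha> \<phi>) =
    jacobi_integral ?a (2 * j + m - 1) ((jacobi_poly (nat \<lfloor>ktilde \<alpha> k l j\<rfloor>) ?a (real j + real m / 2 - 1))\<^sup>2)"
    unfolding jacobi_integral_def by (rule set_lebesgue_integral_cong) (use h in auto)
  then show ?th2 using jacobi_integral_pos[OF a, of "real j + real m / 2 - 1"] m by simp
qed

text \<open>The left side is the power -4 \<beta> \<alpha> / (\<alpha> + 1) of a sine in (0, 1], and
  the right side is its value for \<beta> = 1/2. At sin \<phi> = 0 both sides are 0, as
  \<open>0 powr r = 0\<close>.\<close>

lemma psi_weight_square_le:
  fixes \<alpha> \<beta> :: real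
  assumes "\<alpha> \<ge> 0" "0 \<le> \<beta>" "\<beta> \<le> 1/2" "0 \<le> sin \<phi>"
  shows "(psi \<alpha> \<phi> powr (- \<beta>))\<^sup>2 \<le> sin \<phi> powr (- (2 * (\<alpha> / (\<alpha> + 1))))"
proof (cases "sin \<phi> = 0")
  case False
  then have s: "sin \<phi> > 0" "sin \<phi> \<le> 1" using assms by auto
  have "(psi \<alpha> \<phi> powr (- \<beta>))\<^sup>2 = sin \<phi> powr (- (4 * \<beta> * (\<alpha> / (\<alpha> + 1))))"
    using s by (simp add: psi_def powr_powr power2_eq_square field_simps flip: powr_add)
  also have "\<dots> \<le> sin \<phi> powr (- (2 * (\<alpha> / (\<alpha> + 1))))"
  proof (rule powr_mono')
    have "4 * \<beta> * (\<alpha> / (\<alpha> + 1)) \<le> 2 * (\<alpha> / (\<alpha> + 1))"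
      using assms by (intro mult_right_mono) auto
    then show "- (2 * (\<alpha> / (\<alpha> + 1))) \<le> - (4 * \<beta> * (\<alpha> / (\<alpha> + 1)))" by simp
  qed (use s in auto)
  finally show ?thesis .
qed (use assms in \<open>simp add: psi_def\<close>)

text \<open>With K = k + 1 as splitting parameter, M + 1 + 4 N \<le> (m + 2) K makes both terms of
  \<open>jacobi_singular_bound\<close> of order K^\<sigma>. The constant is large enough for both
  cases of the parameter a and does not involve l, j or k.\<close>

lemma h_fun_singular_bound:
  fixes \<alpha> :: nat and n m k l j :: nat
  defines "\<sigma> \<equiv> real \<alpha> / (real \<alpha> + 1)" and "K \<equiv> real k + 1"
    and "I \<equiv> (LINT \<phi>:{0..pi/2}|lborel. (h_fun n m \<alpha> k l j \<phi>)\<^sup>2 * radial_density n m \<alpha> \<phi>)"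
  assumes nm: "(n \<ge> 3 \<and> m \<ge> 2 \<and> \<alpha> \<ge> 1) \<or> (n = 2 \<and> m \<ge> 2 \<and> \<alpha> = 1)"
    and k: "ktilde \<alpha> k l j \<in> \<nat>"
  shows "set_integrable lborel {0..pi/2} (\<lambda>\<phi>. sin \<phi> powr (- (2 * \<sigma>)) * ((h_fun n m \<alpha> k l j \<phi>)\<^sup>2 * radial_density n m \<alpha> \<phi>))" (is ?th1)
    and "(LINT \<phi>:{0..pi/2}|lborel. sin \<phi> powr (- (2 * \<sigma>)) * ((h_fun n m \<alpha> k l j \<phi>)\<^sup>2 * radial_density n m \<alpha> \<phi>))
      \<le> (2 + 2 * (m + 2) * (\<alpha> + 1)) * K powr \<sigma> * I" (is ?th2)
proof -
  define N where "N = nat \<lfloor>ktilde \<alpha> k l j\<rfloor>"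
  define a where "a = (real n - 2 + 2 * real l) / (2 * (real \<alpha> + 1))"
  define b where "b = real j + real m / 2 - 1"
  define M where "M = 2 * j + m - 1"
  have m: "m \<ge> 2" and n: "n \<ge> 2" and \<alpha>: "\<alpha> \<ge> 1" using nm by auto
  have M: "real M = 2 * b + 1" "M \<ge> 1" using m by (auto simp: M_def b_def of_nat_diff)
  have h: "(h_fun n m \<alpha> k l j \<phi>)\<^sup>2 * radial_density n m \<alpha> \<phi>
    = jacobi_weight a M \<phi> * (poly (jacobi_poly N a b) (- (sin \<phi>)\<^sup>2))\<^sup>2" if "\<phi> \<in> {0..pi/2}" for \<phi>
    unfolding a_def b_def N_def M_def poly_power[symmetric]
    by (rule h_fun_square_density) (use m that in auto)
  have I: "I = jacobi_integral a M ((jacobi_poly N a b)\<^sup>2)"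
    unfolding I_def jacobi_integral_def by (rule set_lebesgue_integral_cong) (use h in auto)
  have I0: "I \<ge> 0" unfolding I using jacobi_integral_pos[of a b M N] m n by (simp add: a_def b_def)
  let ?f = "\<lambda>\<phi>. sin \<phi> powr (- (2 * \<sigma>)) * (jacobi_weight a M \<phi> * (poly (jacobi_poly N a b) (- (sin \<phi>)\<^sup>2))\<^sup>2)"
  have N: "real N = ktilde \<alpha> k l j" using k by (auto simp: N_def Nats_def)
  \<comment> \<open>The definition of \<open>ktilde\<close> reads 2 (\<alpha> + 1) N + l + (\<alpha>
    + 1) j = k, hence 2 N + j \<le> k, while M + 1 + 4 N = 2 (2 N + j) + m.\<close>
  have NK: "M + 1 + 4 * N \<le> (m + 2) * K"
  proof -
    have "2 * (real \<alpha> + 1) * N + l + j * (real \<alpha> + 1) = k"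
      unfolding N ktilde_def by (simp add: field_simps)
    then have "(real \<alpha> + 1) * real (2 * N + j) \<le> k" by (simp add: algebra_simps)
    moreover have "1 * real (2 * N + j) \<le> (real \<alpha> + 1) * real (2 * N + j)" by (intro mult_right_mono) auto
    ultimately have "1 * real (2 * N + j) \<le> real k" by (rule order_trans[rotated])
    then have "2 * real N + j \<le> k" by simp
    then have "M + 1 + 4 * N \<le> 2 * real k + m" using m by (simp add: M_def of_nat_diff)
    also have "\<dots> \<le> (m + 2) * K" by (simp add: K_def algebra_simps)
    finally show ?thesis .
  qed
  have K: "K \<ge> 1" by (simp add: K_def)
  have \<sigma>: "0 \<le> \<sigma>" "\<sigma> \<le> 1" by (auto simp: \<sigma>_def)
  have c1: "set_integrable lborel {0..pi/2} (\<lambda>\<phi>. sin \<phi> powr (- (2 * \<sigma>)) * ((h_fun n m \<alpha> k l j \<phi>)\<^sup>2 * radial_density n m \<alpha> \<phi>))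
      \<longleftrightarrow> set_integrable lborel {0..pi/2} ?f"
    by (rule set_integrable_cong) (use h in auto)
  have c2: "(LINT \<phi>:{0..pi/2}|lborel. sin \<phi> powr (- (2 * \<sigma>)) * ((h_fun n m \<alpha> k l j \<phi>)\<^sup>2 * radial_density n m \<alpha> \<phi>))
      = (LINT \<phi>:{0..pi/2}|lborel. ?f \<phi>)"
    by (rule set_lebesgue_integral_cong) (use h in auto)
  have "set_integrable lborel {0..pi/2} ?f \<and>
      (LINT \<phi>:{0..pi/2}|lborel. ?f \<phi>) \<le> (2 + 2 * (m + 2) * (\<alpha> + 1)) * K powr \<sigma> * I"
  proof (cases "n = 2 \<and> l = 0")
    case True
    \<comment> \<open>Here \<sigma> = 1/2, so the singular factor is 1 / sin and sqrt K =
      K^\<sigma>.\<close>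
    then have t: "\<alpha> = 1" "a = 0" using nm by (auto simp: a_def)
    have s: "- (2 * \<sigma>) = -1" by (simp add: \<sigma>_def t)
    have "sqrt (M + 1 + 4 * N) \<le> sqrt ((m + 2) * K)" using NK by simp
    also have "\<dots> = sqrt (m + 2) * sqrt K" by (simp add: real_sqrt_mult)
    also have "\<dots> \<le> (m + 2) * sqrt K" using K by (intro mult_right_mono) (auto simp: real_sqrt_le_iff intro!: real_le_lsqrt simp: power2_eq_square)
    finally have "2 * sqrt (M + 1 + 4 * N) * I \<le> 2 * ((m + 2) * sqrt K) * I"
      using I0 by (intro mult_right_mono mult_left_mono) auto
    also have "\<dots> \<le> (2 + 2 * (m + 2) * (\<alpha> + 1)) * sqrt K * I"
    proof -
      have "2 * (real m + 2) \<le> 2 + 2 * (m + 2) * (\<alpha> + 1)" by (simp add: t)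
      then have "2 * (real m + 2) * (sqrt K * I) \<le> (2 + 2 * (m + 2) * (\<alpha> + 1)) * (sqrt K * I)"
        using I0 K by (intro mult_right_mono) auto
      then show ?thesis by (simp only: mult.assoc of_nat_add of_nat_numeral)
    qed
    also have "sqrt K = K powr \<sigma>" using K by (simp add: powr_half_sqrt[symmetric] \<sigma>_def t)
    finally show ?thesis
      using jacobi_singular_bound_0[OF M(2,1), of N] unfolding s t(2) I by auto
  next
    case False
    \<comment> \<open>A positive integer, which keeps a away from 0 uniformly in l.\<close>
    then have "real n - 2 + 2 * real l \<ge> 1" using n by auto
    then have a: "a \<ge> 1 / (2 * (real \<alpha> + 1))" unfolding a_def
      by (intro divide_right_mono) auto
    have a0: "a > 0" by (rule less_le_trans[OF _ a]) simp
    have "1 / (2 * a) \<le> real \<alpha> + 1"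
      using a a0 by (simp add: field_simps)
    then have "real (M + 1 + 4 * N) * (1 / (2 * a)) \<le> (real m + 2) * K * (real \<alpha> + 1)"
      using NK a0 K by (intro mult_mono) (auto simp: add.commute)
    then have "real (M + 1 + 4 * N) / (2 * a) \<le> (real m + 2) * K * (real \<alpha> + 1)"
      by (simp only: times_divide_eq_right mult_1_right)
    with K have "1 + real (M + 1 + 4 * N) / (2 * a) \<le> K + (real m + 2) * K * (real \<alpha> + 1)"
      by (rule add_mono)
    also have "\<dots> = K * (1 + (real m + 2) * (real \<alpha> + 1))" by (simp add: algebra_simps)
    finally have "K powr (\<sigma> - 1) * (1 + real (M + 1 + 4 * N) / (2 * a)) \<le> K powr (\<sigma> - 1) * (K * (1 + (real m + 2) * (real \<alpha> + 1)))"
      by (rule mult_left_mono) simp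
    also have "\<dots> = K powr \<sigma> * (1 + (real m + 2) * (real \<alpha> + 1))"
      using K by (simp add: powr_diff)
    finally have "K powr \<sigma> + K powr (\<sigma> - 1) * (1 + real (M + 1 + 4 * N) / (2 * a)) \<le> (2 + 1 * ((m + 2) * (\<alpha> + 1))) * K powr \<sigma>"
      by (simp add: algebra_simps)
    also have "\<dots> \<le> (2 + 2 * ((m + 2) * (\<alpha> + 1))) * K powr \<sigma>"
      by (intro mult_right_mono add_left_mono) auto
    finally have "(K powr \<sigma> + K powr (\<sigma> - 1) * (1 + real (M + 1 + 4 * N) / (2 * a))) * I \<le> (2 + 2 * ((m + 2) * (\<alpha> + 1))) * K powr \<sigma> * I"
      using I0 by (rule mult_right_mono)
    then show ?thesis
      using jacobi_singular_bound[OF a0 M(1) \<sigma> K, of N] unfolding I by (auto simp: mult.assoc)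
  qed
  then show ?th1 ?th2 unfolding c1 c2 by auto
qed

section \<open>Integrability and orthonormality of the angular factors\<close>

lemma spherical_harmonic_properties:
  fixes f :: "'a::euclidean_space \<Rightarrow> complex"
  assumes "f \<in> spherical_harmonics l"
  shows "f \<in> borel_measurable borel" and "\<exists>B. \<forall>x. norm (f x) \<le> B"
proof -
  from assms obtain u where u': "f = on_set (sphere 0 1) u" "u \<in> solid_harmonics l"
    unfolding spherical_harmonics_def by (rule imageE)
  from u'(2) have "polynomial_function u"
    unfolding solid_harmonics_def mem_Collect_eq by (rule conjunct1)
  note u = this u'(1)
  have c: "continuous_on S u" for S by (rule continuous_on_polymonial_function[OF u(1)])
  have [measurable]: "u \<in> borel_measurable borel" by (rule borel_measurable_continuous_onI[OF c])
  show "f \<in> borel_measurable borel" unfolding u(2) on_set_def by (rule measurable_If_set) simp_all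
  have "bounded (u ` sphere 0 1)"
    by (intro compact_imp_bounded compact_continuous_image c compact_sphere)
  then obtain B where B: "\<forall>y\<in>u ` sphere 0 1. norm y \<le> B"
    unfolding bounded_iff by blast
  have "norm (f x) \<le> max 0 B" for x
  proof (cases "x \<in> sphere 0 1")
    case True
    then have "f x = u x" by (simp only: u(2) on_set_def if_True)
    then show ?thesis using bspec[OF B imageI[OF True]] by simp
  next
    case False
    then have "f x = 0" by (simp only: u(2) on_set_def if_False)
    then show ?thesis by simp
  qed
  then show "\<exists>B. \<forall>x. norm (f x) \<le> B" by blast
qed

lemma spherical_harmonic_integrable:
  fixes f g :: "'a::euclidean_space \<Rightarrow> complex"
  assumes f: "f \<in> spherical_harmonics l" and g: "g \<in> spherical_harmonics l'"
  shows "(\<lambda>x. f x * cnj (g x)) \<in> borel_measurable borel"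
    and "integrable sphere_measure (\<lambda>x. f x * cnj (g x))"
proof -
  note [measurable] = spherical_harmonic_properties(1)[OF f] spherical_harmonic_properties(1)[OF g]
  obtain A B where A: "\<And>x. norm (f x) \<le> A" and B: "\<And>x. norm (g x) \<le> B"
    using spherical_harmonic_properties(2)[OF f] spherical_harmonic_properties(2)[OF g] by blast
  show m: "(\<lambda>x. f x * cnj (g x)) \<in> borel_measurable borel" by measurable
  have bd: "norm (f x * cnj (g x)) \<le> A * B" for x
    unfolding norm_mult complex_mod_cnj
    by (intro mult_mono A B norm_ge_zero order_trans[OF norm_ge_zero A])
  have "(\<lambda>x. f x * cnj (g x)) \<in> borel_measurable sphere_measure"
    by (subst measurable_cong_sets[OF sets_sphere_measure refl]) (rule measurable_restrict_space1[OF m])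
  then show "integrable sphere_measure (\<lambda>x. f x * cnj (g x))"
    using bd by (intro finite_measure.integrable_const_bound[OF finite_measure_sphere, of _ "A * B"]) auto
qed

text \<open>Within one degree this is the hypothesis on Y; across degrees it is
  \<open>spherical_harmonics_orthogonal\<close>.\<close>

lemma spherical_harmonic_bases_orthonormal:
  fixes Y :: "nat \<Rightarrow> nat \<Rightarrow> 'a::euclidean_space \<Rightarrow> complex"
  assumes Y: "spherical_harmonic_bases Y"
    and p: "p \<in> {1..cdim (spherical_harmonics l :: ('a \<Rightarrow> complex) set)}"
    and p': "p' \<in> {1..cdim (spherical_harmonics l' :: ('a \<Rightarrow> complex) set)}"
  shows "Y l p \<in> spherical_harmonics l"
    and "(LINT x|sphere_measure. Y l p x * cnj (Y l' p' x)) = (if l = l' \<and> p = p' then 1 else 0)"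
proof -
  have ob: "orthonormal_basis sphere_measure (spherical_harmonics l) (Y l)" for l
    using Y by (simp add: spherical_harmonic_bases_def)
  have mem: "Y l p \<in> spherical_harmonics l"
    if "p \<in> {1..cdim (spherical_harmonics l :: ('a \<Rightarrow> complex) set)}" for l p
  proof -
    have s: "cspan (Y l ` {1..cdim (spherical_harmonics l :: ('a \<Rightarrow> complex) set)}) = spherical_harmonics l"
      using ob[of l] unfolding orthonormal_basis_def by blast
    show ?thesis using cfun.span_base[OF imageI[OF that], of "Y l"] unfolding s .
  qed
  show "Y l p \<in> spherical_harmonics l" by (rule mem[OF p])
  show "(LINT x|sphere_measure. Y l p x * cnj (Y l' p' x)) = (if l = l' \<and> p = p' then 1 else 0)"
  proof (cases "l = l'")
    case True
    then have "p' \<in> {1..cdim (spherical_harmonics l :: ('a \<Rightarrow> complex) set)}" using p' by simp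
    with p have "(LINT x|sphere_measure. Y l p x * cnj (Y l p' x)) = (if p = p' then 1 else 0)"
      using ob[of l] unfolding orthonormal_basis_def by blast
    then show ?thesis using True by simp
  next
    case False
    then show ?thesis using spherical_harmonics_orthogonal[OF mem[OF p] mem[OF p']] by simp
  qed
qed

lemma span_finite_family:
  assumes "finite I" "f \<in> cspan (T ` I)"
  shows "\<exists>c. f = (\<lambda>x. \<Sum>i\<in>I. c i * T i x)"
proof -
  let ?W = "range (\<lambda>c x. \<Sum>i\<in>I. c i * T i x)"
  have "cspan (T ` I) \<subseteq> ?W"
  proof (rule cfun.span_minimal)
    show "T ` I \<subseteq> ?W"
    proof (intro image_subsetI)
      fix i assume i: "i \<in> I"
      have "T i = (\<lambda>x. \<Sum>j\<in>I. (if j = i then 1 else 0) * T j x)"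
      proof
        fix x
        have "(\<Sum>j\<in>I. (if j = i then 1 else 0) * T j x) = (\<Sum>j\<in>I. if j = i then T i x else 0)"
          by (intro sum.cong refl) simp
        then show "T i x = (\<Sum>j\<in>I. (if j = i then 1 else 0) * T j x)"
          using i assms(1) by simp
      qed
      then show "T i \<in> ?W" by (rule range_eqI[where x="\<lambda>j. if j = i then 1 else 0"])
    qed
    show "cfun.subspace ?W"
    proof (rule cfun.subspaceI)
      have "(0 :: 'b \<Rightarrow> complex) = (\<lambda>x. \<Sum>i\<in>I. 0 * T i x)" by (simp add: fun_eq_iff)
      then show "0 \<in> ?W" by (rule range_eqI[where x="\<lambda>_. 0"])
    next
      fix f g assume "f \<in> ?W" "g \<in> ?W"
      then obtain c d where cd: "f = (\<lambda>x. \<Sum>i\<in>I. c i * T i x)" "g = (\<lambda>x. \<Sum>i\<in>I. d i * T i x)" by blast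
      have "f + g = (\<lambda>x. \<Sum>i\<in>I. (c i + d i) * T i x)"
        unfolding cd by (rule ext) (simp add: distrib_right sum.distrib)
      then show "f + g \<in> ?W" by (rule range_eqI[where x="\<lambda>i. c i + d i"])
    next
      fix a f assume "f \<in> ?W"
      then obtain c where c: "f = (\<lambda>x. \<Sum>i\<in>I. c i * T i x)" by blast
      have "(\<lambda>x. a * f x) = (\<lambda>x. \<Sum>i\<in>I. (a * c i) * T i x)"
        unfolding c by (simp only: sum_distrib_left mult.assoc)
      then show "(\<lambda>x. a * f x) \<in> ?W" by (rule range_eqI[where x="\<lambda>i. a * c i"])
    qed
  qed
  then show ?thesis using assms(2) by blast
qed

section \<open>The orthogonal family spanning \<open>H_space\<close> and the bound for the
  projection\<close>

locale H_family =
  fixes \<alpha> k :: nat and Y :: "nat \<Rightarrow> nat \<Rightarrow> real^'n \<Rightarrow> complex" and Z :: "nat \<Rightarrow> nat \<Rightarrow> real^'m \<Rightarrow> complex"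
  assumes Y: "spherical_harmonic_bases Y" and Z: "spherical_harmonic_bases Z"
    and n: "CARD('n) \<ge> 2" and m: "CARD('m) \<ge> 2"
begin

definition index_set :: "(nat \<times> nat \<times> nat \<times> nat) set" where
  "index_set = {(l, j, p, q). l \<le> k \<and> j \<le> k \<and> ktilde \<alpha> k l j \<in> \<nat> \<and>
     p \<in> {1..cdim (spherical_harmonics l :: (real^'n \<Rightarrow> complex) set)} \<and>
     q \<in> {1..cdim (spherical_harmonics j :: (real^'m \<Rightarrow> complex) set)}}"

definition basis_fun :: "nat \<times> nat \<times> nat \<times> nat \<Rightarrow> (real^'n) \<times> (real^'m) \<Rightarrow> complex" where
  "basis_fun = (\<lambda>(l, j, p, q). on_set (Omega \<alpha>) (\<lambda>z. of_real (h_fun CARD('n) CARD('m) \<alpha> k l j (angle \<alpha> z))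
                               * Y l p (sgn (fst z)) * Z j q (sgn (snd z))))"

lemma finite_index_set: "finite index_set"
proof -
  have "index_set \<subseteq> (\<Union>l\<in>{..k}. \<Union>j\<in>{..k}. {l} \<times> {j} \<times> {1..cdim (spherical_harmonics l :: (real^'n \<Rightarrow> complex) set)}
    \<times> {1..cdim (spherical_harmonics j :: (real^'m \<Rightarrow> complex) set)})"
    by (auto simp: index_set_def)
  then show ?thesis by (rule finite_subset) auto
qed

lemma H_space_eq: "H_space \<alpha> Y Z k = cspan (basis_fun ` index_set)"
proof -
  have "{on_set (Omega \<alpha>) (\<lambda>z. of_real (h_fun CARD('n) CARD('m) \<alpha> k l j (angle \<alpha> z))
                               * Y l p (sgn (fst z)) * Z j q (sgn (snd z))) | l j p q.
        l \<le> k \<and> j \<le> k \<and> ktilde \<alpha> k l j \<in> \<nat> \<and>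
        p \<in> {1..cdim (spherical_harmonics l :: (real^'n \<Rightarrow> complex) set)} \<and>
        q \<in> {1..cdim (spherical_harmonics j :: (real^'m \<Rightarrow> complex) set)}} = basis_fun ` index_set"
    unfolding index_set_def basis_fun_def by (simp add: image_Collect)
  then show ?thesis unfolding H_space_def by (rule arg_cong)
qed

lemma borel_measurable_radial: "h_fun CARD('n) CARD('m) \<alpha> k (fst i) (fst (snd i)) \<in> borel_measurable borel"
  unfolding h_fun_def jacobi_def Let_def by measurable

text \<open>For fixed k the numbers l and j determine the radial factor, so distinct indices differ
  in one of the two spherical harmonics and the integral over that sphere is 0, whatever the weight
  v is.\<close>

lemma weighted_inner_product:
  assumes ij: "i \<in> index_set" "j \<in> index_set"
    and v: "v \<in> borel_measurable borel" "\<And>\<phi>. v \<phi> \<ge> 0"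
      "set_integrable lborel {0..pi/2} (\<lambda>\<phi>. v \<phi> * ((h_fun CARD('n) CARD('m) \<alpha> k (fst i) (fst (snd i)) \<phi>)\<^sup>2 * radial_density CARD('n) CARD('m) \<alpha> \<phi>))"
      "set_integrable lborel {0..pi/2} (\<lambda>\<phi>. v \<phi> * ((h_fun CARD('n) CARD('m) \<alpha> k (fst j) (fst (snd j)) \<phi>)\<^sup>2 * radial_density CARD('n) CARD('m) \<alpha> \<phi>))"
  shows "integrable (Omega_measure \<alpha>) (\<lambda>z. of_real (v (angle \<alpha> z)) * (basis_fun i z * cnj (basis_fun j z)))"
    and "(LINT z|Omega_measure \<alpha>. of_real (v (angle \<alpha> z)) * (basis_fun i z * cnj (basis_fun j z)))
      = (if i = j then of_real (LINT \<phi>:{0..pi/2}|lborel. v \<phi> * ((h_fun CARD('n) CARD('m) \<alpha> k (fst i) (fst (snd i)) \<phi>)\<^sup>2 * radial_density CARD('n) CARD('m) \<alpha> \<phi>)) else 0)"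
proof -
  note [measurable] = borel_measurable_radial v(1)
  obtain l1 j1 p1 q1 where i: "i = (l1, j1, p1, q1)" by (cases i)
  obtain l2 j2 p2 q2 where j: "j = (l2, j2, p2, q2)" by (cases j)
  have p: "p1 \<in> {1..cdim (spherical_harmonics l1 :: (real^'n \<Rightarrow> complex) set)}" "p2 \<in> {1..cdim (spherical_harmonics l2 :: (real^'n \<Rightarrow> complex) set)}"
    and q: "q1 \<in> {1..cdim (spherical_harmonics j1 :: (real^'m \<Rightarrow> complex) set)}" "q2 \<in> {1..cdim (spherical_harmonics j2 :: (real^'m \<Rightarrow> complex) set)}"
    using ij unfolding index_set_def i j by blast+
  define F where "F \<phi> = v \<phi> * (h_fun CARD('n) CARD('m) \<alpha> k (fst i) (fst (snd i)) \<phi> * h_fun CARD('n) CARD('m) \<alpha> k (fst j) (fst (snd j)) \<phi>)" for \<phi>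
  define U where "U x = Y l1 p1 x * cnj (Y l2 p2 x)" for x
  define V where "V x = Z j1 q1 x * cnj (Z j2 q2 x)" for x
  have [measurable]: "F \<in> borel_measurable borel" unfolding F_def by measurable
  have Fi: "set_integrable lborel {0..pi/2} (\<lambda>\<phi>. F \<phi> * radial_density CARD('n) CARD('m) \<alpha> \<phi>)"
  proof (rule set_integrable_bound[OF set_integral_add(1)[OF v(3,4)]])
    show "set_borel_measurable lborel {0..pi/2} (\<lambda>\<phi>. F \<phi> * radial_density CARD('n) CARD('m) \<alpha> \<phi>)"
      unfolding set_borel_measurable_def by measurable
    have "norm (F \<phi> * radial_density CARD('n) CARD('m) \<alpha> \<phi>) \<le> norm (v \<phi> * ((h_fun CARD('n) CARD('m) \<alpha> k (fst i) (fst (snd i)) \<phi>)\<^sup>2 * radial_density CARD('n) CARD('m) \<alpha> \<phi>) + v \<phi> * ((h_fun CARD('n) CARD('m) \<alpha> k (fst j) (fst (snd j)) \<phi>)\<^sup>2 * radial_density CARD('n) CARD('m) \<alpha> \<phi>))"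
      if \<phi>: "\<phi> \<in> {0..pi/2}" for \<phi>
    proof -
      have D: "radial_density CARD('n) CARD('m) \<alpha> \<phi> \<ge> 0" by (rule radial_density_nonneg[OF \<phi>])
      have "\<bar>h_fun CARD('n) CARD('m) \<alpha> k (fst i) (fst (snd i)) \<phi> * h_fun CARD('n) CARD('m) \<alpha> k (fst j) (fst (snd j)) \<phi>\<bar> \<le> (h_fun CARD('n) CARD('m) \<alpha> k (fst i) (fst (snd i)) \<phi>)\<^sup>2 + (h_fun CARD('n) CARD('m) \<alpha> k (fst j) (fst (snd j)) \<phi>)\<^sup>2"
      proof -
        have "2 * \<bar>h_fun CARD('n) CARD('m) \<alpha> k (fst i) (fst (snd i)) \<phi>\<bar> * \<bar>h_fun CARD('n) CARD('m) \<alpha> k (fst j) (fst (snd j)) \<phi>\<bar> \<le> \<bar>h_fun CARD('n) CARD('m) \<alpha> k (fst i) (fst (snd i)) \<phi>\<bar>\<^sup>2 + \<bar>h_fun CARD('n) CARD('m) \<alpha> k (fst j) (fst (snd j)) \<phi>\<bar>\<^sup>2" by (rule sum_squares_bound)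
        moreover have "0 \<le> \<bar>h_fun CARD('n) CARD('m) \<alpha> k (fst i) (fst (snd i)) \<phi>\<bar> * \<bar>h_fun CARD('n) CARD('m) \<alpha> k (fst j) (fst (snd j)) \<phi>\<bar>" by simp
        ultimately show ?thesis unfolding abs_mult power2_abs by linarith
      qed
      then have "v \<phi> * \<bar>h_fun CARD('n) CARD('m) \<alpha> k (fst i) (fst (snd i)) \<phi> * h_fun CARD('n) CARD('m) \<alpha> k (fst j) (fst (snd j)) \<phi>\<bar> * radial_density CARD('n) CARD('m) \<alpha> \<phi> \<le> v \<phi> * ((h_fun CARD('n) CARD('m) \<alpha> k (fst i) (fst (snd i)) \<phi>)\<^sup>2 + (h_fun CARD('n) CARD('m) \<alpha> k (fst j) (fst (snd j)) \<phi>)\<^sup>2) * radial_density CARD('n) CARD('m) \<alpha> \<phi>"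
        using v(2) D by (intro mult_right_mono mult_left_mono)
      then have "norm (F \<phi> * radial_density CARD('n) CARD('m) \<alpha> \<phi>) \<le> v \<phi> * ((h_fun CARD('n) CARD('m) \<alpha> k (fst i) (fst (snd i)) \<phi>)\<^sup>2 * radial_density CARD('n) CARD('m) \<alpha> \<phi>) + v \<phi> * ((h_fun CARD('n) CARD('m) \<alpha> k (fst j) (fst (snd j)) \<phi>)\<^sup>2 * radial_density CARD('n) CARD('m) \<alpha> \<phi>)"
        using v(2)[of \<phi>] D by (simp add: F_def abs_mult algebra_simps)
      then show ?thesis by simp
    qed
    then show "AE \<phi> in lborel. \<phi> \<in> {0..pi/2} \<longrightarrow> norm (F \<phi> * radial_density CARD('n) CARD('m) \<alpha> \<phi>) \<le>
        norm (v \<phi> * ((h_fun CARD('n) CARD('m) \<alpha> k (fst i) (fst (snd i)) \<phi>)\<^sup>2 * radial_density CARD('n) CARD('m) \<alpha> \<phi>) + v \<phi> * ((h_fun CARD('n) CARD('m) \<alpha> k (fst j) (fst (snd j)) \<phi>)\<^sup>2 * radial_density CARD('n) CARD('m) \<alpha> \<phi>))" by simp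
  qed
  note Ym = spherical_harmonic_bases_orthonormal[OF Y p] and Ym2 = spherical_harmonic_bases_orthonormal(1)[OF Y p(2,1)]
  note Zm = spherical_harmonic_bases_orthonormal[OF Z q] and Zm2 = spherical_harmonic_bases_orthonormal(1)[OF Z q(2,1)]
  note U = spherical_harmonic_integrable[OF Ym(1) Ym2, folded U_def]
  note V = spherical_harmonic_integrable[OF Zm(1) Zm2, folded V_def]
  have \<alpha>: "real \<alpha> \<ge> 0" by simp
  note O = Omega_integral_product[OF \<alpha> m \<open>F \<in> borel_measurable borel\<close> U(1) V(1) Fi U(2) V(2)]
  have eq: "of_real (v (angle \<alpha> z)) * (basis_fun i z * cnj (basis_fun j z)) = of_real (F (angle \<alpha> z)) * U (sgn (fst z)) * V (sgn (snd z))"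
    if "z \<in> space (Omega_measure \<alpha>)" for z
  proof -
    have "z \<in> Omega \<alpha>" using that by (simp add: Omega_measure_def space_restrict_space)
    then show ?thesis by (simp add: basis_fun_def i j on_set_def F_def U_def V_def)
  qed
  show "integrable (Omega_measure \<alpha>) (\<lambda>z. of_real (v (angle \<alpha> z)) * (basis_fun i z * cnj (basis_fun j z)))"
    by (rule iffD2[OF Bochner_Integration.integrable_cong[OF refl eq] O(1)])
  have "(LINT z|Omega_measure \<alpha>. of_real (v (angle \<alpha> z)) * (basis_fun i z * cnj (basis_fun j z)))
      = of_real (LINT \<phi>:{0..pi/2}|lborel. F \<phi> * radial_density CARD('n) CARD('m) \<alpha> \<phi>) * (LINT x|sphere_measure. U x) * (LINT y|sphere_measure. V y)"
    by (rule trans[OF Bochner_Integration.integral_cong[OF refl eq] O(2)])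
  also have "\<dots> = (if i = j then of_real (LINT \<phi>:{0..pi/2}|lborel. v \<phi> * ((h_fun CARD('n) CARD('m) \<alpha> k (fst i) (fst (snd i)) \<phi>)\<^sup>2 * radial_density CARD('n) CARD('m) \<alpha> \<phi>)) else 0)"
  proof (cases "i = j")
    case True
    have e: "F \<phi> * radial_density CARD('n) CARD('m) \<alpha> \<phi>
        = v \<phi> * ((h_fun CARD('n) CARD('m) \<alpha> k (fst i) (fst (snd i)) \<phi>)\<^sup>2 * radial_density CARD('n) CARD('m) \<alpha> \<phi>)" for \<phi>
      by (simp add: F_def True power2_eq_square)
    show ?thesis unfolding e using True Ym(2) Zm(2) by (simp add: U_def V_def i j)
  next
    case False
    then have "(LINT x|sphere_measure. U x) = 0 \<or> (LINT y|sphere_measure. V y) = 0"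
      unfolding U_def V_def Ym(2) Zm(2) by (auto simp: i j)
    then show ?thesis using False by auto
  qed
  finally show "(LINT z|Omega_measure \<alpha>. of_real (v (angle \<alpha> z)) * (basis_fun i z * cnj (basis_fun j z)))
      = (if i = j then of_real (LINT \<phi>:{0..pi/2}|lborel. v \<phi> * ((h_fun CARD('n) CARD('m) \<alpha> k (fst i) (fst (snd i)) \<phi>)\<^sup>2 * radial_density CARD('n) CARD('m) \<alpha> \<phi>)) else 0)" .
qed

lemma measurable_Omega:
  "f \<in> borel_measurable (Omega_measure \<alpha>) \<longleftrightarrow> f \<in> borel_measurable (restrict_space borel (Omega \<alpha>))"
  by (rule arg_cong[of _ _ "\<lambda>S. f \<in> S"], rule measurable_cong_sets) (simp_all add: Omega_measure_def)

lemma borel_measurable_basis_fun: "basis_fun i \<in> borel_measurable (Omega_measure \<alpha>)" if i: "i \<in> index_set"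
proof -
  obtain l j p q where i': "i = (l, j, p, q)" by (cases i)
  have p: "p \<in> {1..cdim (spherical_harmonics l :: (real^'n \<Rightarrow> complex) set)}"
    and q: "q \<in> {1..cdim (spherical_harmonics j :: (real^'m \<Rightarrow> complex) set)}"
    using i unfolding index_set_def i' by blast+
  note Ym = spherical_harmonic_properties(1)[OF spherical_harmonic_bases_orthonormal(1)[OF Y p p]]
    and Zm = spherical_harmonic_properties(1)[OF spherical_harmonic_bases_orthonormal(1)[OF Z q q]]
  have sgnm: "(sgn :: 'b::euclidean_space \<Rightarrow> 'b) \<in> borel_measurable borel"
    unfolding sgn_div_norm by measurable
  have fsm: "fst \<in> borel_measurable (restrict_space (borel :: ((real^'n) \<times> (real^'m)) measure) (Omega \<alpha>))"
    "snd \<in> borel_measurable (restrict_space (borel :: ((real^'n) \<times> (real^'m)) measure) (Omega \<alpha>))"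
    by (intro measurable_restrict_space1 borel_measurable_continuous_onI continuous_intros)+
  have 1: "(\<lambda>z. Y l p (sgn (fst z))) \<in> borel_measurable (restrict_space (borel :: ((real^'n) \<times> (real^'m)) measure) (Omega \<alpha>))"
    by (rule measurable_compose[OF measurable_compose[OF fsm(1) sgnm] Ym])
  have 2: "(\<lambda>z. Z j q (sgn (snd z))) \<in> borel_measurable (restrict_space (borel :: ((real^'n) \<times> (real^'m)) measure) (Omega \<alpha>))"
    by (rule measurable_compose[OF measurable_compose[OF fsm(2) sgnm] Zm])
  have 3: "(\<lambda>z. h_fun CARD('n) CARD('m) \<alpha> k l j (angle \<alpha> z)) \<in> borel_measurable (restrict_space (borel :: ((real^'n) \<times> (real^'m)) measure) (Omega \<alpha>))"
    using measurable_compose[OF measurable_angle[of "real \<alpha>"] borel_measurable_radial[of i]] by (simp add: i')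
  have "(\<lambda>z. of_real (h_fun CARD('n) CARD('m) \<alpha> k l j (angle \<alpha> z)) * Y l p (sgn (fst z)) * Z j q (sgn (snd z)))
      \<in> borel_measurable (restrict_space borel (Omega \<alpha>))"
    using 1 2 3 by measurable
  then show ?thesis
    unfolding measurable_Omega
    by (rule iffD1[OF measurable_cong, rotated]) (simp add: basis_fun_def i' on_set_def space_restrict_space)
qed

text \<open>Parseval's identity with a radial weight. It is applied with v = 1 and with the square
  of the singular weight, so the two norms can be compared coefficient by coefficient.\<close>

lemma weighted_norm_expansion:
  assumes f: "f = (\<lambda>x. \<Sum>i\<in>index_set. c i * basis_fun i x)"
    and v: "v \<in> borel_measurable borel" "\<And>\<phi>. v \<phi> \<ge> 0"
      "\<And>i. i \<in> index_set \<Longrightarrow> set_integrable lborel {0..pi/2} (\<lambda>\<phi>. v \<phi> * ((h_fun CARD('n) CARD('m) \<alpha> k (fst i) (fst (snd i)) \<phi>)\<^sup>2 * radial_density CARD('n) CARD('m) \<alpha> \<phi>))"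
  shows "integrable (Omega_measure \<alpha>) (\<lambda>z. v (angle \<alpha> z) * (cmod (f z))\<^sup>2)"
    and "(LINT z|Omega_measure \<alpha>. v (angle \<alpha> z) * (cmod (f z))\<^sup>2)
      = (\<Sum>i\<in>index_set. (cmod (c i))\<^sup>2 * (LINT \<phi>:{0..pi/2}|lborel. v \<phi> * ((h_fun CARD('n) CARD('m) \<alpha> k (fst i) (fst (snd i)) \<phi>)\<^sup>2 * radial_density CARD('n) CARD('m) \<alpha> \<phi>)))"
proof -
  let ?B = "\<lambda>i j z. of_real (v (angle \<alpha> z)) * (basis_fun i z * cnj (basis_fun j z))"
  let ?J = "\<lambda>i. LINT \<phi>:{0..pi/2}|lborel. v \<phi> * ((h_fun CARD('n) CARD('m) \<alpha> k (fst i) (fst (snd i)) \<phi>)\<^sup>2 * radial_density CARD('n) CARD('m) \<alpha> \<phi>)"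
  have B: "integrable (Omega_measure \<alpha>) (?B i j)" if "i \<in> index_set" "j \<in> index_set" for i j
    by (rule weighted_inner_product(1)[OF that v(1,2) v(3)[OF that(1)] v(3)[OF that(2)]])
  have BI: "(LINT z|Omega_measure \<alpha>. ?B i j z) = (if i = j then of_real (?J i) else 0)" if "i \<in> index_set" "j \<in> index_set" for i j
    by (rule weighted_inner_product(2)[OF that v(1,2) v(3)[OF that(1)] v(3)[OF that(2)]])
  have ff: "complex_of_real (v (angle \<alpha> z) * (cmod (f z))\<^sup>2) = (\<Sum>i\<in>index_set. \<Sum>j\<in>index_set. (c i * cnj (c j)) * ?B i j z)" for z
  proof -
    have "f z * cnj (f z) = (\<Sum>i\<in>index_set. \<Sum>j\<in>index_set. (c i * basis_fun i z) * (cnj (c j) * cnj (basis_fun j z)))"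
      unfolding f cnj_sum complex_cnj_mult sum_product ..
    then show ?thesis
      unfolding of_real_mult complex_norm_square
      by (simp only: sum_distrib_left) (intro sum.cong refl, simp only: mult_ac)
  qed
  have ci: "integrable (Omega_measure \<alpha>) (\<lambda>z. complex_of_real (v (angle \<alpha> z) * (cmod (f z))\<^sup>2))"
    unfolding ff by (intro Bochner_Integration.integrable_sum integrable_mult_right B)
  then show "integrable (Omega_measure \<alpha>) (\<lambda>z. v (angle \<alpha> z) * (cmod (f z))\<^sup>2)"
    by (simp only: complex_of_real_integrable_eq)
  have "complex_of_real (LINT z|Omega_measure \<alpha>. v (angle \<alpha> z) * (cmod (f z))\<^sup>2)
      = (LINT z|Omega_measure \<alpha>. complex_of_real (v (angle \<alpha> z) * (cmod (f z))\<^sup>2))"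
    by (rule integral_complex_of_real[symmetric])
  also have "\<dots> = (\<Sum>i\<in>index_set. (LINT z|Omega_measure \<alpha>. (\<Sum>j\<in>index_set. (c i * cnj (c j)) * ?B i j z)))"
    unfolding ff by (intro Bochner_Integration.integral_sum Bochner_Integration.integrable_sum integrable_mult_right B)
  also have "\<dots> = (\<Sum>i\<in>index_set. \<Sum>j\<in>index_set. (LINT z|Omega_measure \<alpha>. (c i * cnj (c j)) * ?B i j z))"
    by (intro sum.cong refl Bochner_Integration.integral_sum integrable_mult_right B)
  also have "\<dots> = (\<Sum>i\<in>index_set. \<Sum>j\<in>index_set. if i = j then c i * cnj (c i) * of_real (?J i) else 0)"
    unfolding integral_mult_right_zero by (intro sum.cong refl) (simp only: BI, simp)
  also have "\<dots> = (\<Sum>i\<in>index_set. c i * cnj (c i) * of_real (?J i))"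
    by (intro sum.cong refl) (simp add: finite_index_set)
  also have "\<dots> = complex_of_real (\<Sum>i\<in>index_set. (cmod (c i))\<^sup>2 * ?J i)"
    unfolding of_real_sum of_real_mult complex_norm_square ..
  finally show "(LINT z|Omega_measure \<alpha>. v (angle \<alpha> z) * (cmod (f z))\<^sup>2) = (\<Sum>i\<in>index_set. (cmod (c i))\<^sup>2 * ?J i)"
    by (simp only: of_real_eq_iff)
qed

text \<open>\<open>G_kernel\<close> selects its basis with \<open>SOME\<close>; existence ensures
  that the selected sequence is an orthonormal basis.\<close>

lemma orthonormal_basis_exists: "\<exists>e. orthonormal_basis (Omega_measure \<alpha>) (H_space \<alpha> Y Z k) e"
proof -
  have \<alpha>: "real \<alpha> \<ge> 0" by simp
  note h = h_fun_radial_integral[OF \<alpha> m n, of k]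
  have one: "(\<lambda>_. 1) \<in> borel_measurable borel" "\<And>\<phi>::real. (1::real) \<ge> 0" by simp_all
  have s: "set_integrable lborel {0..pi/2} (\<lambda>\<phi>. 1 * ((h_fun CARD('n) CARD('m) \<alpha> k (fst i) (fst (snd i)) \<phi>)\<^sup>2 * radial_density CARD('n) CARD('m) \<alpha> \<phi>))" for i :: "nat \<times> nat \<times> nat \<times> nat"
    using h(1)[of "fst i" "fst (snd i)"] by (simp only: mult_1)
  show ?thesis
    unfolding H_space_eq
  proof (rule orthonormal_basis_of_orthogonal_family[OF finite_index_set])
    fix i j assume ij: "i \<in> index_set" "j \<in> index_set"
    show "integrable (Omega_measure \<alpha>) (\<lambda>x. basis_fun i x * cnj (basis_fun j x))"
      using weighted_inner_product(1)[OF ij one s s] by (simp only: of_real_1 mult_1)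
    show "(LINT x|Omega_measure \<alpha>. basis_fun i x * cnj (basis_fun j x)) = 0" if "i \<noteq> j"
      using weighted_inner_product(2)[OF ij one s s] that by (simp only: of_real_1 mult_1 if_False)
  next
    fix i assume i: "i \<in> index_set"
    show "(LINT x|Omega_measure \<alpha>. basis_fun i x * cnj (basis_fun i x)) = of_real (LINT \<phi>:{0..pi/2}|lborel. (h_fun CARD('n) CARD('m) \<alpha> k (fst i) (fst (snd i)) \<phi>)\<^sup>2 * radial_density CARD('n) CARD('m) \<alpha> \<phi>)"
      using weighted_inner_product(2)[OF i i one s s] by (simp only: of_real_1 mult_1 if_True simp_thms)
    show "(LINT \<phi>:{0..pi/2}|lborel. (h_fun CARD('n) CARD('m) \<alpha> k (fst i) (fst (snd i)) \<phi>)\<^sup>2 * radial_density CARD('n) CARD('m) \<alpha> \<phi>) > 0"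
      by (rule h(2))
  qed
qed

lemma weighted_P_proj_bound:
  fixes \<beta> :: real and g :: "(real^'n) \<times> (real^'m) \<Rightarrow> complex"
  defines "\<sigma> \<equiv> real \<alpha> / (real \<alpha> + 1)" and "C \<equiv> 2 + 2 * (CARD('m) + 2) * (\<alpha> + 1)"
  assumes nm: "(CARD('n) \<ge> 3 \<and> CARD('m) \<ge> 2 \<and> \<alpha> \<ge> 1) \<or> (CARD('n) = 2 \<and> CARD('m) \<ge> 2 \<and> \<alpha> = 1)"
    and \<beta>: "0 \<le> \<beta>" "\<beta> \<le> 1/2"
    and g: "square_integrable (Omega_measure \<alpha>) g"
  shows "(\<integral>\<^sup>+ z. ennreal ((cmod (psi_weight \<alpha> \<beta> z *
           P_proj \<alpha> Y Z k (\<lambda>\<zeta>. psi_weight \<alpha> \<beta> \<zeta> * g \<zeta>) z))\<^sup>2) \<partial>Omega_measure \<alpha>)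
      \<le> ennreal ((C * (real k + 1) powr \<sigma>)\<^sup>2) * (\<integral>\<^sup>+ z. ennreal ((cmod (g z))\<^sup>2) \<partial>Omega_measure \<alpha>)"
proof -
  let ?M = "Omega_measure \<alpha> :: ((real^'n) \<times> (real^'m)) measure"
  let ?w = "psi_weight \<alpha> \<beta> :: (real^'n) \<times> (real^'m) \<Rightarrow> complex"
  let ?h = "\<lambda>i \<phi>. (h_fun CARD('n) CARD('m) \<alpha> k (fst i) (fst (snd i)) \<phi>)\<^sup>2 * radial_density CARD('n) CARD('m) \<alpha> \<phi>"
  let ?A = "C * (real k + 1) powr \<sigma>"
  define e where "e = (SOME e. orthonormal_basis ?M (H_space \<alpha> Y Z k) e)"
  define v where "v \<phi> = (psi \<alpha> \<phi> powr (- \<beta>))\<^sup>2" for \<phi>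
  have v: "v \<in> borel_measurable borel" "\<And>\<phi>. v \<phi> \<ge> 0"
    unfolding v_def psi_def by simp_all
  have one: "(\<lambda>_. 1) \<in> borel_measurable borel" "\<And>\<phi>::real. (1::real) \<ge> 0" by simp_all
  have \<alpha>: "real \<alpha> \<ge> 0" by simp
  have h: "set_integrable lborel {0..pi/2} (\<lambda>\<phi>. 1 * ?h i \<phi>)" for i :: "nat \<times> nat \<times> nat \<times> nat"
    using h_fun_radial_integral(1)[OF \<alpha> m n] by (simp only: mult_1)
  have vh: "set_integrable lborel {0..pi/2} (\<lambda>\<phi>. v \<phi> * ?h i \<phi>)"
    and vI: "(LINT \<phi>:{0..pi/2}|lborel. v \<phi> * ?h i \<phi>) \<le> ?A * (LINT \<phi>:{0..pi/2}|lborel. 1 * ?h i \<phi>)"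
    if i: "i \<in> index_set" for i
  proof -
    have kt: "ktilde \<alpha> k (fst i) (fst (snd i)) \<in> \<nat>" using i by (auto simp: index_set_def)
    note s = h_fun_singular_bound[OF nm kt, folded \<sigma>_def]
    have le: "v \<phi> * ?h i \<phi> \<le> sin \<phi> powr (- (2 * \<sigma>)) * ?h i \<phi>" if \<phi>: "\<phi> \<in> {0..pi/2}" for \<phi>
    proof (rule mult_right_mono)
      show "v \<phi> \<le> sin \<phi> powr (- (2 * \<sigma>))"
        unfolding v_def \<sigma>_def using sin_cos_nonneg[OF \<phi>] \<beta>
        by (intro psi_weight_square_le) auto
      show "0 \<le> ?h i \<phi>" using radial_density_nonneg[OF \<phi>] by simp
    qed
    show vh: "set_integrable lborel {0..pi/2} (\<lambda>\<phi>. v \<phi> * ?h i \<phi>)"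
    proof (rule set_integrable_bound[OF s(1)])
      note [measurable] = v(1) borel_measurable_radial
      show "set_borel_measurable lborel {0..pi/2} (\<lambda>\<phi>. v \<phi> * ?h i \<phi>)"
        unfolding set_borel_measurable_def by measurable
      have "norm (v \<phi> * ?h i \<phi>) \<le> norm (sin \<phi> powr (- (2 * \<sigma>)) * ?h i \<phi>)" if \<phi>: "\<phi> \<in> {0..pi/2}" for \<phi>
      proof -
        have "0 \<le> v \<phi> * ?h i \<phi>" using v(2)[of \<phi>] radial_density_nonneg[OF \<phi>] by simp
        then show ?thesis using le[OF \<phi>] by simp
      qed
      then show "AE \<phi> in lborel. \<phi> \<in> {0..pi/2} \<longrightarrow> norm (v \<phi> * ?h i \<phi>) \<le> norm (sin \<phi> powr (- (2 * \<sigma>)) * ?h i \<phi>)"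
        by simp
    qed
    have "(LINT \<phi>:{0..pi/2}|lborel. v \<phi> * ?h i \<phi>) \<le> (LINT \<phi>:{0..pi/2}|lborel. sin \<phi> powr (- (2 * \<sigma>)) * ?h i \<phi>)"
      by (rule set_integral_mono[OF vh s(1) le])
    also have "\<dots> \<le> ?A * (LINT \<phi>:{0..pi/2}|lborel. ?h i \<phi>)"
      using s(2) by (simp add: C_def)
    finally show "(LINT \<phi>:{0..pi/2}|lborel. v \<phi> * ?h i \<phi>) \<le> ?A * (LINT \<phi>:{0..pi/2}|lborel. 1 * ?h i \<phi>)"
      by (simp only: mult_1)
  qed
  have vw: "(cmod (?w z * f z))\<^sup>2 = v (angle \<alpha> z) * (cmod (f z))\<^sup>2" for z f
    by (simp add: psi_weight_def v_def norm_mult power_mult_distrib)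
  have expand: "\<exists>c. f = (\<lambda>x. \<Sum>i\<in>index_set. c i * basis_fun i x)" if "f \<in> H_space \<alpha> Y Z k" for f
    using span_finite_family[OF finite_index_set] that unfolding H_space_eq by blast
  have P: "P_proj \<alpha> Y Z k u z = (LINT \<zeta>|?M. (\<Sum>i\<in>{1..cdim (H_space \<alpha> Y Z k)}. e i z * cnj (e i \<zeta>)) * u \<zeta>)" for u z
    unfolding P_proj_def G_kernel_def Let_def e_def ..
  show ?thesis
    unfolding P
  proof (rule weighted_projection_bound[OF _ _ _ _ _ _ _ g])
    show "orthonormal_basis ?M (H_space \<alpha> Y Z k) e"
      unfolding e_def by (rule someI_ex[OF orthonormal_basis_exists])
    show "?w \<in> borel_measurable ?M"
    proof -
      have "(\<lambda>\<phi>. complex_of_real (psi \<alpha> \<phi> powr (- \<beta>))) \<in> borel_measurable borel"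
        unfolding psi_def by measurable
      then show ?thesis
        unfolding measurable_Omega psi_weight_def by (rule measurable_compose[OF measurable_angle[OF \<alpha>]])
    qed
    show "?A > 0" by (simp add: C_def add_pos_nonneg)
    fix f assume "f \<in> H_space \<alpha> Y Z k"
    then obtain c where c: "f = (\<lambda>x. \<Sum>i\<in>index_set. c i * basis_fun i x)" using expand by blast
    note e1 = weighted_norm_expansion[OF c one h, unfolded mult_1] and ev = weighted_norm_expansion[OF c v vh]
    show "f \<in> borel_measurable ?M"
      unfolding c by (intro borel_measurable_sum borel_measurable_times borel_measurable_const borel_measurable_basis_fun)
    show "integrable ?M (\<lambda>x. (cmod (f x))\<^sup>2)" by (rule e1(1))
    show "integrable ?M (\<lambda>x. (cmod (?w x * f x))\<^sup>2)" unfolding vw by (rule ev(1))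
    \<comment> \<open>Both quadratic forms are diagonal in the coefficients, and \<open>?A\<close>
      bounds all the ratios of radial integrals at once.\<close>
    have "(\<Sum>i\<in>index_set. (cmod (c i))\<^sup>2 * (LINT \<phi>:{0..pi/2}|lborel. v \<phi> * ?h i \<phi>))
      \<le> (\<Sum>i\<in>index_set. (cmod (c i))\<^sup>2 * (?A * (LINT \<phi>:{0..pi/2}|lborel. ?h i \<phi>)))"
      by (intro sum_mono mult_left_mono vI[unfolded mult_1]) simp_all
    also have "\<dots> = ?A * (\<Sum>i\<in>index_set. (cmod (c i))\<^sup>2 * (LINT \<phi>:{0..pi/2}|lborel. ?h i \<phi>))"
      by (simp only: sum_distrib_left mult.left_commute)
    finally have "(LINT x|?M. v (angle \<alpha> x) * (cmod (f x))\<^sup>2) \<le> ?A * (LINT x|?M. (cmod (f x))\<^sup>2)"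
      using ev(2) e1(2) by simp
    then show "(LINT x|?M. (cmod (?w x * f x))\<^sup>2) \<le> ?A * (LINT x|?M. (cmod (f x))\<^sup>2)"
      unfolding vw .
  qed
qed

end

theorem theorem4p15:
  fixes \<alpha> :: nat and \<beta> :: real
  assumes "0 \<le> \<beta>" and "\<beta> < 1/2"
    and "(CARD('n::finite) \<ge> 3 \<and> CARD('m::finite) \<ge> 2 \<and> \<alpha> \<ge> 1) \<or>
         (CARD('n) = 2 \<and> CARD('m) \<ge> 2 \<and> \<alpha> = 1)"
  shows "\<exists>C>0. \<forall>(Y :: nat \<Rightarrow> nat \<Rightarrow> real^'n \<Rightarrow> complex) (Z :: nat \<Rightarrow> nat \<Rightarrow> real^'m \<Rightarrow> complex).
    spherical_harmonic_bases Y \<longrightarrow> spherical_harmonic_bases Z \<longrightarrow>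
    (\<forall>(k::nat) g. square_integrable (Omega_measure (real \<alpha>)) g \<longrightarrow>
      (\<integral>\<^sup>+ z. ennreal ((cmod (psi_weight \<alpha> \<beta> z *
           P_proj \<alpha> Y Z k (\<lambda>\<zeta>. psi_weight \<alpha> \<beta> \<zeta> * g \<zeta>) z))\<^sup>2) \<partial>Omega_measure \<alpha>)
      \<le> ennreal (C * (real k + 1) powr (2 * real \<alpha> / (real \<alpha> + 1)))
          * (\<integral>\<^sup>+ z. ennreal ((cmod (g z))\<^sup>2) \<partial>Omega_measure \<alpha>))"
proof -
  define C where "C = real (2 + 2 * (CARD('m) + 2) * (\<alpha> + 1))"
  have C: "C > 0" by (simp add: C_def add_pos_nonneg)
  show ?thesis
  \<comment> \<open>C (k + 1)^(\<alpha> / (\<alpha> + 1)) bounds the operator norm, and the claim is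
    about the squared norm.\<close>
  proof (intro exI[of _ "C\<^sup>2"] conjI allI impI)
    show "C\<^sup>2 > 0" using C by simp
    fix Y :: "nat \<Rightarrow> nat \<Rightarrow> real^'n \<Rightarrow> complex" and Z :: "nat \<Rightarrow> nat \<Rightarrow> real^'m \<Rightarrow> complex" and k :: nat
      and g :: "(real^'n) \<times> (real^'m) \<Rightarrow> complex"
    assume Y: "spherical_harmonic_bases Y" and Z: "spherical_harmonic_bases Z"
      and g: "square_integrable (Omega_measure (real \<alpha>)) g"
    interpret H_family \<alpha> k Y Z
      by unfold_locales (use Y Z assms(3) in auto)
    have "((real k + 1) powr (real \<alpha> / (real \<alpha> + 1)))\<^sup>2 = (real k + 1) powr (2 * real \<alpha> / (real \<alpha> + 1))"
      by (simp add: power2_eq_square flip: powr_add)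
    then have "(C * (real k + 1) powr (real \<alpha> / (real \<alpha> + 1)))\<^sup>2 = C\<^sup>2 * (real k + 1) powr (2 * real \<alpha> / (real \<alpha> + 1))"
      by (simp only: power_mult_distrib)
    then show "(\<integral>\<^sup>+ z. ennreal ((cmod (psi_weight \<alpha> \<beta> z *
           P_proj \<alpha> Y Z k (\<lambda>\<zeta>. psi_weight \<alpha> \<beta> \<zeta> * g \<zeta>) z))\<^sup>2) \<partial>Omega_measure \<alpha>)
      \<le> ennreal (C\<^sup>2 * (real k + 1) powr (2 * real \<alpha> / (real \<alpha> + 1)))
          * (\<integral>\<^sup>+ z. ennreal ((cmod (g z))\<^sup>2) \<partial>Omega_measure \<alpha>)"
      using weighted_P_proj_bound[OF assms(3) assms(1) less_imp_le[OF assms(2)] g] by (simp only: C_def)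
  qed
qed

end
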